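(* Assume that $1\le k\le N-1$, that for any $v\in\mathcal X$ and any affine hyperplane $\Pi$ in $\mathbb R^N$ one has $v_{\Pi^+},v_{\Pi^-}\in\mathcal X$ (assumption A1'), that problem $(\mathcal P')$ admits minimizers in $\mathcal X$ and any minimizer is a $C^1$ function on $\mathbb R^N$ (assumption A2), and that there exists $j\in\{1,\dots,k\}$ such that $\lambda_j\neq 0$. Let $u\in\mathcal X$ be a minimizer for problem $(\mathcal P')$. Then there exists a $(k-1)$-dimensional affine subspace $V$ of $\mathbb R^N$ such that $u$ is radially symmetric with respect to $V$.
   Context: **Setting.** $\mathcal X$ is a given function space (a set of functions $v:\mathbb R^N\to\mathbb R^n$, with a.e. equal functions identified) whose elements are locally integrable with locally integrable weak gradient $\nabla v$; $|\nabla v|$ is the Euclidean norm of $\nabla v$. A statement that an element of $\mathcal X$ is $C^1$ means it has a $C^1$ representative, which is then used. $F,G_1,\dots,G_k$ are real-valued functions on $\mathbb R^n\times[0,\infty)$ such that for every $v\in\mathcal X$ the functions $x\mapsto F(v(x),|\nabla v(x)|)$ and $x\mapsto G_j(v(x),|\nabla v(x)|)$, $1\le j\le k$, belong to $L^1(\mathbb R^N)$. **Problem $(\mathcal P')$.** Given $\lambda_1,\dots,\lambda_k\in\mathbb R$: minimize $E(u)=\int_{\mathbb R^N}F(u(x),|\nabla u(x)|)\,dx$ over $u\in\mathcal X$ subject to the $k$ constraints $Q_j(u)=\int_{\mathbb R^N}G_j(u(x),|\nabla u(x)|)\,dx=\lambda_j$, $j=1,\dots,k$. A minimizer is a $u\in\mathcal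 X$ satisfying the constraints with $E(u)\le E(v)$ for all $v\in\mathcal X$ satisfying the constraints. **Reflections.** For an affine hyperplane $\Pi$ in $\mathbb R^N$, let $\Pi^+,\Pi^-$ be the two open half-spaces it determines and $s_\Pi$ the reflection across $\Pi$. For $f$ defined on $\mathbb R^N$, set $f_{\Pi^+}(x)=f(x)$ if $x\in\Pi^+\cup\Pi$ and $f_{\Pi^+}(x)=f(s_\Pi(x))$ if $x\in\Pi^-$; set $f_{\Pi^-}(x)=f(x)$ if $x\in\Pi^-\cup\Pi$ and $f_{\Pi^-}(x)=f(s_\Pi(x))$ if $x\in\Pi^+$. **Radial symmetry.** For an affine subspace $V$ of $\mathbb R^N$ let $p_V$ be the orthogonal projection onto $V$. A function $f$ on $\mathbb R^N$ is radially symmetric with respect to $V$ if there is a function $\tilde f$ on $V\times[0,\infty)$ such that $f(x)=\tilde f(p_V(x),|x-p_V(x)|)$ for all $x\in\mathbb R^N$. (A $0$-dimensional affine subspace is a point.) *)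

theory Defs
  imports "HOL-Analysis.Analysis"
begin

text \<open>
  Functions \<open>real ^ 'N \<Rightarrow> real ^ 'n\<close> have as gradient the Jacobian matrix
  \<open>real ^ 'N ^ 'n\<close>: the entry \<open>D x $ i $ j\<close> is the derivative of the \<open>i\<close>-th component in the
  \<open>j\<close>-th coordinate direction, and \<open>norm (D x)\<close> is the Euclidean (Frobenius) norm.
\<close>

definition locally_integrable :: "(real ^ 'N \<Rightarrow> 'b::euclidean_space) \<Rightarrow> bool" where
  "locally_integrable f \<longleftrightarrow> (\<forall>K. compact K \<longrightarrow> f absolutely_integrable_on K)"

definition partial_deriv :: "'N \<Rightarrow> (real ^ 'N \<Rightarrow> real) \<Rightarrow> real ^ 'N \<Rightarrow> real" where
  "partial_deriv j f x = frechet_derivative f (at x) (axis j 1)"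

primrec C_k :: "nat \<Rightarrow> (real ^ 'N \<Rightarrow> real) \<Rightarrow> bool" where
  "C_k 0 f \<longleftrightarrow> continuous_on UNIV f"
| "C_k (Suc m) f \<longleftrightarrow> (\<forall>x. f differentiable at x) \<and> (\<forall>j. C_k m (partial_deriv j f))"

definition test_function :: "(real ^ 'N \<Rightarrow> real) \<Rightarrow> bool" where
  "test_function \<phi> \<longleftrightarrow> (\<forall>m. C_k m \<phi>) \<and> compact (closure {x. \<phi> x \<noteq> 0})"

definition has_weak_gradient ::
    "(real ^ 'N \<Rightarrow> real ^ 'n) \<Rightarrow> (real ^ 'N \<Rightarrow> real ^ 'N ^ 'n) \<Rightarrow> bool" where
  "has_weak_gradient v D \<longleftrightarrow> locally_integrable D \<and>
     (\<forall>\<phi>. test_function \<phi> \<longrightarrow> (\<forall>i j.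
        (LINT x|lebesgue. v x $ i * partial_deriv j \<phi> x) = - (LINT x|lebesgue. D x $ i $ j * \<phi> x)))"

text \<open>
  A weak gradient is unique up to a null set, so the choice below does not affect the integrals
  that are formed with it (Lebesgue measure being complete).
\<close>

definition weak_gradient :: "(real ^ 'N \<Rightarrow> real ^ 'n) \<Rightarrow> real ^ 'N \<Rightarrow> real ^ 'N ^ 'n" where
  "weak_gradient v = (SOME D. has_weak_gradient v D)"

text \<open>
  A set of functions with almost everywhere equal functions identified is represented by the
  union of the equivalence classes, i.e. by a set that is closed under a.e. equality.
\<close>

definition function_space :: "(real ^ 'N \<Rightarrow> real ^ 'n) set \<Rightarrow> bool" where
  "function_space X \<longleftrightarrow>
     (\<forall>v\<in>X. locally_integrable v \<and> (\<exists>D. has_weak_gradient v D)) \<and>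
     (\<forall>v\<in>X. \<forall>w. (AE x in lebesgue. w x = v x) \<longrightarrow> w \<in> X)"

text \<open>
  The integrands are functions on \<open>\<real>\<^sup>n \<times> [0, \<infinity>)\<close>; here their second argument ranges over all
  reals, but they are only ever evaluated at a norm.
\<close>

definition integrand ::
    "(real ^ 'n \<Rightarrow> real \<Rightarrow> real) \<Rightarrow> (real ^ 'N \<Rightarrow> real ^ 'n) \<Rightarrow> real ^ 'N \<Rightarrow> real" where
  "integrand F v x = F (v x) (norm (weak_gradient v x))"

definition functional ::
    "(real ^ 'n \<Rightarrow> real \<Rightarrow> real) \<Rightarrow> (real ^ 'N \<Rightarrow> real ^ 'n) \<Rightarrow> real" where
  "functional F v = (LINT x|lebesgue. integrand F v x)"

definition admissible ::
    "(real ^ 'N \<Rightarrow> real ^ 'n) set \<Rightarrow> nat \<Rightarrow> (nat \<Rightarrow> real ^ 'n \<Rightarrow> real \<Rightarrow> real) \<Rightarrow> (nat \<Rightarrow> real)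
      \<Rightarrow> (real ^ 'N \<Rightarrow> real ^ 'n) set" where
  "admissible X k G lam = {v \<in> X. \<forall>j\<in>{1..k}. functional (G j) v = lam j}"

definition minimizer ::
    "(real ^ 'N \<Rightarrow> real ^ 'n) set \<Rightarrow> (real ^ 'n \<Rightarrow> real \<Rightarrow> real) \<Rightarrow> nat
      \<Rightarrow> (nat \<Rightarrow> real ^ 'n \<Rightarrow> real \<Rightarrow> real) \<Rightarrow> (nat \<Rightarrow> real) \<Rightarrow> (real ^ 'N \<Rightarrow> real ^ 'n) \<Rightarrow> bool" where
  "minimizer X F k G lam u \<longleftrightarrow>
     u \<in> admissible X k G lam \<and> (\<forall>v\<in>admissible X k G lam. functional F u \<le> functional F v)"

definition C1 :: "(real ^ 'N \<Rightarrow> real ^ 'n) \<Rightarrow> bool" where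
  "C1 f \<longleftrightarrow> (\<exists>D :: real ^ 'N \<Rightarrow> real ^ 'N ^ 'n.
     (\<forall>x. (f has_derivative (\<lambda>h. D x *v h)) (at x)) \<and> continuous_on UNIV D)"

definition C1_representative :: "(real ^ 'N \<Rightarrow> real ^ 'n) \<Rightarrow> (real ^ 'N \<Rightarrow> real ^ 'n) \<Rightarrow> bool" where
  "C1_representative u w \<longleftrightarrow> C1 w \<and> (AE x in lebesgue. w x = u x)"

text \<open>
  A hyperplane is given as \<open>{x. a \<bullet> x = b}\<close> with \<open>a \<noteq> 0\<close>; its open half-spaces are
  \<open>{x. a \<bullet> x > b}\<close> (the positive one) and \<open>{x. a \<bullet> x < b}\<close> (the negative one).
\<close>

definition reflection :: "real ^ 'N \<Rightarrow> real \<Rightarrow> real ^ 'N \<Rightarrow> real ^ 'N" where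
  "reflection a b x = x - (2 * (a \<bullet> x - b) / (a \<bullet> a)) *\<^sub>R a"

definition reflect_pos :: "real ^ 'N \<Rightarrow> real \<Rightarrow> (real ^ 'N \<Rightarrow> 'b) \<Rightarrow> real ^ 'N \<Rightarrow> 'b" where
  "reflect_pos a b f x = (if a \<bullet> x \<ge> b then f x else f (reflection a b x))"

definition reflect_neg :: "real ^ 'N \<Rightarrow> real \<Rightarrow> (real ^ 'N \<Rightarrow> 'b) \<Rightarrow> real ^ 'N \<Rightarrow> 'b" where
  "reflect_neg a b f x = (if a \<bullet> x \<le> b then f x else f (reflection a b x))"

definition orth_proj :: "(real ^ 'N) set \<Rightarrow> real ^ 'N \<Rightarrow> real ^ 'N" where
  "orth_proj V x = (THE p. p \<in> V \<and> (\<forall>y\<in>V. orthogonal (x - p) (y - p)))"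

lemma orth_proj_unique:
  assumes "p \<in> V" "\<And>y. y \<in> V \<Longrightarrow> orthogonal (x - p) (y - p)"
  shows "orth_proj V x = p"
  unfolding orth_proj_def
proof (rule the_equality)
  fix q assume q: "q \<in> V \<and> (\<forall>y\<in>V. orthogonal (x - q) (y - q))"
  have "(x - p) \<bullet> (q - p) = 0" "(x - q) \<bullet> (p - q) = 0"
    using assms q by (auto simp: orthogonal_def)
  then have "(q - p) \<bullet> (q - p) = 0"
    by (simp add: inner_diff_left inner_diff_right inner_commute)
  then show "q = p" by simp
qed (use assms in auto)

lemma orth_proj_eq_closest_point:
  assumes "affine V" "V \<noteq> {}"
  shows "orth_proj V x = closest_point V x"
proof (rule orth_proj_unique)
  let ?c = "closest_point V x"
  have "closed V"
    using assms(1) by (rule affine_closed)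
  then show c: "?c \<in> V"
    using assms(2) by (rule closest_point_in_set)
  have le: "(x - ?c) \<bullet> (z - ?c) \<le> 0" if "z \<in> V" for z
    using closest_point_dot[OF affine_imp_convex[OF assms(1)] \<open>closed V\<close> that] .
  show "orthogonal (x - ?c) (y - ?c)" if "y \<in> V" for y
  proof -
    have "2 *\<^sub>R ?c + (-1) *\<^sub>R y \<in> V"
      using mem_affine[OF assms(1) c that, of 2 "-1"] by simp
    from le[OF this] have "- ((x - ?c) \<bullet> (y - ?c)) \<le> 0"
      by (simp add: inner_diff_right inner_diff_left inner_add_right algebra_simps)
    with le[OF that] show ?thesis
      by (simp add: orthogonal_def)
  qed
qed

definition radially_symmetric :: "(real ^ 'N \<Rightarrow> 'b) \<Rightarrow> (real ^ 'N) set \<Rightarrow> bool" where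
  "radially_symmetric f V \<longleftrightarrow>
     (\<exists>g :: real ^ 'N \<Rightarrow> real \<Rightarrow> 'b. \<forall>x. f x = g (orth_proj V x) (norm (x - orth_proj V x)))"

end

theory Submission
  imports Defs "HOL-Homology.Homology"
begin

text \<open>
  An affine functional \<open>\<phi>\<close> (a pair \<open>(a, b)\<close>, standing for \<open>x \<mapsto> a \<bullet> x - b\<close>) splits a minimizer \<open>u\<close> if
  its two half-spaces carry equal shares of all constraints.  Then both functions obtained from
  \<open>u\<close> by reflection across \<open>\<phi> = 0\<close> are minimizers; being \<open>C\<^sup>1\<close>, they force the normal derivative of
  \<open>u\<close> to vanish on the hyperplane.  By the Borsuk--Ulam theorem every \<open>(k + 1)\<close>-dimensional space
  of affine functionals contains a splitting one.

  The symmetry is expressed by the Killing fields \<open>\<phi> \<nabla>\<psi> - \<psi> \<nabla>\<phi>\<close> that annihilate \<open>u\<close>.  If \<open>u\<close> is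
  invariant under the reflections in two orthogonal hyperplanes \<open>\<phi> = 0\<close>, \<open>\<psi> = 0\<close>, then all functionals
  spanned by \<open>\<phi>\<close> and \<open>\<psi>\<close> split \<open>u\<close>, so the field of this pair annihilates \<open>u\<close>.  If \<open>u\<close> is only
  invariant under the reflection in \<open>\<phi> = 0\<close>, the same follows for each \<open>\<psi>\<close> orthogonal to \<open>\<phi>\<close> that
  splits \<open>u\<close>, by passing to the two reflected minimizers; a dimension count then yields a space of
  \<open>N - k + 1\<close> functionals all of whose Killing fields annihilate \<open>u\<close>, and \<open>u\<close> is radially symmetric
  with respect to their common zero set.

  It remains to find one reflection that leaves an arbitrary minimizer invariant.  Each splitting
  \<open>\<phi>\<close> has a partner on either side of \<open>\<phi> = 0\<close>.  Having a common annihilating Killing field on an open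
  set is an equivalence relation on functionals, and by the bracket identity different classes are
  orthogonal; since the splitting functionals meet every hyperplane of functionals, two of them must
  be related everywhere.
\<close>

section \<open>The Borsuk--Ulam theorem\<close>

text \<open>The constants are kept among the affine functionals, which gives these dimension N + 1.
  Every hyperplane of functionals, and also the space of functionals with gradient orthogonal to a
  given one, then has dimension N > k, so each contains a splitting functional. The price is that a
  constant could be returned and that a Killing field could be a translation field; the nonzero
  \<open>lam j\<close> excludes both. The obstacle is the first mirror. The two functions reflected
  across a splitting hyperplane are symmetric and have partners, but these partners may differ, and
  for a function that is merely \<open>C1\<close> no unique continuation carries a relation across
  the hyperplane. Relations are therefore studied on open sets so small that they can no longer
  grow. Orthogonality of classes is accessible even there, because the inner product of two Killing
  fields is a polynomial in x and thus controlled by its values on any open set. The minimal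
  subspace that settles the matter is chosen before the open set, so the local conclusions fit
  together.\<close>

lemma nsphere_eq_top_of_set:
  "nsphere n = top_of_set {x. (\<Sum>i\<le>n. x i ^ 2) = 1 \<and> (\<forall>i>n. x i = 0)}"
  by (simp add: nsphere euclidean_product_topology)

locale orthonormal_frame =
  fixes e :: "nat \<Rightarrow> 'a::euclidean_space"
  assumes orthonormal:
    "\<And>i j. i < DIM('a) \<Longrightarrow> j < DIM('a) \<Longrightarrow> e i \<bullet> e j = (if i = j then 1 else 0)"
begin

definition emb :: "nat \<Rightarrow> (nat \<Rightarrow> real) \<Rightarrow> 'a" where
  "emb n x = (\<Sum>i\<le>n. x i *\<^sub>R e i)"

definition crd :: "nat \<Rightarrow> 'a \<Rightarrow> nat \<Rightarrow> real" where
  "crd n y = (\<lambda>i. if i \<le> n then y \<bullet> e i else 0)"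

definition coord_span :: "nat \<Rightarrow> 'a set" where
  "coord_span n = span (e ` {..n})"

definition coord_sphere :: "nat \<Rightarrow> 'a set" where
  "coord_sphere n = sphere 0 1 \<inter> coord_span n"

definition nat_sphere :: "nat \<Rightarrow> (nat \<Rightarrow> real) set" where
  "nat_sphere n = {x. (\<Sum>i\<le>n. x i ^ 2) = 1 \<and> (\<forall>i>n. x i = 0)}"

text \<open>Radial projection of \<open>f\<close> to the unit sphere, read in coordinates. It turns
  a nowhere vanishing map into a self-map of \<open>nsphere n\<close>, the kind of map that
  \<open>Brouwer_degree2\<close> is about.\<close>

definition normalized :: "nat \<Rightarrow> ('a \<Rightarrow> 'a) \<Rightarrow> (nat \<Rightarrow> real) \<Rightarrow> nat \<Rightarrow> real" where
  "normalized n f x = crd n (f (emb n x) /\<^sub>R norm (f (emb n x)))"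

lemma nsphere_nat_sphere: "nsphere n = top_of_set (nat_sphere n)"
  by (simp add: nsphere_eq_top_of_set nat_sphere_def)

lemma subspace_coord_span: "subspace (coord_span n)"
  by (simp add: coord_span_def)

lemma emb_in_coord_span: "emb n x \<in> coord_span n"
  unfolding emb_def coord_span_def by (intro span_sum span_scale span_base) auto

lemma emb_inner:
  assumes "n < DIM('a)" "j < DIM('a)"
  shows "emb n x \<bullet> e j = (if j \<le> n then x j else 0)"
proof -
  have "emb n x \<bullet> e j = (\<Sum>i\<le>n. x i * (e i \<bullet> e j))"
    by (simp add: emb_def inner_sum_left)
  also have "\<dots> = (\<Sum>i\<le>n. if i = j then x j else 0)"
    using assms by (intro sum.cong) (auto simp: orthonormal)
  finally show ?thesis by simp
qed

lemma emb_crd: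
  assumes "n < DIM('a)" "y \<in> coord_span n"
  shows "emb n (crd n y) = y"
proof -
  have "y \<in> span (e ` {..n})" using assms(2) by (simp add: coord_span_def)
  then show ?thesis
  proof (induction rule: span_induct_alt)
    case base
    then show ?case by (simp add: emb_def crd_def)
  next
    case (step c x y)
    then obtain j where j: "j \<le> n" "x = e j" by auto
    have "emb n (crd n (c *\<^sub>R x + y)) = c *\<^sub>R emb n (crd n x) + emb n (crd n y)"
      by (simp add: emb_def crd_def inner_add_left algebra_simps sum.distrib scaleR_sum_right)
    moreover have "emb n (crd n x) = (\<Sum>i\<le>n. if i = j then e j else 0)"
      unfolding emb_def crd_def using j assms(1) by (intro sum.cong) (auto simp: orthonormal)
    ultimately show ?case using step j by simp
  qed
qed

lemma crd_emb:
  assumes "n < DIM('a)" "\<And>i. i > n \<Longrightarrow> x i = 0"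
  shows "crd n (emb n x) = x"
  using assms by (auto simp: crd_def emb_inner fun_eq_iff)

lemma coord_span_orthogonal: "y \<in> coord_span n \<Longrightarrow> n < j \<Longrightarrow> j < DIM('a) \<Longrightarrow> y \<bullet> e j = 0"
  by (metis emb_crd emb_inner leD order.strict_trans)

lemma norm_emb:
  assumes "n < DIM('a)" shows "(norm (emb n x))\<^sup>2 = (\<Sum>i\<le>n. (x i)\<^sup>2)"
proof -
  have "(norm (emb n x))\<^sup>2 = (\<Sum>i\<le>n. x i * (emb n x \<bullet> e i))"
    by (simp add: power2_norm_eq_inner emb_def inner_sum_right inner_sum_left)
  then show ?thesis using assms by (simp add: emb_inner power2_eq_square)
qed

lemma emb_in_coord_sphere: "n < DIM('a) \<Longrightarrow> x \<in> nat_sphere n \<Longrightarrow> emb n x \<in> coord_sphere n"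
  using norm_emb[of n x] norm_ge_zero[of "emb n x"]
  by (auto simp: coord_sphere_def emb_in_coord_span nat_sphere_def power2_eq_1_iff simp del: norm_ge_zero)

lemma crd_in_nat_sphere:
  assumes "n < DIM('a)" "y \<in> coord_sphere n" shows "crd n y \<in> nat_sphere n"
proof -
  have "(\<Sum>i\<le>n. (crd n y i)\<^sup>2) = (norm y)\<^sup>2"
    using assms emb_crd[of n y] norm_emb[of n "crd n y"] by (simp add: coord_sphere_def)
  then show ?thesis using assms by (auto simp: nat_sphere_def coord_sphere_def crd_def)
qed

lemma continuous_on_emb: "continuous_on A (emb n)"
  unfolding emb_def
  by (intro continuous_on_sum continuous_on_scaleR continuous_on_const
      continuous_on_subset[OF continuous_on_product_coordinates]) auto

lemma continuous_on_crd: "continuous_on A (crd n)"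
  unfolding crd_def
proof (intro continuous_on_coordinatewise_then_product)
  show "continuous_on A (\<lambda>x. if i \<le> n then x \<bullet> e i else 0)" for i
    by (cases "i \<le> n") (auto intro!: continuous_intros)
qed

lemma sgn_in_coord_sphere: "y \<in> coord_span n \<Longrightarrow> y \<noteq> 0 \<Longrightarrow> y /\<^sub>R norm y \<in> coord_sphere n"
  by (auto simp: coord_sphere_def intro: subspace_scale[OF subspace_coord_span])

lemma continuous_map_normalized:
  assumes n: "n < DIM('a)" and f: "continuous_on (coord_sphere n) f" "f ` coord_sphere n \<subseteq> coord_span n - {0}"
  shows "continuous_map (nsphere n) (nsphere n) (normalized n f)"
proof -
  have "continuous_on (nat_sphere n) (f \<circ> emb n)"
    using n by (intro continuous_on_compose continuous_on_emb continuous_on_subset[OF f(1)])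
      (auto simp: emb_in_coord_sphere)
  then have "continuous_on (nat_sphere n) (\<lambda>x. f (emb n x) /\<^sub>R norm (f (emb n x)))"
    using f(2) n emb_in_coord_sphere by (intro continuous_intros) (auto simp: o_def)
  then have "continuous_on (nat_sphere n) (crd n \<circ> (\<lambda>x. f (emb n x) /\<^sub>R norm (f (emb n x))))"
    by (intro continuous_on_compose continuous_on_crd)
  moreover have "normalized n f x \<in> nat_sphere n" if "x \<in> nat_sphere n" for x
    unfolding normalized_def using f(2) n emb_in_coord_sphere[OF n that]
    by (intro crd_in_nat_sphere sgn_in_coord_sphere) auto
  ultimately show ?thesis
    by (auto simp: nsphere_nat_sphere normalized_def o_def)
qed

section \<open>Degree of nowhere vanishing maps on coordinate spheres\<close>

definition deg :: "nat \<Rightarrow> ('a \<Rightarrow> 'a) \<Rightarrow> int" where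
  "deg n f = Brouwer_degree2 n (normalized n f)"

lemma deg_homotopic:
  assumes n: "n < DIM('a)"
    and H: "continuous_on ({0..1} \<times> coord_sphere n) (\<lambda>z. H (fst z) (snd z))"
      "\<And>t x. t \<in> {0..1::real} \<Longrightarrow> x \<in> coord_sphere n \<Longrightarrow> H t x \<in> coord_span n - {0}"
  shows "deg n (H 0) = deg n (H 1)"
  unfolding deg_def
proof (rule Brouwer_degree2_homotopic)
  let ?h = "\<lambda>z. normalized n (H (fst z)) (snd z)"
  have "continuous_on ({0..1} \<times> nat_sphere n) ((\<lambda>z. H (fst z) (snd z)) \<circ> (\<lambda>z. (fst z, emb n (snd z))))"
    using n by (intro continuous_on_compose continuous_on_subset[OF H(1)] continuous_intros
        continuous_on_compose2[OF continuous_on_emb]) (auto simp: emb_in_coord_sphere)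
  then have "continuous_on ({0..1} \<times> nat_sphere n)
     (\<lambda>z. H (fst z) (emb n (snd z)) /\<^sub>R norm (H (fst z) (emb n (snd z))))"
    using H(2) n emb_in_coord_sphere by (intro continuous_intros) (fastforce simp: o_def)+
  then have "continuous_on ({0..1} \<times> nat_sphere n)
     (crd n \<circ> (\<lambda>z. H (fst z) (emb n (snd z)) /\<^sub>R norm (H (fst z) (emb n (snd z)))))"
    by (intro continuous_on_compose continuous_on_crd)
  then have c: "continuous_on ({0..1} \<times> nat_sphere n) ?h"
    by (simp add: normalized_def o_def)
  have "normalized n (H t) x \<in> nat_sphere n" if "x \<in> nat_sphere n" "t \<in> {0..1}" for x t
    unfolding normalized_def using H(2)[OF that(2)] n emb_in_coord_sphere[OF n that(1)]
    by (intro crd_in_nat_sphere sgn_in_coord_sphere) auto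
  then have "continuous_map (prod_topology (top_of_set {0..1}) (nsphere n)) (nsphere n) ?h"
    using c by (auto simp: nsphere_nat_sphere prod_topology_subtopology_eu)
  then show "homotopic_with (\<lambda>x. True) (nsphere n) (nsphere n) (normalized n (H 0)) (normalized n (H 1))"
    unfolding homotopic_with_def by (intro exI[of _ ?h]) auto
qed

lemma normalized_uminus:
  assumes "n < DIM('a)" "\<And>x. x \<in> coord_sphere n \<Longrightarrow> f (- x) = - f x" "x \<in> nat_sphere n"
  shows "normalized n f (\<lambda>i. - x i) = (\<lambda>i. - normalized n f x i)"
proof -
  have "emb n (\<lambda>i. - x i) = - emb n x"
    by (simp add: emb_def sum_negf)
  then show ?thesis
    using assms(2)[OF emb_in_coord_sphere[OF assms(1,3)]] by (auto simp: normalized_def crd_def)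
qed

text \<open>A norm-preserving linear map commutes with the radial projection, so normalizing turns
  the composite into a composite of sphere maps, whose degrees multiply.\<close>

lemma deg_compose_isometry:
  assumes n: "n < DIM('a)" and f: "continuous_on (coord_sphere n) f" "f ` coord_sphere n \<subseteq> coord_span n - {0}"
    and T: "linear T" "\<And>x. norm (T x) = norm x" "T ` coord_span n \<subseteq> coord_span n"
  shows "deg n (T \<circ> f) = deg n T * deg n f"
proof -
  have T0: "T ` coord_sphere n \<subseteq> coord_span n - {0}"
  proof -
    have "T y \<noteq> 0" if "norm y = 1" for y
      using T(2)[of y] that by force
    then show ?thesis using T(3) by (auto simp: coord_sphere_def)
  qed
  have cT: "continuous_on (coord_sphere n) T"
    using T(1) by (simp add: linear_continuous_on linear_conv_bounded_linear)
  have "normalized n (T \<circ> f) x = (normalized n T \<circ> normalized n f) x" if "x \<in> nat_sphere n" for x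
  proof -
    define y where "y = f (emb n x) /\<^sub>R norm (f (emb n x))"
    have y: "y \<in> coord_sphere n"
      unfolding y_def using f(2) emb_in_coord_sphere[OF n that] by (intro sgn_in_coord_sphere) auto
    have "T y = T (f (emb n x)) /\<^sub>R norm (T (f (emb n x)))"
      unfolding y_def by (simp add: T linear_scale)
    moreover have "norm (T y) = 1" using y by (simp add: T coord_sphere_def)
    moreover have "emb n (normalized n f x) = y"
      using emb_crd[OF n] y by (simp add: normalized_def y_def[symmetric] coord_sphere_def)
    ultimately show ?thesis by (simp add: normalized_def)
  qed
  then have "deg n (T \<circ> f) = Brouwer_degree2 n (normalized n T \<circ> normalized n f)"
    unfolding deg_def by (intro Brouwer_degree2_eq) (simp add: nsphere_nat_sphere)
  also have "\<dots> = deg n T * deg n f"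
    unfolding deg_def by (intro Brouwer_degree2_compose continuous_map_normalized n f cT T0)
  finally show ?thesis .
qed

lemma coord_span_Suc: "coord_span n \<subseteq> coord_span (Suc n)"
  unfolding coord_span_def by (intro span_mono) auto

lemma coord_sphere_Suc: "coord_sphere n \<subseteq> coord_sphere (Suc n)"
  using coord_span_Suc by (auto simp: coord_sphere_def)

lemma coord_span_SucI:
  assumes "Suc n < DIM('a)" "y \<in> coord_span (Suc n)" "y \<bullet> e (Suc n) = 0"
  shows "y \<in> coord_span n"
proof -
  have "y = emb n (crd (Suc n) y)"
    using emb_crd[OF assms(1,2)] assms(3) by (simp add: emb_def crd_def)
  then show ?thesis by (metis emb_in_coord_span)
qed

text \<open>
  The cone over the image of the sphere is a null set.  As Lebesgue measure lives on the whole type,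
  the coordinates beyond \<open>n + 1\<close> are carried along unchanged.
\<close>

lemma exists_avoided_direction:
  assumes n: "Suc n < DIM('a)" and p: "p differentiable_on UNIV" "\<And>x. p (- x) = - p x"
  obtains v where "v \<in> coord_span (Suc n)" "norm v = 1" "\<And>y c. y \<in> coord_sphere n \<Longrightarrow> p y = c *\<^sub>R v \<Longrightarrow> c = 0"
proof -
  define P where "P z = emb n (crd n z)" for z
  define Q where "Q z = emb (Suc n) (crd (Suc n) z)" for z
  define A where "A = {z. e (Suc n) \<bullet> z = 0 \<and> P z \<noteq> 0}"
  \<comment> \<open>\<open>q\<close> extends \<open>p\<close> positively homogeneously from the
    sphere to the cone; \<open>P\<close> and \<open>Q\<close> project onto the first n + 1 and n + 2
    coordinates.\<close>
  define q where "q z = norm (P z) *\<^sub>R p (P z /\<^sub>R norm (P z)) + (z - Q z)" for z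
  have lin: "linear (\<lambda>z. emb m (crd m z))" for m
    by (intro linearI) (simp_all add: emb_def crd_def inner_add_left algebra_simps sum.distrib scaleR_sum_right)
  have dP: "P differentiable (at z within X)" and dQ: "Q differentiable (at z within X)" for z X
    using lin[of n] lin[of "Suc n"] unfolding P_def Q_def
    by (auto intro: linear_imp_differentiable)
  have dq: "q differentiable (at z within A)" if "z \<in> A" for z
  proof -
    have Pz: "P z \<noteq> 0" using that by (simp add: A_def)
    have nP: "(\<lambda>z. norm (P z)) differentiable (at z within A)"
      using differentiable_compose[OF _ dP, of norm z A] differentiable_norm_at[OF Pz] 
      by (auto intro: differentiable_at_withinI)
    have "(\<lambda>z. p (P z /\<^sub>R norm (P z))) differentiable (at z within A)"
      by (rule differentiable_compose[of p])
        (use p(1) Pz nP dP in \<open>auto simp: differentiable_on_def intro!: derivative_intros\<close>)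
    with nP show ?thesis
      unfolding q_def[abs_def] by (intro derivative_intros dQ) auto
  qed
  have "negligible A"
    using orthonormal[of "Suc n" "Suc n"] n unfolding A_def
    by (intro negligible_subset[OF negligible_hyperplane[of "e (Suc n)" 0]]) auto
  then have neg: "negligible (q ` A)"
    by (intro negligible_differentiable_image_negligible) (auto simp: differentiable_on_def dq)
  \<comment> \<open>The hyperplane orthogonal to \<open>e 0\<close> is removed as well, so that the
    projection \<open>Q v\<close> of a point outside is nonzero and can be normalized.\<close>
  have "negligible (q ` A \<union> {x. e 0 \<bullet> x = 0})"
    using orthonormal[of 0 0] n by (intro negligible_Un neg negligible_hyperplane) auto
  then have "q ` A \<union> {x. e 0 \<bullet> x = 0} \<noteq> UNIV"
    using non_negligible_UNIV[where 'a='a] by metis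
  then obtain v where v: "v \<notin> q ` A" "e 0 \<bullet> v \<noteq> 0"
    by auto
  define w where "w = Q v"
  have w: "w \<in> coord_span (Suc n)" by (simp add: w_def Q_def emb_in_coord_span)
  have we: "w \<bullet> e i = v \<bullet> e i" if "i \<le> Suc n" for i
    using that n by (simp add: w_def Q_def emb_inner crd_def)
  have "w \<noteq> 0" using we[of 0] v(2) by (auto simp: inner_commute)
  have avoid: "c = 0" if y: "y \<in> coord_sphere n" and c: "p y = c *\<^sub>R w" for y c
  proof (rule ccontr)
    assume "c \<noteq> 0"
    define s where "s = \<bar>1 / c\<bar>"
    \<comment> \<open>Oddness of \<open>p\<close> turns a negative coefficient into a positive one;
      the cone consists of positive multiples only.\<close>
    define y' where "y' = sgn c *\<^sub>R y"
    have "y' \<in> coord_sphere n" using y \<open>c \<noteq> 0\<close> subspace_scale[OF subspace_coord_span] by (simp add: y'_def coord_sphere_def abs_sgn_eq)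
    have "p y' = sgn c *\<^sub>R p y"
      using p(2) \<open>c \<noteq> 0\<close> by (auto simp: y'_def sgn_if)
    then have w_eq: "w = s *\<^sub>R p y'"
      using c \<open>c \<noteq> 0\<close> by (simp add: s_def sgn_if)
    define z where "z = s *\<^sub>R y' + (v - Q v)"
    have y'E: "y' \<in> coord_span n" "norm y' = 1" using \<open>y' \<in> coord_sphere n\<close> by (auto simp: coord_sphere_def)
    have vQ: "(v - Q v) \<bullet> e i = 0" if "i \<le> Suc n" for i
      using we[OF that] by (simp add: w_def inner_diff_left)
    have "P (v - Q v) = 0" "Q (v - Q v) = 0"
      using vQ by (simp_all add: P_def Q_def emb_def crd_def)
    moreover have "P y' = y'" "Q y' = y'"
      using y'E coord_span_Suc emb_crd n by (auto simp: P_def Q_def)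
    moreover have "P (s *\<^sub>R y' + (v - Q v)) = s *\<^sub>R P y' + P (v - Q v)"
      "Q (s *\<^sub>R y' + (v - Q v)) = s *\<^sub>R Q y' + Q (v - Q v)"
      unfolding P_def Q_def by (simp_all only: linear_add[OF lin] linear_scale[OF lin])
    ultimately have PQ: "P z = s *\<^sub>R y'" "Q z = s *\<^sub>R y'" by (simp_all add: z_def)
    have "s > 0" using \<open>c \<noteq> 0\<close> by (simp add: s_def)
    then have "P z \<noteq> 0" using PQ y'E by auto
    moreover have "e (Suc n) \<bullet> z = 0"
      using vQ[of "Suc n"] coord_span_orthogonal[OF y'E(1), of "Suc n"] n by (simp add: z_def inner_add_right inner_commute)
    ultimately have "z \<in> A" by (simp add: A_def)
    moreover have "q z = v"
      using \<open>s > 0\<close> y'E w_eq by (simp add: q_def PQ) (simp add: z_def w_def)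
    ultimately show False using v(1) by auto
  qed
  show thesis
  proof (rule that[of "w /\<^sub>R norm w"])
    show "w /\<^sub>R norm w \<in> coord_span (Suc n)" using w by (intro subspace_scale[OF subspace_coord_span])
    show "norm (w /\<^sub>R norm w) = 1" using \<open>w \<noteq> 0\<close> by simp
    show "c = 0" if "y \<in> coord_sphere n" "p y = c *\<^sub>R (w /\<^sub>R norm w)" for y c
      using avoid[OF that(1), of "c / norm w"] that(2) \<open>w \<noteq> 0\<close> by (simp add: divide_inverse)
  qed
qed

lemma coord_sphere_0: "coord_sphere 0 = {e 0, - e 0}"
proof -
  have *: "e 0 \<bullet> e 0 = 1" using orthonormal[of 0 0] by simp
  then have "norm (e 0) = 1" by (simp add: norm_eq_1)
  have "x \<in> {e 0, - e 0}" if x: "x \<in> coord_sphere 0" for x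
  proof -
    obtain c where "x = c *\<^sub>R e 0" using x by (auto simp: coord_sphere_def coord_span_def span_singleton)
    then show ?thesis using x \<open>norm (e 0) = 1\<close> by (cases "c \<ge> 0") (auto simp: coord_sphere_def)
  qed
  moreover have "c *\<^sub>R e 0 \<in> coord_span 0" for c
    by (auto simp: coord_span_def span_singleton)
  from this[of 1] this[of "- 1"] have "{e 0, - e 0} \<subseteq> coord_sphere 0"
    using \<open>norm (e 0) = 1\<close> by (simp add: coord_sphere_def)
  ultimately show ?thesis by blast
qed

text \<open>Borsuk's theorem, by induction on the dimension.
  \<open>Borsuk_odd_mapping_degree_step\<close> compares the parity of the degree with that on the
  equator, but only for maps that send the equator to itself. By dimension, a differentiable odd map
  avoids some axis on the equator; once that axis is turned to the pole, the image of the equator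
  can be pushed into the equatorial hyperplane without meeting 0.\<close>

lemma odd_deg:
  assumes "n < DIM('a)" "continuous_on (coord_sphere n) f" "f ` coord_sphere n \<subseteq> coord_span n - {0}"
    "\<And>x. x \<in> coord_sphere n \<Longrightarrow> f (- x) = - f x"
  shows "odd (deg n f)"
  using assms
proof (induction n arbitrary: f)
  case 0
  have e0: "e 0 \<in> coord_sphere 0" "- e 0 \<in> coord_sphere 0" using coord_sphere_0 by auto
  have ee: "e 0 \<bullet> e 0 = 1" using orthonormal[of 0 0] by simp
  obtain c where c: "f (e 0) = c *\<^sub>R e 0" "c \<noteq> 0"
    using 0(3) e0 by (auto simp: coord_span_def span_singleton image_subset_iff)
  have f: "f x = c *\<^sub>R x" if "x \<in> coord_sphere 0" for x
    using that coord_sphere_0 c 0(4)[OF e0(1)] by auto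
  have n: "normalized 0 f x = (\<lambda>i. sgn c * x i)" if "x \<in> nat_sphere 0" for x
  proof -
    have "norm (emb 0 x) = 1" using emb_in_coord_sphere[OF 0(1) that] by (simp add: coord_sphere_def)
    then have "f (emb 0 x) /\<^sub>R norm (f (emb 0 x)) = sgn c *\<^sub>R emb 0 x"
      using f[OF emb_in_coord_sphere[OF 0(1) that]] c by (simp add: sgn_if)
    moreover have "crd 0 (emb 0 x) = x" using that by (intro crd_emb 0) (simp add: nat_sphere_def)
    moreover have "crd 0 (sgn c *\<^sub>R emb 0 x) = (\<lambda>i. sgn c * crd 0 (emb 0 x) i)"
      by (auto simp: crd_def)
    ultimately show ?thesis by (simp add: normalized_def)
  qed
  show ?case
  proof (cases "c > 0")
    case True
    then have "deg 0 f = Brouwer_degree2 0 id"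
      unfolding deg_def using n by (intro Brouwer_degree2_eq) (auto simp: nsphere_nat_sphere)
    then show ?thesis by simp
  next
    case False
    then have "deg 0 f = Brouwer_degree2 0 (\<lambda>x i. if i = 0 then - x i else x i)"
      unfolding deg_def using n c by (intro Brouwer_degree2_eq) (auto simp: nsphere_nat_sphere nat_sphere_def fun_eq_iff)
    then show ?thesis by (simp add: Brouwer_degree2_reflection)
  qed
next
  case (Suc n)
  note n = \<open>Suc n < DIM('a)\<close>
  have "compact (coord_sphere (Suc n))"
    by (simp add: coord_sphere_def coord_span_def compact_Int_closed closed_span)
  have "coord_sphere (Suc n) \<noteq> {}"
    using emb_in_coord_sphere[OF n, of "\<lambda>i. if i = 0 then 1 else 0"]
    by (auto simp: nat_sphere_def power2_eq_square if_distrib[of "\<lambda>x. x * _"] cong: if_cong)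
  have "continuous_on (coord_sphere (Suc n)) (\<lambda>x. norm (f x))"
    by (intro continuous_intros Suc.prems)
  from continuous_attains_inf[OF \<open>compact _\<close> \<open>coord_sphere (Suc n) \<noteq> {}\<close> this]
  obtain x0 where x0: "x0 \<in> coord_sphere (Suc n)" "\<And>y. y \<in> coord_sphere (Suc n) \<Longrightarrow> norm (f x0) \<le> norm (f y)"
    by auto
  define d where "d = norm (f x0)"
  have "d > 0" using x0 Suc.prems(3) by (auto simp: d_def)
  obtain g where g: "polynomial_function g" "g ` coord_sphere (Suc n) \<subseteq> coord_span (Suc n)"
    "\<And>x. x \<in> coord_sphere (Suc n) \<Longrightarrow> norm (f x - g x) < d"
    using Stone_Weierstrass_polynomial_function_subspace[OF \<open>compact _\<close> Suc.prems(2) \<open>d > 0\<close> subspace_coord_span, of "Suc n"]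
      Suc.prems(3) by blast
  have S_uminus: "- x \<in> coord_sphere (Suc n)" if "x \<in> coord_sphere (Suc n)" for x
    using that subspace_neg[OF subspace_coord_span] by (auto simp: coord_sphere_def)
  \<comment> \<open>Taking the odd part does not spoil the approximation because \<open>f\<close> is
    odd.\<close>
  define p where "p x = (1/2) *\<^sub>R (g x - g (- x))" for x
  have p_odd: "p (- x) = - p x" for x by (simp add: p_def algebra_simps)
  have dp: "p differentiable_on UNIV"
    unfolding p_def differentiable_on_def
    by (intro ballI differentiable_scaleR differentiable_diff differentiable_const
        differentiable_compose[of g uminus] differentiable_at_polynomial_function[OF g(1)]
        differentiable_minus differentiable_ident)
  have pE: "p x \<in> coord_span (Suc n)" if "x \<in> coord_sphere (Suc n)" for x
    unfolding p_def using that g(2) S_uminus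
    by (intro subspace_scale subspace_diff subspace_coord_span) auto
  have fp: "norm (f x - p x) < norm (f x)" if "x \<in> coord_sphere (Suc n)" for x
  proof -
    have "f x - p x = (1/2) *\<^sub>R ((f x - g x) - (f (- x) - g (- x)))"
      using Suc.prems(4)[OF that] by (simp add: p_def algebra_simps flip: scaleR_add_left)
    then have "norm (f x - p x) \<le> (1/2) * (norm (f x - g x) + norm (f (- x) - g (- x)))"
      using norm_triangle_ineq4[of "f x - g x" "f (- x) - g (- x)"] by simp
    also have "\<dots> < d" using g(3)[OF that] g(3)[OF S_uminus[OF that]] by simp
    finally show ?thesis using x0(2)[OF that] by (simp add: d_def)
  qed
  have cp: "continuous_on (coord_sphere (Suc n)) p"
    using dp differentiable_imp_continuous_on continuous_on_subset by blast
  have p0: "p x \<noteq> 0" if "x \<in> coord_sphere (Suc n)" for x using fp[OF that] by auto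
  have fp_deg: "deg (Suc n) f = deg (Suc n) p"
  proof -
    let ?H = "\<lambda>t x. (1 - t) *\<^sub>R f x + t *\<^sub>R p x"
    have "deg (Suc n) (?H 0) = deg (Suc n) (?H 1)"
    proof (rule deg_homotopic[OF n])
      show "continuous_on ({0..1} \<times> coord_sphere (Suc n)) (\<lambda>z. ?H (fst z) (snd z))"
        by (intro continuous_intros continuous_on_compose2[OF cp] continuous_on_compose2[OF Suc.prems(2)]) auto
      fix t x assume t: "t \<in> {0..1::real}" and x: "x \<in> coord_sphere (Suc n)"
      have "?H t x = f x - t *\<^sub>R (f x - p x)" by (simp add: algebra_simps)
      moreover have "norm (t *\<^sub>R (f x - p x)) < norm (f x)"
        using fp[OF x] t mult_left_le_one_le[of "norm (f x - p x)" t] by simp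
      ultimately have "?H t x \<noteq> 0" by (metis less_irrefl right_minus_eq)
      moreover have "?H t x \<in> coord_span (Suc n)"
        using Suc.prems(3) x pE[OF x] by (intro subspace_add subspace_scale subspace_coord_span) auto
      ultimately show "?H t x \<in> coord_span (Suc n) - {0}" by simp
    qed
    then show ?thesis by simp
  qed
  obtain v where v: "v \<in> coord_span (Suc n)" "norm v = 1" "\<And>y c. y \<in> coord_sphere n \<Longrightarrow> p y = c *\<^sub>R v \<Longrightarrow> c = 0"
    using exists_avoided_direction[OF n dp p_odd] by blast
  define w where "w = v - e (Suc n)"
  \<comment> \<open>The reflection that exchanges the unit vectors \<open>v\<close> and
    \<open>e (Suc n)\<close>; it is the identity if they coincide.\<close>
  define T where "T x = x - (2 * (x \<bullet> w) / (w \<bullet> w)) *\<^sub>R w" for x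
  have eE: "e (Suc n) \<in> coord_span (Suc n)" by (auto simp: coord_span_def intro: span_base)
  have e1: "e (Suc n) \<bullet> e (Suc n) = 1" using orthonormal n by simp
  have v1: "v \<bullet> v = 1" using v(2) by (simp add: norm_eq_1)
  have linT: "linear T"
    by (intro linearI) (simp_all add: T_def inner_add_left algebra_simps add_divide_distrib)
  have TT: "T (T x) = x" for x
    by (cases "w = 0") (simp_all add: T_def inner_diff_left)
  have nT: "norm (T x) = norm x" for x
  proof (cases "w = 0")
    case False
    then have "T x \<bullet> T x = x \<bullet> x"
      by (simp add: T_def inner_diff_left inner_diff_right inner_commute power2_eq_square)
    then show ?thesis by (simp add: norm_eq_sqrt_inner)
  qed (simp add: T_def)
  have TE: "T ` coord_span (Suc n) \<subseteq> coord_span (Suc n)"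
    unfolding T_def w_def using v(1) eE
    by (intro image_subsetI subspace_diff subspace_scale subspace_coord_span) auto
  have Te: "T (e (Suc n)) = v"
  proof (cases "w = 0")
    case False
    have "w \<bullet> w = 2 - 2 * (e (Suc n) \<bullet> v)"
      using e1 v1 by (simp add: w_def inner_diff_left inner_diff_right inner_commute)
    moreover have "e (Suc n) \<bullet> w = e (Suc n) \<bullet> v - 1"
      using e1 by (simp add: w_def inner_diff_right)
    moreover have "w \<bullet> w \<noteq> 0" using False by simp
    ultimately have "2 * (e (Suc n) \<bullet> w) / (w \<bullet> w) = - 1"
      by (simp only: divide_eq_eq) simp
    then show ?thesis by (simp add: T_def w_def)
  qed (simp add: T_def w_def)
  define g where "g = T \<circ> p"
  have g_odd: "g (- x) = - g x" for x
    using linT by (simp add: g_def p_odd linear_neg)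
  have cg: "continuous_on (coord_sphere (Suc n)) g"
    unfolding g_def
    by (intro continuous_on_compose cp) (simp add: linT linear_continuous_on linear_conv_bounded_linear[symmetric])
  have gE: "g x \<in> coord_span (Suc n)" if "x \<in> coord_sphere (Suc n)" for x
    using pE[OF that] TE by (auto simp: g_def)
  have g0: "g x \<noteq> 0" if "x \<in> coord_sphere (Suc n)" for x
    using p0[OF that] nT[of "p x"] by (metis comp_apply g_def norm_eq_zero)
  have g_avoid: "g y \<noteq> c *\<^sub>R e (Suc n)" if "y \<in> coord_sphere n" for y c
  proof
    assume "g y = c *\<^sub>R e (Suc n)"
    then have "T (g y) = c *\<^sub>R v" using Te linT by (simp add: linear_scale)
    then have "p y = c *\<^sub>R v" by (simp add: g_def TT)
    with v(3)[OF that] have "p y = 0" by force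
    then show False using p0 that coord_sphere_Suc by blast
  qed
  have gp_deg: "deg (Suc n) g = deg (Suc n) T * deg (Suc n) p"
    unfolding g_def using p0 pE by (intro deg_compose_isometry n cp linT nT TE) auto
  \<comment> \<open>The factor \<open>1 - \<bar>x \<bullet> e (Suc n)\<bar>\<close> is even in
    \<open>x\<close>, so \<open>H 1\<close> stays odd. It reaches 1 only on the equator, where
    \<open>g\<close> avoids the axis; elsewhere less than the full component is removed, so a
    nonzero vector stays nonzero.\<close>
  define H where "H t x = g x - (t * (1 - \<bar>x \<bullet> e (Suc n)\<bar>) * (g x \<bullet> e (Suc n))) *\<^sub>R e (Suc n)" for t :: real and x
  have H: "H t x \<in> coord_span (Suc n) - {0}" if t: "t \<in> {0..1}" and x: "x \<in> coord_sphere (Suc n)" for t x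
  proof -
    have "H t x \<noteq> 0"
    proof
      assume "H t x = 0"
      then have gx: "g x = (t * (1 - \<bar>x \<bullet> e (Suc n)\<bar>) * (g x \<bullet> e (Suc n))) *\<^sub>R e (Suc n)" (is "_ = ?c *\<^sub>R _")
        by (simp add: H_def)
      then have "g x \<bullet> e (Suc n) = ?c" using e1 by (metis inner_scaleR_left mult.right_neutral)
      moreover have "g x \<bullet> e (Suc n) \<noteq> 0" using gx g0[OF x] by auto
      ultimately have "t * (1 - \<bar>x \<bullet> e (Suc n)\<bar>) = 1" by simp
      moreover have "t * (1 - \<bar>x \<bullet> e (Suc n)\<bar>) \<le> 1 - \<bar>x \<bullet> e (Suc n)\<bar>" if "\<bar>x \<bullet> e (Suc n)\<bar> \<le> 1"
        using t that by (intro mult_left_le_one_le) auto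
      moreover have "\<bar>x \<bullet> e (Suc n)\<bar> \<le> 1"
        using Cauchy_Schwarz_ineq2[of x "e (Suc n)"] x e1 by (simp add: coord_sphere_def norm_eq_sqrt_inner)
      ultimately have "x \<bullet> e (Suc n) = 0" by linarith
      then have "x \<in> coord_sphere n" using x coord_span_SucI[OF n] by (auto simp: coord_sphere_def)
      with g_avoid gx show False by blast
    qed
    then show ?thesis unfolding H_def
      using gE[OF x] eE by (auto intro!: subspace_diff subspace_scale subspace_coord_span)
  qed
  have cH: "continuous_on ({0..1} \<times> coord_sphere (Suc n)) (\<lambda>z. H (fst z) (snd z))"
    unfolding H_def by (intro continuous_intros continuous_on_compose2[OF cg]) auto
  have "deg (Suc n) (H 0) = deg (Suc n) (H 1)"
    by (rule deg_homotopic[OF n cH H])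
  moreover have "H 0 = g" by (simp add: H_def fun_eq_iff)
  ultimately have gH: "deg (Suc n) g = deg (Suc n) (H 1)" by simp
  have cH1: "continuous_on (coord_sphere (Suc n)) (H 1)"
    unfolding H_def by (intro continuous_intros cg)
  have H1_odd: "H 1 (- x) = - H 1 x" for x
    by (simp add: H_def g_odd)
  have H1E: "H 1 x \<in> coord_span n - {0}" if "x \<in> coord_sphere n" for x
  proof -
    have x: "x \<in> coord_sphere (Suc n)" using that coord_sphere_Suc by auto
    have "x \<bullet> e (Suc n) = 0" using that coord_span_orthogonal n by (auto simp: coord_sphere_def)
    then have "H 1 x \<bullet> e (Suc n) = 0" using e1 by (simp add: H_def inner_diff_left)
    then show ?thesis using H[OF _ x, of 1] coord_span_SucI[OF n] by auto
  qed
  have N_Suc: "nat_sphere n \<subseteq> nat_sphere (Suc n)" by (auto simp: nat_sphere_def)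
  have norm_eq: "normalized (Suc n) (H 1) x = normalized n (H 1) x" if "x \<in> nat_sphere n" for x
  proof -
    have "emb (Suc n) x = emb n x" using that by (simp add: emb_def nat_sphere_def)
    moreover have "H 1 (emb n x) \<bullet> e (Suc n) = 0"
      using H1E[OF emb_in_coord_sphere[OF _ that]] n coord_span_orthogonal by auto
    ultimately show ?thesis by (auto simp: normalized_def crd_def fun_eq_iff le_Suc_eq)
  qed
  have H1im: "H 1 ` coord_sphere n \<subseteq> coord_span n - {0}" using H1E by auto
  have "even (Brouwer_degree2 (Suc n) (normalized (Suc n) (H 1))
      - Brouwer_degree2 (Suc n - Suc 0) (normalized (Suc n) (H 1)))"
  proof (rule Borsuk_odd_mapping_degree_step)
    show "continuous_map (nsphere (Suc n)) (nsphere (Suc n)) (normalized (Suc n) (H 1))"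
      using H by (intro continuous_map_normalized n cH1) auto
    show "(normalized (Suc n) (H 1) \<circ> (\<lambda>x i. - x i)) x = ((\<lambda>x i. - x i) \<circ> normalized (Suc n) (H 1)) x"
      if "x \<in> topspace (nsphere (Suc n))" for x
      using normalized_uminus[of "Suc n" "H 1", OF n H1_odd] that by (simp add: nsphere_nat_sphere)
    have "continuous_map (nsphere n) (nsphere n) (normalized n (H 1))"
      using n coord_sphere_Suc H1im by (intro continuous_map_normalized continuous_on_subset[OF cH1]) auto
    then show "normalized (Suc n) (H 1) \<in> topspace (nsphere (Suc n - Suc 0)) \<rightarrow> topspace (nsphere (Suc n - Suc 0))"
      using norm_eq by (auto simp: nsphere_nat_sphere continuous_map_def)
  qed
  moreover have "Brouwer_degree2 n (normalized (Suc n) (H 1)) = deg n (H 1)"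
    unfolding deg_def using norm_eq by (intro Brouwer_degree2_eq) (auto simp: nsphere_nat_sphere)
  moreover have "odd (deg n (H 1))"
    using n coord_sphere_Suc H1im H1_odd by (intro Suc.IH continuous_on_subset[OF cH1]) auto
  ultimately have "odd (deg (Suc n) (H 1))" by (simp add: deg_def)
  \<comment> \<open>An odd product has odd factors, so the unknown degree of \<open>T\<close> does
    no harm.\<close>
  then show ?case
    using gH gp_deg fp_deg by (metis even_mult_iff)
qed

text \<open>If \<open>f\<close> had no zero, its normalization would miss the pole
  \<open>e n\<close> and have degree 0, which is even.\<close>

lemma Borsuk_Ulam_coord_sphere:
  assumes n: "n < DIM('a)" and f: "continuous_on (coord_sphere n) f" "\<And>x. x \<in> coord_sphere n \<Longrightarrow> f (- x) = - f x"
    and fE: "\<And>x. x \<in> coord_sphere n \<Longrightarrow> f x \<in> coord_span n" "\<And>x. x \<in> coord_sphere n \<Longrightarrow> f x \<bullet> e n = 0"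
  shows "\<exists>x\<in>coord_sphere n. f x = 0"
proof (rule ccontr)
  assume "\<not> ?thesis"
  then have f0: "f ` coord_sphere n \<subseteq> coord_span n - {0}" using fE by fastforce
  define x where "x = (\<lambda>i. if i = n then 1 else 0 :: real)"
  have x: "x \<in> nat_sphere n" by (auto simp: nat_sphere_def x_def power2_eq_square if_distrib[of "\<lambda>x. x * _"] cong: if_cong)
  have "normalized n f y n = 0" if "y \<in> nat_sphere n" for y
    using fE(2)[OF emb_in_coord_sphere[OF n that]] by (simp add: normalized_def crd_def)
  moreover have "x n \<noteq> 0" by (simp add: x_def)
  ultimately have "x \<notin> normalized n f ` nat_sphere n" by auto
  then have "deg n f = 0"
    unfolding deg_def using x
    by (intro Brouwer_degree2_nonsurjective continuous_map_normalized n f f0) (auto simp: nsphere_nat_sphere)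
  with odd_deg[OF n f(1) f0 f(2)] show False by simp
qed

end

theorem Borsuk_Ulam:
  fixes L :: "'a::euclidean_space set" and h :: "nat \<Rightarrow> 'a \<Rightarrow> real"
  assumes L: "subspace L" "n < dim L"
    and h: "\<And>j. j < n \<Longrightarrow> continuous_on (sphere 0 1 \<inter> L) (h j)"
      "\<And>j x. j < n \<Longrightarrow> x \<in> sphere 0 1 \<inter> L \<Longrightarrow> h j (- x) = - h j x"
  obtains x where "x \<in> L" "norm x = 1" "\<And>j. j < n \<Longrightarrow> h j x = 0"
proof -
  obtain e :: "nat \<Rightarrow> 'a" where e: "bij_betw e {0..<DIM('a)} Basis"
    using ex_bij_betw_nat_finite[OF finite_Basis] by blast
  interpret orthonormal_frame e
  proof
    fix i j assume "i < DIM('a)" "j < DIM('a)"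
    then show "e i \<bullet> e j = (if i = j then 1 else 0)"
      using e by (subst inner_Basis) (auto simp: bij_betw_def inj_on_def)
  qed
  have n: "n < DIM('a)" using L(2) dim_subset_UNIV[of L] by linarith
  have "dim (coord_span n) = Suc n"
  proof -
    have "inj_on e {..n}" using e n by (auto simp: bij_betw_def inj_on_def)
    moreover have "independent (e ` {..n})"
      using e n by (intro independent_mono[OF independent_Basis]) (auto simp: bij_betw_def)
    ultimately show ?thesis by (simp add: coord_span_def dim_span dim_eq_card_independent card_image)
  qed
  moreover obtain M where M: "subspace M" "M \<subseteq> span L" "dim M = Suc n"
    using choose_subspace_of_subspace[of "Suc n" L] L(2) by auto
  ultimately obtain T where T: "linear T" "T ` coord_span n = M" "\<And>x. x \<in> coord_span n \<Longrightarrow> norm (T x) = norm x"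
    using isometries_subspaces[OF subspace_coord_span M(1), of n] by metis
  have TS: "T x \<in> sphere 0 1 \<inter> L" if "x \<in> coord_sphere n" for x
    using that T M(2) span_eq_iff[THEN iffD2, OF L(1)] by (auto simp: coord_sphere_def)
  \<comment> \<open>The n odd functions become the components along \<open>e 0\<close>, ...,
    \<open>e (n - 1)\<close>. The empty component along \<open>e n\<close> is the one that
    \<open>Borsuk_Ulam_coord_sphere\<close> wants to vanish.\<close>
  define f where "f x = (\<Sum>j<n. h j (T x) *\<^sub>R e j)" for x
  have f_inner: "f x \<bullet> e j = (if j < n then h j (T x) else 0)" if "j < DIM('a)" for x j
  proof -
    have "f x \<bullet> e j = (\<Sum>i<n. if i = j then h j (T x) else 0)"
      unfolding f_def inner_sum_left using n that by (intro sum.cong) (auto simp: orthonormal)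
    then show ?thesis by simp
  qed
  have "\<exists>x\<in>coord_sphere n. f x = 0"
  proof (rule Borsuk_Ulam_coord_sphere[OF n])
    show "continuous_on (coord_sphere n) f"
      unfolding f_def using TS T(1)
      by (intro continuous_on_sum continuous_on_scaleR continuous_on_const
          continuous_on_compose2[OF h(1)]) (auto simp: linear_continuous_on linear_conv_bounded_linear)
    show "f (- x) = - f x" if "x \<in> coord_sphere n" for x
      using h(2)[OF _ TS[OF that]] T(1) by (simp add: f_def linear_neg sum_negf)
    show "f x \<in> coord_span n" for x
      unfolding f_def coord_span_def by (intro span_sum span_scale span_base) auto
    show "f x \<bullet> e n = 0" for x using f_inner[OF n] by simp
  qed
  then obtain x where x: "x \<in> coord_sphere n" "f x = 0" by blast
  show thesis
  proof (rule that[of "T x"])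
    show "h j (T x) = 0" if "j < n" for j
      using f_inner[of j x] x n that by simp
  qed (use TS[OF x(1)] in auto)
qed

section \<open>Weak gradients and classical derivatives\<close>

text \<open>The multiples of \<open>exp (- 1 / t)\<close> by polynomials in \<open>1 / t\<close> are closed under differentiation.\<close>

definition flat :: "real poly \<Rightarrow> real \<Rightarrow> real" where
  "flat p t = (if t > 0 then poly p (1 / t) * exp (- 1 / t) else 0)"

text \<open>The free power \<open>k\<close> carries the induction: passing from \<open>p\<close> to
  \<open>pCons a p\<close> multiplies by \<open>s\<close>, and the power absorbs it.\<close>

lemma tendsto_power_poly_div_exp_0: "((\<lambda>s. s ^ k * poly p s / exp s) \<longlongrightarrow> (0::real)) at_top"
proof (induction p arbitrary: k)
  case (pCons a p)
  have "((\<lambda>s. a * (s ^ k / exp s) + s ^ Suc k * poly p s / exp s) \<longlongrightarrow> a * 0 + 0) at_top"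
    by (intro tendsto_intros tendsto_power_div_exp_0 pCons.IH)
  then show ?case by (simp add: field_simps)
qed simp

text \<open>With s = 1 / t one has ds/dt = - s^2, and the derivative of
  \<open>poly p s * exp (- s)\<close> in s is (p' - p) exp (- s); hence the polynomial s^2 (p - p').
  At 0 the right difference quotient is s p(s) exp (- s) with s tending to infinity.\<close>

lemma has_real_derivative_flat:
  "(flat p has_real_derivative flat ([:0, 0, 1:] * (p - pderiv p)) t) (at t)"
proof -
  consider "t > 0" | "t < 0" | "t = 0" by linarith
  then show ?thesis
  proof cases
    case 1
    have "((\<lambda>t. poly p (1 / t) * exp (- 1 / t)) has_real_derivative
        flat ([:0, 0, 1:] * (p - pderiv p)) t) (at t)"
      using 1
      by (auto intro!: derivative_eq_intros DERIV_chain'[of _ _ _ _ "poly p"] poly_DERIV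
          simp: flat_def field_simps power2_eq_square)
    then show ?thesis
      by (rule has_field_derivative_transform_within_open[of _ _ _ "{0<..}"])
        (use 1 in \<open>auto simp: flat_def\<close>)
  next
    case 2
    have "((\<lambda>t. 0) has_real_derivative flat ([:0, 0, 1:] * (p - pderiv p)) t) (at t)"
      using 2 by (auto simp: flat_def)
    then show ?thesis
      by (rule has_field_derivative_transform_within_open[of _ _ _ "{..<0}"])
        (use 2 in \<open>auto simp: flat_def\<close>)
  next
    case 3
    have "((\<lambda>h. flat p h / h) \<longlongrightarrow> 0) (at 0)"
    proof (rule filterlim_split_at)
      show "((\<lambda>h. flat p h / h) \<longlongrightarrow> 0) (at_left 0)"
        by (rule tendsto_eventually) (auto simp: eventually_at_left_field flat_def intro: exI[of _ "-1"])
      have "\<forall>\<^sub>F s in at_top. flat p (inverse s) / inverse s = s ^ 1 * poly p s / exp s"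
        using eventually_gt_at_top[of 0]
        by eventually_elim (simp add: flat_def field_simps exp_minus)
      then show "((\<lambda>h. flat p h / h) \<longlongrightarrow> 0) (at_right 0)"
        unfolding filterlim_at_right_to_top
        using tendsto_power_poly_div_exp_0[of 1 p] by (simp add: filterlim_cong)
    qed
    then show ?thesis
      using 3 by (simp add: has_field_derivative_iff flat_def)
  qed
qed

text \<open>A class that contains the bump functions and is closed under partial derivatives, so
  that smoothness of every order follows from membership.\<close>

inductive flat_algebra :: "(real ^ 'N \<Rightarrow> real) \<Rightarrow> bool" where
  flat: "flat_algebra (\<lambda>x. flat p (c * x $ i + d))"
| const: "flat_algebra (\<lambda>x. c)"
| add: "flat_algebra f \<Longrightarrow> flat_algebra g \<Longrightarrow> flat_algebra (\<lambda>x. f x + g x)"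
| mult: "flat_algebra f \<Longrightarrow> flat_algebra g \<Longrightarrow> flat_algebra (\<lambda>x. f x * g x)"

lemma flat_algebra_partial_deriv:
  fixes f :: "real ^ 'N \<Rightarrow> real"
  assumes "flat_algebra f"
  shows "(\<forall>x. f differentiable at x) \<and> (\<forall>j. flat_algebra (partial_deriv j f))"
  using assms
proof induction
  case (flat p c i d)
  define q where "q = [:0, 0, 1:] * (p - pderiv p)"
  have *: "((\<lambda>x. flat p (c * x $ i + d)) has_derivative
      (\<lambda>h. flat q (c * x $ i + d) * (c * h $ i))) (at x)" for x :: "real ^ 'N"
  proof -
    have "((\<lambda>x :: real ^ 'N. c * x $ i + d) has_derivative (\<lambda>h. c * h $ i)) (at x)"
      by (auto intro!: derivative_eq_intros bounded_linear_imp_has_derivative[OF bounded_linear_vec_nth])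
    from has_derivative_compose[OF this has_real_derivative_flat[unfolded has_field_derivative_def]]
    show ?thesis unfolding q_def .
  qed
  have "partial_deriv j (\<lambda>x. flat p (c * x $ i + d)) = (\<lambda>x. flat q (c * x $ i + d) * (c * axis j 1 $ i))" for j
    by (rule ext) (simp add: partial_deriv_def frechet_derivative_at[OF *, symmetric])
  then show ?case
    using * by (auto simp: differentiable_def intro: flat_algebra.intros)
next
  case (const c)
  then show ?case by (auto simp: partial_deriv_def frechet_derivative_const intro: flat_algebra.const)
next
  case (add f g)
  have *: "((\<lambda>x. f x + g x) has_derivative
      (\<lambda>h. frechet_derivative f (at x) h + frechet_derivative g (at x) h)) (at x)" for x
    using add by (intro has_derivative_add) (auto simp: frechet_derivative_works[symmetric])
  have "partial_deriv j (\<lambda>x. f x + g x) = (\<lambda>x. partial_deriv j f x + partial_deriv j g x)" for j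
    by (rule ext) (simp add: partial_deriv_def frechet_derivative_at[OF *, symmetric])
  with add show ?case by (auto intro: flat_algebra.intros)
next
  case (mult f g)
  have *: "((\<lambda>x. f x * g x) has_derivative
      (\<lambda>h. f x * frechet_derivative g (at x) h + frechet_derivative f (at x) h * g x)) (at x)" for x
    using mult by (intro has_derivative_mult) (auto simp: frechet_derivative_works[symmetric])
  have "partial_deriv j (\<lambda>x. f x * g x) = (\<lambda>x. f x * partial_deriv j g x + partial_deriv j f x * g x)" for j
    by (rule ext) (simp add: partial_deriv_def frechet_derivative_at[OF *, symmetric])
  with mult show ?case by (auto intro!: flat_algebra.add flat_algebra.mult)
qed

lemma flat_algebra_C_k: "flat_algebra f \<Longrightarrow> C_k m f"
proof (induction m arbitrary: f)
  case 0
  then show ?case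
    using flat_algebra_partial_deriv
    by (auto simp: continuous_on_eq_continuous_at intro: differentiable_imp_continuous_within)
qed (use flat_algebra_partial_deriv in auto)

lemma flat_algebra_prod: "finite I \<Longrightarrow> (\<And>i. i \<in> I \<Longrightarrow> flat_algebra (f i)) \<Longrightarrow> flat_algebra (\<lambda>x. \<Prod>i\<in>I. f i x)"
  by (induction I rule: finite_induct) (auto intro: flat_algebra.intros)

text \<open>Scaling by \<open>m\<close> makes exp (- 1 / (m t)) increase to 1 for positive t. The
  bump functions thus approximate the indicator of the box directly, with values in [0, 1] and
  without convolution.\<close>

definition bump :: "real ^ 'N \<Rightarrow> real ^ 'N \<Rightarrow> nat \<Rightarrow> real ^ 'N \<Rightarrow> real" where
  "bump a b m x = (\<Prod>i\<in>UNIV. flat 1 (real m * x $ i + - real m * a $ i) * flat 1 (- real m * x $ i + real m * b $ i))"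

lemma flat_1_bounds: "0 \<le> flat 1 t" "flat 1 t \<le> 1"
  by (auto simp: flat_def)

lemma bump_bounds: "0 \<le> bump a b m x" "bump a b m x \<le> 1"
  unfolding bump_def
  by (auto intro!: prod_nonneg prod_le_1 mult_nonneg_nonneg mult_le_one flat_1_bounds)

lemma bump_eq_0: "x \<notin> box a b \<Longrightarrow> bump a b m x = 0"
proof -
  assume "x \<notin> box a b"
  then obtain i where "x $ i \<le> a $ i \<or> b $ i \<le> x $ i" by (auto simp: mem_box_cart not_less)
  then have "real m * (x $ i - a $ i) \<le> 0 \<or> real m * (b $ i - x $ i) \<le> 0"
    by (auto intro: mult_nonneg_nonpos)
  then have "flat 1 (real m * x $ i + - real m * a $ i) * flat 1 (- real m * x $ i + real m * b $ i) = 0"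
    by (auto simp: flat_def algebra_simps)
  then show ?thesis unfolding bump_def by (intro prod_zero) auto
qed

lemma tendsto_bump: "(\<lambda>m. bump a b m x) \<longlonglongrightarrow> indicator (box a b) x"
proof (cases "x \<in> box a b")
  case True
  have lim: "(\<lambda>m. flat 1 (real m * t)) \<longlonglongrightarrow> 1" if "t > 0" for t
  proof -
    have "(\<lambda>m. exp (- ((1 / t) / real m))) \<longlonglongrightarrow> exp (- 0)"
      by (intro tendsto_intros lim_const_over_n)
    moreover have "\<forall>\<^sub>F m in sequentially. exp (- ((1 / t) / real m)) = flat 1 (real m * t)"
      using eventually_gt_at_top[of "0::nat"] by eventually_elim (use that in \<open>simp add: flat_def field_simps\<close>)
    ultimately show ?thesis using Lim_transform_eventually by fastforce
  qed
  have "(\<lambda>m. \<Prod>i\<in>UNIV. flat 1 (real m * (x $ i - a $ i)) * flat 1 (real m * (b $ i - x $ i)))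
      \<longlonglongrightarrow> (\<Prod>i\<in>(UNIV::'a set). 1 * 1)"
    using True by (intro tendsto_prod tendsto_mult lim) (auto simp: mem_box_cart)
  then show ?thesis using True by (simp add: bump_def[abs_def] algebra_simps)
qed (simp add: bump_eq_0)

lemma test_function_bump: "test_function (bump a b m)"
proof -
  have "flat_algebra (bump a b m)"
    unfolding bump_def by (intro flat_algebra_prod flat_algebra.mult flat_algebra.flat) auto
  moreover have "compact (closure {x. bump a b m x \<noteq> 0})"
    using bump_eq_0[of _ a b m] by (auto simp: compact_closure intro: bounded_subset[OF bounded_box[of a b]])
  ultimately show ?thesis by (simp add: test_function_def flat_algebra_C_k)
qed

section \<open>Integration by parts against test functions\<close>

lemma test_function_has_derivative:
  assumes "test_function \<phi>"
  shows "(\<phi> has_derivative (\<lambda>h. \<Sum>j\<in>UNIV. h $ j * partial_deriv j \<phi> x)) (at x)"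
    and "continuous_on UNIV (partial_deriv j \<phi>)" "continuous_on UNIV \<phi>"
proof -
  have C: "C_k m \<phi>" for m using assms by (simp add: test_function_def)
  from C[of 0] show "continuous_on UNIV \<phi>" by simp
  from C[of "Suc 0"] show "continuous_on UNIV (partial_deriv j \<phi>)" by simp
  from C[of "Suc 0"] have d: "(\<phi> has_derivative frechet_derivative \<phi> (at x)) (at x)"
    by (simp add: frechet_derivative_works[symmetric])
  have "frechet_derivative \<phi> (at x) h = (\<Sum>j\<in>UNIV. h $ j * partial_deriv j \<phi> x)" for h
  proof -
    have l: "linear (frechet_derivative \<phi> (at x))"
      using d has_derivative_linear by blast
    have "h = (\<Sum>j\<in>UNIV. h $ j *\<^sub>R axis j 1)"
      using basis_expansion[of h] by (simp add: scalar_mult_eq_scaleR)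
    then have "frechet_derivative \<phi> (at x) h = frechet_derivative \<phi> (at x) (\<Sum>j\<in>UNIV. h $ j *\<^sub>R axis j 1)"
      by simp
    also have "\<dots> = (\<Sum>j\<in>UNIV. h $ j * partial_deriv j \<phi> x)"
      by (simp add: linear_sum[OF l] linear_scale[OF l] partial_deriv_def)
    finally show ?thesis .
  qed
  then have "frechet_derivative \<phi> (at x) = (\<lambda>h. \<Sum>j\<in>UNIV. h $ j * partial_deriv j \<phi> x)" by blast
  with d show "(\<phi> has_derivative (\<lambda>h. \<Sum>j\<in>UNIV. h $ j * partial_deriv j \<phi> x)) (at x)" by simp
qed

text \<open>Each difference quotient has integral 0 by translation invariance. The mean value
  theorem bounds the quotients uniformly on a fixed ball, so dominated convergence passes to the
  derivative.\<close>

lemma integral_directional_derivative_eq_0: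
  fixes f :: "'a::euclidean_space \<Rightarrow> real"
  assumes f: "\<And>x. (f has_derivative f' x) (at x)" and c: "continuous_on UNIV (\<lambda>x. f' x v)"
    and supp: "\<And>x. norm x > R \<Longrightarrow> f x = 0"
  shows "(LINT x|lborel. f' x v) = 0"
proof -
  have cf: "continuous_on UNIV f"
    using f by (intro has_derivative_continuous_on[of _ _ f']) (auto intro: has_derivative_at_withinI)
  \<comment> \<open>Outside the ball of radius \<open>R'\<close> both \<open>x\<close> and its shift
    by a fraction of \<open>v\<close> are beyond \<open>R\<close>; the points that the mean value
    theorem produces stay within \<open>R' + norm v\<close>.\<close>
  define R' where "R' = \<bar>R\<bar> + norm v"
  have "compact ((\<lambda>x. f' x v) ` cball 0 (R' + norm v))"
    by (intro compact_continuous_image continuous_on_subset[OF c]) auto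
  then have "bounded ((\<lambda>x. f' x v) ` cball 0 (R' + norm v))"
    by (rule compact_imp_bounded)
  then obtain M where "\<And>y. y \<in> (\<lambda>x. f' x v) ` cball 0 (R' + norm v) \<Longrightarrow> norm y \<le> M"
    by (auto simp: bounded_iff)
  then have M: "\<bar>f' x v\<bar> \<le> M" if "norm x \<le> R' + norm v" for x
    using that by auto
  have M0: "M \<ge> 0" using M[of 0] by (auto simp: R'_def)
  define g where "g n x = real (Suc n) * (f (x + (1 / real (Suc n)) *\<^sub>R v) - f x)" for n x
  have cg: "continuous_on UNIV (g n)" for n
    unfolding g_def by (intro continuous_intros continuous_on_compose2[OF cf]) auto
  have bound: "norm (g n x) \<le> M * indicator (cball 0 R') x" for n x
  proof (cases "norm x \<le> R'")
    case True
    let ?t = "1 / real (Suc n)"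
    have "\<exists>s. 0 < s \<and> s < ?t \<and> f (x + ?t *\<^sub>R v) - f (x + 0 *\<^sub>R v) = (?t - 0) * f' (x + s *\<^sub>R v) v"
    proof (rule MVT2)
      fix s
      have "((\<lambda>s. f (x + s *\<^sub>R v)) has_derivative (\<lambda>h. f' (x + s *\<^sub>R v) (h *\<^sub>R v))) (at s)"
        by (rule has_derivative_compose[OF _ f]) (auto intro!: derivative_eq_intros)
      moreover have "f' (x + s *\<^sub>R v) (h *\<^sub>R v) = h * f' (x + s *\<^sub>R v) v" for h
        using f[THEN has_derivative_linear] by (simp add: linear_scale)
      ultimately show "((\<lambda>s. f (x + s *\<^sub>R v)) has_real_derivative f' (x + s *\<^sub>R v) v) (at s)"
        by (simp add: has_field_derivative_def mult_commute_abs)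
    qed simp
    then obtain s where s: "0 < s" "s < ?t" "f (x + ?t *\<^sub>R v) - f x = ?t * f' (x + s *\<^sub>R v) v"
      by auto
    moreover have "?t \<le> 1" by simp
    ultimately have "s \<le> 1" by linarith
    have "g n x = f' (x + s *\<^sub>R v) v" using s(3) by (simp add: g_def)
    moreover have "norm (x + s *\<^sub>R v) \<le> R' + norm v"
      using True norm_triangle_ineq[of x "s *\<^sub>R v"] s \<open>s \<le> 1\<close> mult_right_mono[OF \<open>s \<le> 1\<close>, of "norm v"] by simp
    ultimately show ?thesis using M True by simp
  next
    case False
    have "norm (x + (1 / real (Suc n)) *\<^sub>R v) \<ge> norm x - norm v"
      using norm_triangle_ineq2[of x "- ((1 / real (Suc n)) *\<^sub>R v)"]
        mult_right_mono[of "1 / real (Suc n)" 1 "norm v"] by simp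
    moreover have "norm x > norm v + \<bar>R\<bar>" using False by (simp add: R'_def)
    ultimately have "norm x > R" "norm (x + (1 / real (Suc n)) *\<^sub>R v) > R"
      using norm_ge_zero[of v] by linarith+
    then show ?thesis using False supp by (simp add: g_def)
  qed
  have "(\<lambda>n. LINT x|lborel. g n x) \<longlonglongrightarrow> (LINT x|lborel. f' x v)"
  proof (rule integral_dominated_convergence)
    show "(\<lambda>x. f' x v) \<in> borel_measurable lborel" "g n \<in> borel_measurable lborel" for n
      using c cg by (auto intro: borel_measurable_continuous_onI)
    show "integrable lborel (\<lambda>x. M * indicator (cball 0 R') x)"
      by (intro integrable_mult_right integrable_real_indicator)
        (use emeasure_bounded_finite[OF bounded_cball[of 0 R']] in auto)
    show "AE x in lborel. (\<lambda>n. g n x) \<longlonglongrightarrow> f' x v"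
    proof (rule AE_I2)
      fix x
      have "((\<lambda>s. f (x + s *\<^sub>R v)) has_derivative (\<lambda>h. f' (x + 0 *\<^sub>R v) (h *\<^sub>R v))) (at 0)"
        by (rule has_derivative_compose[OF _ f]) (auto intro!: derivative_eq_intros)
      moreover have "f' x (h *\<^sub>R v) = h * f' x v" for h
        using f[THEN has_derivative_linear] by (simp add: linear_scale)
      ultimately have "((\<lambda>s. f (x + s *\<^sub>R v)) has_real_derivative f' x v) (at 0)"
        by (simp add: has_field_derivative_def mult_commute_abs)
      then have "((\<lambda>h. (f (x + h *\<^sub>R v) - f x) / h) \<longlongrightarrow> f' x v) (at 0)"
        by (simp add: has_field_derivative_iff)
      moreover have "filterlim (\<lambda>n. 1 / real (Suc n)) (at 0) sequentially"
        unfolding filterlim_at using LIMSEQ_Suc[OF lim_1_over_n] by (auto simp del: of_nat_Suc)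
      ultimately have "(\<lambda>n. (f (x + (1 / real (Suc n)) *\<^sub>R v) - f x) / (1 / real (Suc n))) \<longlonglongrightarrow> f' x v"
        by (rule filterlim_compose)
      then show "(\<lambda>n. g n x) \<longlonglongrightarrow> f' x v" by (simp add: g_def mult.commute)
    qed
  qed (use bound in auto)
  moreover have "(LINT x|lborel. g n x) = 0" for n
  proof -
    let ?w = "(1 / real (Suc n)) *\<^sub>R v"
    have int: "integrable lborel f"
    proof (rule Bochner_Integration.integrable_bound[of _ "\<lambda>x. indicator (cball 0 R) x *\<^sub>R f x"])
      show "integrable lborel (\<lambda>x. indicator (cball 0 R) x *\<^sub>R f x)"
        using borel_integrable_compact[of "cball 0 R" f] continuous_on_subset[OF cf] 
        by (simp add: set_integrable_def)
      show "f \<in> borel_measurable lborel" using cf by (auto intro: borel_measurable_continuous_onI)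
    qed (use supp in \<open>auto simp: indicator_def not_le\<close>)
    have "(LINT x|lborel. f (?w + x)) = (LINT x|lborel. f x)"
      using integral_distr[of "(+) ?w" lborel borel f] lborel_distr_plus[of ?w]
        borel_measurable_continuous_onI[OF cf] by simp
    moreover have "integrable lborel (\<lambda>x. f (?w + x))"
      using integrable_distr[of "(+) ?w" lborel borel f] lborel_distr_plus[of ?w] int by simp
    ultimately show ?thesis using int by (simp add: g_def add.commute)
  qed
  ultimately show ?thesis by (simp add: LIMSEQ_const_iff)
qed

text \<open>The bump function lives on a box inside \<open>U\<close>, so its product with
  \<open>w\<close> extends by 0 to a differentiable function on the whole space. Classical
  integration by parts for this product and the weak definition for \<open>v\<close> test
  \<open>D\<close> and \<open>Dv\<close> against the same function.\<close>

lemma has_weak_gradient_bump: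
  fixes v w :: "real ^ 'N \<Rightarrow> real ^ 'n" and Dv D :: "real ^ 'N \<Rightarrow> real ^ 'N ^ 'n"
  assumes v: "locally_integrable v" and Dv: "has_weak_gradient v Dv"
    and U: "open U" and w: "\<And>x. x \<in> U \<Longrightarrow> (w has_derivative (\<lambda>h. D x *v h)) (at x)"
    and D: "continuous_on U D" and vw: "AE x in lebesgue. x \<in> U \<longrightarrow> v x = w x"
    and ab: "cbox a b \<subseteq> U"
  shows "(LINT x|lebesgue. (indicator (cbox a b) x * (Dv x $ i $ j - D x $ i $ j)) * bump a b m x) = 0"
proof -
  define \<phi> where "\<phi> = bump a b m"
  have t: "test_function \<phi>" by (simp add: \<phi>_def test_function_bump)
  note \<phi> = test_function_has_derivative[OF t]
  have \<phi>0: "\<phi> x = 0" if "x \<notin> cbox a b" for x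
    using that box_subset_cbox[of a b] bump_eq_0[of x a b m] by (auto simp: \<phi>_def)
  have d\<phi>0: "partial_deriv j \<phi> x = 0" if "x \<notin> cbox a b" for x
  proof -
    have "((\<lambda>x. 0) has_derivative (\<lambda>h. 0)) (at x)" by simp
    then have "(\<phi> has_derivative (\<lambda>h. 0)) (at x)"
      by (rule has_derivative_transform_within_open[of _ _ _ _ "- cbox a b"])
        (use that \<phi>0 in \<open>auto simp: open_Compl closed_cbox\<close>)
    then show ?thesis by (simp add: partial_deriv_def frechet_derivative_at[symmetric])
  qed
  have wc: "continuous_on U w"
    using w by (intro has_derivative_continuous_on) (auto intro: has_derivative_at_withinI)
  define f where "f x = (if x \<in> U then w x $ i * \<phi> x else 0)" for x
  define f' where "f' x h = (if x \<in> U then w x $ i * (\<Sum>j\<in>UNIV. h $ j * partial_deriv j \<phi> x)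
      + (D x *v h) $ i * \<phi> x else 0)" for x h
  define p where "p x = (if x \<in> U then w x $ i * partial_deriv j \<phi> x else 0)" for x
  define q where "q x = (if x \<in> U then D x $ i $ j * \<phi> x else 0)" for x
  have f: "(f has_derivative f' x) (at x)" for x
  proof (cases "x \<in> U")
    case True
    have "((\<lambda>x. w x $ i * \<phi> x) has_derivative f' x) (at x)"
      using True unfolding f'_def
      by (auto intro!: has_derivative_mult \<phi> bounded_linear.has_derivative[OF bounded_linear_vec_nth w])
    then show ?thesis
      by (rule has_derivative_transform_within_open[OF _ U True]) (simp add: f_def)
  next
    case False
    have "((\<lambda>x. 0) has_derivative (\<lambda>h. 0)) (at x)" by simp
    then have "(f has_derivative (\<lambda>h. 0)) (at x)"
      by (rule has_derivative_transform_within_open[of _ _ _ _ "- cbox a b"])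
        (use ab False \<phi>0 in \<open>auto simp: open_Compl closed_cbox f_def\<close>)
    moreover have "f' x = (\<lambda>h. 0)" using False by (auto simp: f'_def)
    ultimately show ?thesis by simp
  qed
  have ext: "continuous_on UNIV g" if "continuous_on U g" "\<And>x. x \<notin> cbox a b \<Longrightarrow> g x = 0" for g :: "_ \<Rightarrow> real"
  proof -
    have "continuous_on (- cbox a b) (\<lambda>x. 0 :: real)" by simp
    then have "continuous_on (- cbox a b) g"
      by (rule continuous_on_eq) (use that in auto)
    then have "continuous_on (U \<union> - cbox a b) g"
      using that U by (intro continuous_on_open_Un) (auto simp: open_Compl closed_cbox)
    moreover have "U \<union> - cbox a b = UNIV" using ab by auto
    ultimately show ?thesis by simp
  qed
  have "continuous_on U (\<lambda>x. w x $ i * partial_deriv j \<phi> x)" "continuous_on U (\<lambda>x. D x $ i $ j * \<phi> x)"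
    using wc D \<phi>(2,3) by (auto intro!: continuous_intros intro: continuous_on_subset)
  then have "continuous_on U p" "continuous_on U q"
    by (auto simp: p_def q_def cong: continuous_on_cong)
  then have cp: "continuous_on UNIV p" and cq: "continuous_on UNIV q"
    using \<phi>0 d\<phi>0 by (auto intro!: ext simp: p_def q_def)
  have cint: "integrable lborel g" if "continuous_on UNIV g" "\<And>x. x \<notin> cbox a b \<Longrightarrow> g x = 0" for g :: "_ \<Rightarrow> real"
  proof (rule Bochner_Integration.integrable_bound[of _ "\<lambda>x. indicator (cbox a b) x *\<^sub>R g x"])
    show "integrable lborel (\<lambda>x. indicator (cbox a b) x *\<^sub>R g x)"
      using borel_integrable_compact[of "cbox a b" g] continuous_on_subset[OF that(1)] by simp
  qed (use that in \<open>auto simp: indicator_def intro: borel_measurable_continuous_onI\<close>)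
  have ip: "integrable lborel p" and iq: "integrable lborel q"
    using \<phi>0 d\<phi>0 by (auto intro!: cint cp cq simp: p_def q_def)
  have f'_eq: "f' x (axis j 1) = p x + q x" for x
  proof -
    have "(\<Sum>k\<in>UNIV. axis j 1 $ k * partial_deriv k \<phi> x) = (\<Sum>k\<in>UNIV. if k = j then partial_deriv j \<phi> x else 0)"
      by (intro sum.cong) (auto simp: axis_def)
    then show ?thesis
      by (simp add: f'_def p_def q_def matrix_vector_mul_component inner_axis)
  qed
  obtain R where R: "\<And>x. x \<in> cbox a b \<Longrightarrow> norm x \<le> R"
    using bounded_cbox[of a b] by (auto simp: bounded_iff)
  have "(LINT x|lborel. f' x (axis j 1)) = 0"
  proof (rule integral_directional_derivative_eq_0[OF f])
    show "continuous_on UNIV (\<lambda>x. f' x (axis j 1))"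
      unfolding f'_eq by (intro continuous_intros cp cq)
    show "f x = 0" if "norm x > R" for x
      using R[of x] \<phi>0[of x] that by (force simp: f_def)
  qed
  then have pq: "(LINT x|lborel. p x) + (LINT x|lborel. q x) = 0"
    by (simp add: f'_eq ip iq)
  have leb: "(LINT x|lebesgue. g x) = (LINT x|lborel. g x)" if "continuous_on UNIV g" for g :: "_ \<Rightarrow> real"
    using that by (intro integral_completion) (auto intro: borel_measurable_continuous_onI)
  have \<phi>m: "\<phi> \<in> borel_measurable lebesgue" "partial_deriv j \<phi> \<in> borel_measurable lebesgue"
    using \<phi>(2,3) by (auto intro!: measurable_completion borel_measurable_continuous_onI)
  have iv: "integrable lebesgue (\<lambda>x. indicator (cbox a b) x *\<^sub>R v x)"
    using v compact_cbox unfolding locally_integrable_def set_integrable_def by blast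
  have iD: "integrable lebesgue (\<lambda>x. indicator (cbox a b) x *\<^sub>R Dv x)"
    using Dv compact_cbox unfolding has_weak_gradient_def locally_integrable_def set_integrable_def by blast
  have "(LINT x|lebesgue. v x $ i * partial_deriv j \<phi> x) = (LINT x|lebesgue. p x)"
  proof (rule integral_cong_AE)
    have "(\<lambda>x. (indicator (cbox a b) x *\<^sub>R v x) $ i * partial_deriv j \<phi> x) \<in> borel_measurable lebesgue"
      by (intro borel_measurable_times \<phi>m borel_measurable_integrable
          integrable_bounded_linear[OF bounded_linear_vec_nth iv])
    then show "(\<lambda>x. v x $ i * partial_deriv j \<phi> x) \<in> borel_measurable lebesgue"
      by (rule measurable_cong[THEN iffD1, rotated]) (use d\<phi>0 in \<open>auto simp: indicator_def\<close>)
    show "p \<in> borel_measurable lebesgue"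
      using cp by (auto intro!: measurable_completion borel_measurable_continuous_onI)
    show "AE x in lebesgue. v x $ i * partial_deriv j \<phi> x = p x"
      using vw by eventually_elim (use d\<phi>0 ab in \<open>auto simp: p_def\<close>)
  qed
  moreover have "(LINT x|lebesgue. v x $ i * partial_deriv j \<phi> x) = - (LINT x|lebesgue. Dv x $ i $ j * \<phi> x)"
    using Dv t by (simp add: has_weak_gradient_def)
  ultimately have eq: "(LINT x|lebesgue. Dv x $ i $ j * \<phi> x) = (LINT x|lebesgue. q x)"
    using pq leb[OF cp] leb[OF cq] by simp
  have iDij: "integrable lebesgue (\<lambda>x. indicator (cbox a b) x * Dv x $ i $ j)"
    using integrable_bounded_linear[OF bounded_linear_vec_nth
        integrable_bounded_linear[OF bounded_linear_vec_nth iD, of i], of j] by simp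
  have "integrable lebesgue (\<lambda>x. (indicator (cbox a b) x * Dv x $ i $ j) * \<phi> x)"
    by (rule Bochner_Integration.integrable_bound[OF iDij])
      (use \<phi>m iDij bump_bounds[of a b m] in \<open>auto simp: \<phi>_def abs_mult intro!: mult_right_le_one_le\<close>)
  also have "(\<lambda>x. (indicator (cbox a b) x * Dv x $ i $ j) * \<phi> x) = (\<lambda>x. Dv x $ i $ j * \<phi> x)"
  proof
    show "indicator (cbox a b) x * Dv x $ i $ j * \<phi> x = Dv x $ i $ j * \<phi> x" for x
      using \<phi>0 by (cases "x \<in> cbox a b") auto
  qed
  finally have iDphi: "integrable lebesgue (\<lambda>x. Dv x $ i $ j * \<phi> x)" .
  have "integrable lebesgue q" using iq by (simp add: integrable_completion)
  then have "(LINT x|lebesgue. Dv x $ i $ j * \<phi> x - q x) = 0"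
    using eq iDphi by simp
  moreover have "(\<lambda>x. Dv x $ i $ j * \<phi> x - q x)
      = (\<lambda>x. (indicator (cbox a b) x * (Dv x $ i $ j - D x $ i $ j)) * \<phi> x)"
  proof
    show "Dv x $ i $ j * \<phi> x - q x
        = (indicator (cbox a b) x * (Dv x $ i $ j - D x $ i $ j)) * \<phi> x" for x
      using \<phi>0 ab by (cases "x \<in> cbox a b") (auto simp: q_def algebra_simps)
  qed
  ultimately show ?thesis by (simp add: \<phi>_def)
qed

text \<open>Lebesgue differentiation in the form \<open>integrable_ccontinuous_explicit\<close>: off
  a null set, \<open>h x\<close> is the limit of averages over shrinking cubes with corner
  \<open>x\<close>, and these averages are 0.\<close>

lemma AE_eq_0_if_box_integrals_eq_0:
  fixes h :: "'a::euclidean_space \<Rightarrow> real"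
  assumes h: "integrable lebesgue h"
    and 0: "\<And>c d. box c d \<subseteq> box a b \<Longrightarrow> (LINT x|lebesgue. h x * indicator (box c d) x) = 0"
  shows "AE x in lebesgue. x \<in> box a b \<longrightarrow> h x = 0"
proof -
  have abs_int: "h absolutely_integrable_on S" if "S \<in> sets lebesgue" for S
    unfolding set_integrable_def using integrable_mult_indicator[OF that h] by simp
  have "h integrable_on cbox c d" for c d
    by (intro set_lebesgue_integral_eq_integral abs_int) auto
  then obtain N where N: "negligible N" "\<And>x e. x \<notin> N \<Longrightarrow> 0 < e \<Longrightarrow>
      \<exists>d>0. \<forall>t. 0 < t \<and> t < d \<longrightarrow> norm (integral (cbox x (x + t *\<^sub>R One)) h /\<^sub>R t ^ DIM('a) - h x) < e"
    using integrable_ccontinuous_explicit[of h] by metis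
  have "h x = 0" if x: "x \<in> box a b" "x \<notin> N" for x
  proof (rule ccontr)
    assume "h x \<noteq> 0"
    then obtain d where d: "d > 0"
      "\<And>t. 0 < t \<Longrightarrow> t < d \<Longrightarrow> norm (integral (cbox x (x + t *\<^sub>R One)) h /\<^sub>R t ^ DIM('a) - h x) < \<bar>h x\<bar>"
      using N(2)[OF x(2), of "\<bar>h x\<bar>"] by auto
    obtain r where r: "r > 0" "ball x r \<subseteq> box a b"
      using open_box[of a b] x(1) open_contains_ball by blast
    define t where "t = min (d / 2) (r / (norm (One :: 'a) + 1))"
    have pos: "norm (One :: 'a) + 1 > 0" using norm_ge_zero by (rule add_nonneg_pos) simp
    have t: "t > 0" "t < d" using d(1) r(1) pos by (auto simp: t_def min_less_iff_disj)
    have "t \<le> r / (norm (One :: 'a) + 1)" by (simp add: t_def)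
    then have "t * (norm (One :: 'a) + 1) \<le> r" using pos by (simp add: pos_le_divide_eq)
    then have tn: "t * norm (One :: 'a) < r" using t by (simp add: distrib_left)
    have "cbox x (x + t *\<^sub>R One) \<subseteq> ball x r"
    proof
      fix y assume y: "y \<in> cbox x (x + t *\<^sub>R One)"
      have "norm (y - x) \<le> norm (t *\<^sub>R One :: 'a)"
        using y t(1) by (intro norm_le_componentwise) (auto simp: mem_box inner_diff_left inner_add_left)
      then show "y \<in> ball x r" using tn t(1) by (simp add: dist_norm norm_minus_commute)
    qed
    then have sub: "box x (x + t *\<^sub>R One) \<subseteq> box a b" using r(2) box_subset_cbox by blast
    have "integral (cbox x (x + t *\<^sub>R One)) h = integral (box x (x + t *\<^sub>R One)) h"
      by (simp add: integral_open_interval)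
    also have "\<dots> = (LINT y|lebesgue. h y * indicator (box x (x + t *\<^sub>R One)) y)"
      using set_lebesgue_integral_eq_integral(2)[OF abs_int, of "box x (x + t *\<^sub>R One)"]
      by (simp add: set_lebesgue_integral_def mult.commute)
    also have "\<dots> = 0" using 0[OF sub] by simp
    finally show False using d(2)[OF t(1,2)] by simp
  qed
  then have "{x. \<not> (x \<in> box a b \<longrightarrow> h x = 0)} \<subseteq> N" by auto
  then show ?thesis
    using N(1) by (intro AE_I'[of N]) (auto simp: negligible_iff_null_sets)
qed

text \<open>Stated for an arbitrary open \<open>U\<close> because a reflected function has a known
  classical derivative on each open half-space, but not yet across the hyperplane. In the limit the
  bump functions become indicators of boxes, and \<open>U\<close> is a countable union of
  boxes.\<close>

theorem weak_gradient_eq_classical: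
  fixes v w :: "real ^ 'N \<Rightarrow> real ^ 'n" and Dv D :: "real ^ 'N \<Rightarrow> real ^ 'N ^ 'n"
  assumes v: "locally_integrable v" and Dv: "has_weak_gradient v Dv"
    and U: "open U" and w: "\<And>x. x \<in> U \<Longrightarrow> (w has_derivative (\<lambda>h. D x *v h)) (at x)"
    and D: "continuous_on U D" and vw: "AE x in lebesgue. x \<in> U \<longrightarrow> v x = w x"
  shows "AE x in lebesgue. x \<in> U \<longrightarrow> Dv x = D x"
proof -
  have box: "AE x in lebesgue. x \<in> box a b \<longrightarrow> Dv x $ i $ j = D x $ i $ j" if ab: "cbox a b \<subseteq> U" for a b i j
  proof -
    define h where "h x = indicator (cbox a b) x * (Dv x $ i $ j - D x $ i $ j)" for x
    have "integrable lebesgue (\<lambda>x. indicator (cbox a b) x *\<^sub>R Dv x)"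
      using Dv compact_cbox unfolding has_weak_gradient_def locally_integrable_def set_integrable_def by blast
    moreover have iD: "integrable lborel (\<lambda>x. indicator (cbox a b) x *\<^sub>R D x)"
      using borel_integrable_compact[OF compact_cbox continuous_on_subset[OF D ab]] .
    have "integrable lebesgue (\<lambda>x. indicator (cbox a b) x *\<^sub>R D x)"
      using iD borel_measurable_integrable[OF iD] by (simp add: integrable_completion)
    ultimately have "integrable lebesgue (\<lambda>x. indicator (cbox a b) x *\<^sub>R Dv x - indicator (cbox a b) x *\<^sub>R D x)"
      by (rule Bochner_Integration.integrable_diff)
    from integrable_bounded_linear[OF bounded_linear_vec_nth
        integrable_bounded_linear[OF bounded_linear_vec_nth this, of i], of j]
    have h: "integrable lebesgue h"
      by (simp add: h_def[abs_def] algebra_simps)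
    have "AE x in lebesgue. x \<in> box a b \<longrightarrow> h x = 0"
    proof (rule AE_eq_0_if_box_integrals_eq_0[OF h])
      fix c d assume cd: "box c d \<subseteq> box a b"
      show "(LINT x|lebesgue. h x * indicator (box c d) x) = 0"
      proof (cases "box c d = {}")
        case False
        then have "box a b \<noteq> {}" using cd by blast
        then have cab: "cbox c d \<subseteq> cbox a b"
          using closure_mono[OF cd] closure_box[OF False] closure_box[of a b] by simp
        have "(\<lambda>m. LINT x|lebesgue. h x * bump c d m x) \<longlonglongrightarrow> (LINT x|lebesgue. h x * indicator (box c d) x)"
        proof (rule integral_dominated_convergence)
          show "(\<lambda>x. h x * bump c d m x) \<in> borel_measurable lebesgue" for m
          proof (rule borel_measurable_times)
            show "bump c d m \<in> borel_measurable lebesgue"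
              using test_function_has_derivative(3)[OF test_function_bump[of c d m]]
              by (intro measurable_completion) (simp add: borel_measurable_continuous_onI)
          qed (use h in simp)
          show "integrable lebesgue (\<lambda>x. norm (h x))" using h by simp
          show "AE x in lebesgue. norm (h x * bump c d m x) \<le> norm (h x)" for m
            using bump_bounds[of c d m] by (auto simp: abs_mult intro!: mult_right_le_one_le)
          show "AE x in lebesgue. (\<lambda>m. h x * bump c d m x) \<longlonglongrightarrow> h x * indicator (box c d) x"
            by (intro AE_I2 tendsto_intros tendsto_bump)
          show "(\<lambda>x. h x * indicator (box c d) x) \<in> borel_measurable lebesgue"
            using h by (intro borel_measurable_times borel_measurable_indicator) auto
        qed
        moreover have "(LINT x|lebesgue. h x * bump c d m x) = 0" for m
        proof -
          have eq: "h x * bump c d m x = indicator (cbox c d) x * (Dv x $ i $ j - D x $ i $ j) * bump c d m x" for x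
            using bump_eq_0[of x c d m] box_subset_cbox[of c d] cab
            by (cases "x \<in> box c d") (auto simp: h_def indicator_def subset_iff)
          show ?thesis
            unfolding eq by (rule has_weak_gradient_bump[OF v Dv U w D vw]) (use cab ab in auto)
        qed
        ultimately show ?thesis by (simp add: LIMSEQ_const_iff)
      qed simp
    qed
    then show ?thesis
      by eventually_elim (use box_subset_cbox[of a b] in \<open>auto simp: h_def\<close>)
  qed
  obtain \<D> where \<D>: "countable \<D>" "\<And>X. X \<in> \<D> \<Longrightarrow> X \<subseteq> U \<and> (\<exists>a b. X = cbox a b)" "\<Union>\<D> = U"
    using open_countable_Union_open_cbox[OF U] by (metis Pow_iff subset_iff)
  have "AE x in lebesgue. \<forall>X\<in>\<D>. x \<in> X \<longrightarrow> Dv x = D x"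
  proof (intro AE_ball_countable[OF \<D>(1), THEN iffD2] ballI)
    fix X assume "X \<in> \<D>"
    then obtain a b where X: "X = cbox a b" "cbox a b \<subseteq> U" using \<D>(2) by blast
    have "AE x in lebesgue. \<forall>i j. x \<in> box a b \<longrightarrow> Dv x $ i $ j = D x $ i $ j"
      unfolding AE_all_countable using box[OF X(2)] by blast
    moreover have "AE x in lebesgue. x \<notin> cbox a b - box a b"
      using negligible_frontier_interval[of a b] by (intro AE_not_in) (simp add: negligible_iff_null_sets)
    ultimately show "AE x in lebesgue. x \<in> X \<longrightarrow> Dv x = D x"
      by eventually_elim (auto simp: X(1) vec_eq_iff)
  qed
  then show ?thesis by eventually_elim (use \<D>(3) in auto)
qed

section \<open>Invariance of Lebesgue measure under isometries\<close>

lemma lborel_distr_diff: "distr lborel borel ((-) c) = (lborel :: 'a::euclidean_space measure)"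
proof -
  have "(-) c = (\<lambda>x. c + (- 1) *\<^sub>R x)" by (auto simp: fun_eq_iff)
  then show ?thesis
    using lborel_affine[of "- 1" c] by (simp add: density_1)
qed

text \<open>
  Uniqueness of Haar measure, specialised: comparing the image measure with \<open>lborel\<close> by Fubini
  shows that they are proportional, and an isometry does not change the measure of the unit ball.
\<close>

lemma lborel_distr_linear_isometry:
  fixes T :: "'a::euclidean_space \<Rightarrow> 'a"
  assumes T: "linear T" "\<And>x. norm (T x) = norm x"
  shows "distr lborel borel T = lborel"
proof (rule measure_eqI)
  have [measurable]: "T \<in> borel_measurable borel"
    using T(1) by (intro borel_measurable_continuous_onI linear_continuous_on) (simp add: linear_conv_bounded_linear)
  have "inj T" using T by (metis linear_injective_0 norm_eq_zero)
  then have surj: "surj T" using T(1) linear_injective_imp_surjective by blast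
  fix A assume "A \<in> sets (distr lborel borel T)"
  then have A[measurable]: "A \<in> sets borel" by simp
  define B where "B = ball (0 :: 'a) 1"
  have B[measurable]: "B \<in> sets borel" by (simp add: B_def)
  have shift: "(\<integral>\<^sup>+x. f (c + x) \<partial>lborel) = (\<integral>\<^sup>+x. f x \<partial>lborel)"
    if [measurable]: "f \<in> borel_measurable borel" for f :: "'a \<Rightarrow> ennreal" and c
    using nn_integral_distr[of "(+) c" lborel borel f] by (simp add: lborel_distr_plus)
  have refl: "(\<integral>\<^sup>+x. f (c - x) \<partial>lborel) = (\<integral>\<^sup>+x. f x \<partial>lborel)"
    if [measurable]: "f \<in> borel_measurable borel" for f :: "'a \<Rightarrow> ennreal" and c
    using nn_integral_distr[of "(-) c" lborel borel f] by (simp add: lborel_distr_diff)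
  have "emeasure lborel (T -` A) * emeasure lborel B
      = (\<integral>\<^sup>+x. (\<integral>\<^sup>+y. indicator A (T x) * indicator B y \<partial>lborel) \<partial>lborel)"
  proof -
    have "(\<integral>\<^sup>+x. indicator A (T x) \<partial>lborel) = emeasure lborel (T -` A)"
      using nn_integral_indicator[of "T -` A" lborel] measurable_sets_borel[OF \<open>T \<in> borel_measurable borel\<close> A]
      by (simp add: indicator_vimage)
    then show ?thesis by (simp add: nn_integral_cmult nn_integral_multc)
  qed
  \<comment> \<open>Shifting \<open>y\<close> by \<open>T x\<close> couples the two factors; after
    exchanging the integrals, \<open>x\<close> is shifted by the preimage of \<open>y\<close>, which
    moves \<open>y\<close> into the first factor.\<close>
  also have "\<dots> = (\<integral>\<^sup>+x. (\<integral>\<^sup>+y. indicator A (T x) * indicator B (T x + y) \<partial>lborel) \<partial>lborel)"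
    by (rule nn_integral_cong) (simp add: nn_integral_cmult shift)
  also have "\<dots> = (\<integral>\<^sup>+y. (\<integral>\<^sup>+x. indicator A (T x) * indicator B (T x + y) \<partial>lborel) \<partial>lborel)"
    by (rule lborel_pair.Fubini') measurable
  also have "\<dots> = (\<integral>\<^sup>+y. (\<integral>\<^sup>+x. indicator A (T x - y) * indicator B (T x) \<partial>lborel) \<partial>lborel)"
  proof (rule nn_integral_cong)
    fix y
    obtain z where z: "T z = y" using surj by (metis surjD)
    have "T (- z + x) = T x - y" for x using T(1) z by (simp add: linear_diff)
    then show "(\<integral>\<^sup>+x. indicator A (T x) * indicator B (T x + y) \<partial>lborel)
        = (\<integral>\<^sup>+x. indicator A (T x - y) * indicator B (T x) \<partial>lborel)"
      using shift[of "\<lambda>x. indicator A (T x) * indicator B (T x + y)" "- z"] by simp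
  qed
  also have "\<dots> = (\<integral>\<^sup>+x. (\<integral>\<^sup>+y. indicator A (T x - y) * indicator B (T x) \<partial>lborel) \<partial>lborel)"
    by (rule lborel_pair.Fubini'[symmetric]) measurable
  also have "\<dots> = (\<integral>\<^sup>+x. emeasure lborel A * indicator B (T x) \<partial>lborel)"
  proof (rule nn_integral_cong)
    fix x
    have "(\<integral>\<^sup>+y. indicator A (T x - y) \<partial>lborel) = emeasure lborel A"
      using refl[of "indicator A" "T x"] by simp
    then show "(\<integral>\<^sup>+y. indicator A (T x - y) * indicator B (T x) \<partial>lborel)
        = emeasure lborel A * indicator B (T x)"
      by (simp add: nn_integral_multc)
  qed
  also have "\<dots> = (\<integral>\<^sup>+x. emeasure lborel A * indicator B x \<partial>lborel)"
    by (rule nn_integral_cong) (simp add: B_def T(2) indicator_def)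
  also have "\<dots> = emeasure lborel A * emeasure lborel B"
    by (simp add: nn_integral_cmult)
  finally have "emeasure lborel (T -` A) * emeasure lborel B = emeasure lborel A * emeasure lborel B" .
  moreover have "emeasure lborel B \<noteq> 0"
    using emeasure_lborel_ball_finite open_not_negligible[of B]
    by (auto simp: B_def negligible_iff_null_sets null_sets_def)
  moreover have "emeasure lborel B \<noteq> \<infinity>"
    using emeasure_bounded_finite[of B] by (simp add: B_def less_top)
  ultimately have "emeasure lborel (T -` A) = emeasure lborel A"
    by (simp add: ennreal_mult_cancel_left mult.commute[of _ "emeasure lborel B"])
  then show "emeasure (distr lborel borel T) A = emeasure lborel A"
    by (simp add: emeasure_distr)
qed simp

lemma lborel_distr_isometry:
  fixes R :: "'a::euclidean_space \<Rightarrow> 'a"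
  assumes "linear T" "\<And>x. norm (T x) = norm x" "\<And>x. R x = c + T x"
  shows "distr lborel borel R = lborel"
proof -
  have T[measurable]: "T \<in> borel_measurable borel"
    using assms(1) by (intro borel_measurable_continuous_onI linear_continuous_on) (simp add: linear_conv_bounded_linear)
  have "distr lborel borel R = distr (distr lborel borel T) borel ((+) c)"
    by (subst distr_distr) (auto simp: o_def assms(3)[abs_def])
  then show ?thesis
    using lborel_distr_linear_isometry[OF assms(1,2)] by (simp add: lborel_distr_plus)
qed

locale lborel_preserving =
  fixes R :: "'a::euclidean_space \<Rightarrow> 'a"
  assumes measurable_R [measurable]: "R \<in> borel_measurable borel"
    and distr_R: "distr lborel borel R = lborel"
begin

lemma AE_compose:
  assumes "AE x in lebesgue. P x" shows "AE x in lebesgue. P (R x)"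
proof -
  have "AE x in lborel. P x" using assms by (simp add: AE_completion_iff)
  then obtain N where N: "{x. \<not> P x} \<subseteq> N" "N \<in> sets borel" "emeasure lborel N = 0"
    by (auto elim: AE_E)
  have "emeasure lborel (R -` N) = emeasure (distr lborel borel R) N"
    using N(2) by (simp add: emeasure_distr)
  then have "R -` N \<in> null_sets lborel"
    using N measurable_sets_borel[OF measurable_R N(2)] by (simp add: distr_R null_sets_def)
  then have "AE x in lborel. P (R x)"
    by (rule AE_I') (use N(1) in auto)
  then show ?thesis by (rule AE_completion)
qed

text \<open>A Lebesgue set is a Borel set plus a subset of a Borel null set, and measure
  preservation keeps the preimage of the null set null; Borel measurability of \<open>R\<close>
  alone would not give this.\<close>

lemma measurable_compose_R:
  fixes h :: "'a \<Rightarrow> real"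
  assumes "h \<in> borel_measurable lebesgue"
  shows "(\<lambda>x. h (R x)) \<in> borel_measurable lebesgue"
proof -
  have "R \<in> lebesgue \<rightarrow>\<^sub>M lebesgue"
  proof (rule measurableI)
    fix A :: "'a set" assume "A \<in> sets lebesgue"
    then obtain S N N' where A: "A = S \<union> N" "N \<subseteq> N'" "N' \<in> null_sets lborel" "S \<in> sets lborel"
      by (rule sets_completionE)
    have "AE x in lebesgue. x \<notin> N'" using A(3) by (intro AE_completion AE_not_in)
    then have "AE x in lebesgue. R x \<notin> N'" by (rule AE_compose)
    then have "R -` N' \<in> null_sets lebesgue"
      using completion.AE_iff_null_sets[of "\<lambda>x. R x \<notin> N'" lborel] by (simp add: vimage_def)
    then have "R -` N \<in> sets lebesgue"
      by (rule null_setsD2[OF null_sets_completion_subset[OF vimage_mono[OF A(2)]]])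
    moreover have "R -` S \<in> sets lebesgue"
      using measurable_sets_borel[OF measurable_R, of S] A(4) by simp
    ultimately have "R -` S \<union> R -` N \<in> sets lebesgue" by (intro sets.Un)
    then show "R -` A \<inter> space lebesgue \<in> sets lebesgue"
      by (simp add: A(1) vimage_Un)
  qed (simp add: space_completion)
  then show ?thesis using assms by (rule measurable_compose)
qed

lemma integral_compose:
  fixes h :: "'a \<Rightarrow> real"
  assumes "integrable lebesgue h"
  shows "integrable lebesgue (\<lambda>x. h (R x))"
    and "(LINT x|lebesgue. h (R x)) = (LINT x|lebesgue. h x)"
proof -
  obtain g where g: "g \<in> borel_measurable lborel" "AE x in lborel. h x = g x"
    using completion_ex_borel_measurable_real[of h lborel] assms by auto
  have gm[measurable]: "g \<in> borel_measurable borel" using g(1) by simp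
  have hm: "h \<in> borel_measurable lebesgue" using assms by auto
  have gl: "g \<in> borel_measurable lebesgue" "(\<lambda>x. g (R x)) \<in> borel_measurable lebesgue"
    by (auto intro!: measurable_completion)
  have hg: "AE x in lebesgue. h x = g x" using g(2) by (rule AE_completion)
  have hgR: "AE x in lebesgue. h (R x) = g (R x)" using AE_compose[OF hg] .
  have ig: "integrable lborel g"
    using integrable_cong_AE[OF hm gl(1) hg] assms by (simp add: integrable_completion)
  then have igR: "integrable lborel (\<lambda>x. g (R x))"
    using integrable_distr[of R lborel borel g] by (simp add: distr_R)
  have eq: "(LINT x|lborel. g (R x)) = (LINT x|lborel. g x)"
    using integral_distr[of R lborel borel g] by (simp add: distr_R)
  note hRm = measurable_compose_R[OF hm]
  show "integrable lebesgue (\<lambda>x. h (R x))"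
    using integrable_cong_AE[OF hRm gl(2) hgR] igR by (simp add: integrable_completion)
  show "(LINT x|lebesgue. h (R x)) = (LINT x|lebesgue. h x)"
    using integral_cong_AE[OF hRm gl(2) hgR] integral_cong_AE[OF hm gl(1) hg] eq
    by (simp add: integral_completion)
qed

end

lemma lborel_preserving_isometry:
  fixes R :: "'a::euclidean_space \<Rightarrow> 'a"
  assumes "linear T" "\<And>x. norm (T x) = norm x" "\<And>x. R x = c + T x"
  shows "lborel_preserving R"
proof
  show "R \<in> borel_measurable borel"
    unfolding assms(3)[abs_def] using assms(1)
    by (intro borel_measurable_continuous_onI continuous_intros linear_continuous_on)
      (simp add: linear_conv_bounded_linear)
qed (rule lborel_distr_isometry[of T R c, OF assms])

section \<open>Splitting hyperplanes\<close>

lemma reflection_eq: "reflection a b x = (2 * b / (a \<bullet> a)) *\<^sub>R a + reflection a 0 x"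
  by (simp add: reflection_def algebra_simps diff_divide_distrib)

lemma linear_reflection_0: "linear (reflection a 0)"
  by (intro linearI) (simp_all add: reflection_def inner_add_right algebra_simps add_divide_distrib)

lemma reflection_0_self_adjoint: "reflection a 0 x \<bullet> y = x \<bullet> reflection a 0 y"
  by (simp add: reflection_def inner_diff_left inner_diff_right inner_commute)

lemma norm_reflection_0: "norm (reflection a 0 x) = norm x"
proof (cases "a = 0")
  case False
  then have "reflection a 0 x \<bullet> reflection a 0 x = x \<bullet> x"
    by (simp add: reflection_def inner_diff_left inner_diff_right inner_commute power2_eq_square)
  then show ?thesis by (simp add: norm_eq_sqrt_inner)
qed (simp add: reflection_def)

lemma inner_reflection: "a \<noteq> 0 \<Longrightarrow> a \<bullet> reflection a b x - b = - (a \<bullet> x - b)"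
  by (simp add: reflection_def inner_diff_right)

lemma reflection_reflection: "a \<noteq> 0 \<Longrightarrow> reflection a b (reflection a b x) = x"
proof -
  assume "a \<noteq> 0"
  have "reflection a b (reflection a b x)
      = reflection a b x - (2 * (a \<bullet> reflection a b x - b) / (a \<bullet> a)) *\<^sub>R a"
    by (rule reflection_def)
  also have "\<dots> = reflection a b x + (2 * (a \<bullet> x - b) / (a \<bullet> a)) *\<^sub>R a"
    unfolding inner_reflection[OF \<open>a \<noteq> 0\<close>]
    by (simp only: mult_minus_right minus_divide_left[symmetric] scaleR_minus_left diff_minus_eq_add)
  also have "\<dots> = x" by (simp only: reflection_def diff_add_cancel)
  finally show ?thesis .
qed

lemma reflection_fixes: "a \<bullet> x = b \<Longrightarrow> reflection a b x = x"
  by (simp add: reflection_def)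

lemma lborel_preserving_reflection: "lborel_preserving (reflection a b)"
  by (rule lborel_preserving_isometry[OF linear_reflection_0 norm_reflection_0 reflection_eq])

lemma has_derivative_reflection:
  "(reflection a b has_derivative reflection a 0) (at x within S)"
  unfolding reflection_eq[of a b, abs_def]
  by (auto intro!: derivative_eq_intros linear_imp_has_derivative linear_reflection_0)

lemma continuous_on_reflection: "continuous_on S (reflection a b)"
  by (rule has_derivative_continuous_on[OF has_derivative_reflection])

lemma AE_hyperplane:
  fixes a :: "'a::euclidean_space"
  shows "a \<noteq> 0 \<Longrightarrow> AE x in lebesgue. a \<bullet> x \<noteq> b"
  using AE_not_in[of "{x. a \<bullet> x = b}" lebesgue] negligible_hyperplane[of a b]
  by (simp add: negligible_iff_null_sets)

lemma measurable_sgn_affine: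
  fixes a :: "'a::euclidean_space"
  shows "(\<lambda>x. sgn (a \<bullet> x - b)) \<in> borel_measurable lebesgue"
proof (rule measurable_completion)
  have "(\<lambda>x. sgn (a \<bullet> x - b)) = (\<lambda>x. if a \<bullet> x - b > 0 then 1 else if a \<bullet> x - b < 0 then - 1 else 0)"
    by (auto simp: sgn_if fun_eq_iff)
  then show "(\<lambda>x. sgn (a \<bullet> x - b)) \<in> borel_measurable lborel" by simp
qed

lemma abs_sgn_le_1: "\<bar>sgn (t :: real)\<bar> \<le> 1"
  by (simp add: sgn_if)

lemma integrable_sgn_mult:
  fixes a :: "'a::euclidean_space"
  assumes "integrable lebesgue h"
  shows "integrable lebesgue (\<lambda>x. sgn (a \<bullet> x - b) * h x)"
  by (rule Bochner_Integration.integrable_bound[OF assms])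
    (use assms measurable_sgn_affine[of a b] abs_sgn_le_1 in \<open>auto simp: abs_mult intro!: mult_left_le_one_le\<close>)

text \<open>Up to the hyperplane, which is null, \<open>q\<close> is \<open>h\<close> cut off to the
  positive half-space, so the reflected function is \<open>q\<close> plus its mirror image.
  Agreement of \<open>g\<close> almost everywhere is asked for because weak gradients are known no
  better.\<close>

lemma integral_reflect_pos:
  assumes h: "integrable lebesgue h" and a: "a \<noteq> 0"
    and g: "integrable lebesgue g" "AE x in lebesgue. g x = reflect_pos a b h x"
  shows "(LINT x|lebesgue. g x) = (LINT x|lebesgue. h x) + (LINT x|lebesgue. sgn (a \<bullet> x - b) * h x)"
proof -
  interpret lborel_preserving "reflection a b" by (rule lborel_preserving_reflection)
  define q where "q x = (h x + sgn (a \<bullet> x - b) * h x) / 2" for x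
  have q: "integrable lebesgue q"
    unfolding q_def using h integrable_sgn_mult[OF h] by simp
  note qR = integral_compose[OF q]
  have "AE x in lebesgue. g x = q x + q (reflection a b x)"
    using g(2) AE_hyperplane[OF a, of b]
  proof eventually_elim
    case (elim x)
    then show ?case
      using inner_reflection[OF a, of b x] by (auto simp: q_def reflect_pos_def sgn_if)
  qed
  then have "(LINT x|lebesgue. g x) = (LINT x|lebesgue. q x + q (reflection a b x))"
    using g(1) q qR(1) by (intro integral_cong_AE) auto
  also have "\<dots> = 2 * (LINT x|lebesgue. q x)"
    using q qR by simp
  also have "\<dots> = (LINT x|lebesgue. h x) + (LINT x|lebesgue. sgn (a \<bullet> x - b) * h x)"
    unfolding q_def using h integrable_sgn_mult[OF h] by simp
  finally show ?thesis .
qed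

lemma continuous_AE_eq:
  fixes f g :: "'a::euclidean_space \<Rightarrow> 'b::metric_space"
  assumes "continuous_on UNIV f" "continuous_on UNIV g" "AE x in lebesgue. f x = g x"
  shows "f = g"
proof -
  have "open {x. f x \<noteq> g x}"
    using open_Collect_neq[OF assms(1,2)] .
  moreover have "negligible {x. f x \<noteq> g x}"
    using assms(3) by (simp add: negligible_iff_null_sets completion.AE_iff_null_sets)
  ultimately show ?thesis using open_not_negligible by blast
qed

lemma locally_integrable_measurable:
  assumes "locally_integrable v" shows "v \<in> borel_measurable lebesgue"
proof (rule borel_measurable_LIMSEQ_metric)
  show "(\<lambda>x. indicator (cball 0 (real n)) x *\<^sub>R v x) \<in> borel_measurable lebesgue" for n
    using assms unfolding locally_integrable_def set_integrable_def by (intro borel_measurable_integrable) auto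
  show "(\<lambda>n. indicator (cball 0 (real n)) x *\<^sub>R v x) \<longlonglongrightarrow> v x" for x
  proof (rule tendsto_eventually)
    obtain m where m: "norm x \<le> real m" using real_arch_simple by blast
    show "\<forall>\<^sub>F n in sequentially. indicator (cball 0 (real n)) x *\<^sub>R v x = v x"
      using eventually_ge_at_top[of m] by eventually_elim (use m in \<open>auto simp: indicator_def\<close>)
  qed
qed

text \<open>An equality of predicates, so that the choice in \<open>weak_gradient\<close> picks the
  very same gradient for both functions.\<close>

lemma has_weak_gradient_AE_cong:
  assumes "locally_integrable v" "locally_integrable w" "AE x in lebesgue. w x = v x"
  shows "has_weak_gradient w = has_weak_gradient v"
proof -
  have "(LINT x|lebesgue. w x $ i * partial_deriv j \<phi> x) = (LINT x|lebesgue. v x $ i * partial_deriv j \<phi> x)"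
    if "test_function \<phi>" for \<phi> i j
  proof (rule integral_cong_AE)
    have [measurable]: "partial_deriv j \<phi> \<in> borel_measurable lebesgue"
      using test_function_has_derivative(2)[OF that]
      by (intro measurable_completion) (simp add: borel_measurable_continuous_onI)
    have "(\<lambda>x. u x $ i) \<in> borel_measurable lebesgue" if "locally_integrable u" for u :: "real ^ 'a \<Rightarrow> real ^ 'b"
      by (rule measurable_compose[OF locally_integrable_measurable[OF that]])
        (intro borel_measurable_continuous_onI continuous_intros)
    note [measurable] = this[OF assms(1)] this[OF assms(2)]
    show "(\<lambda>x. w x $ i * partial_deriv j \<phi> x) \<in> borel_measurable lebesgue"
      "(\<lambda>x. v x $ i * partial_deriv j \<phi> x) \<in> borel_measurable lebesgue" by measurable
    show "AE x in lebesgue. w x $ i * partial_deriv j \<phi> x = v x $ i * partial_deriv j \<phi> x"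
      using assms(3) by eventually_elim simp
  qed
  then show ?thesis by (auto simp: has_weak_gradient_def fun_eq_iff)
qed

lemma norm_map_rows:
  fixes A :: "real ^ 'N ^ 'n"
  assumes "\<And>x. norm (T x) = norm x"
  shows "norm (\<chi> i. T (A $ i)) = norm A"
  using assms by (simp add: norm_vec_def L2_set_def)

text \<open>The functional is kept as a pair and not as a function, so that the type
  \<open>(real ^ 'N) \<times> real\<close> supplies inner product, unit sphere and
  dimension.\<close>

definition aff :: "(real ^ 'N) \<times> real \<Rightarrow> real ^ 'N \<Rightarrow> real" where
  "aff \<phi> x = fst \<phi> \<bullet> x - snd \<phi>"

section \<open>The minimization problem and its continuously differentiable minimizers\<close>

locale minimization_problem =
  fixes X :: "(real ^ 'N \<Rightarrow> real ^ 'n) set"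
    and F :: "real ^ 'n \<Rightarrow> real \<Rightarrow> real"
    and G :: "nat \<Rightarrow> real ^ 'n \<Rightarrow> real \<Rightarrow> real"
    and k :: nat
    and lam :: "nat \<Rightarrow> real"
  assumes X: "function_space X"
    and F_integrable: "\<And>v. v \<in> X \<Longrightarrow> integrable lebesgue (integrand F v)"
    and G_integrable: "\<And>v j. v \<in> X \<Longrightarrow> j \<in> {1..k} \<Longrightarrow> integrable lebesgue (integrand (G j) v)"
    and k: "1 \<le> k" "k \<le> CARD('N) - 1"
    and reflect_in_X: "\<And>v a b. v \<in> X \<Longrightarrow> a \<noteq> 0 \<Longrightarrow> reflect_pos a b v \<in> X"
    and ex_C1: "\<And>v. minimizer X F k G lam v \<Longrightarrow> \<exists>w. C1_representative v w"
    and lam: "\<exists>j\<in>{1..k}. lam j \<noteq> 0"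
begin

definition C1_minimizer :: "(real ^ 'N \<Rightarrow> real ^ 'n) \<Rightarrow> (real ^ 'N \<Rightarrow> real ^ 'N ^ 'n) \<Rightarrow> bool" where
  "C1_minimizer u D \<longleftrightarrow> minimizer X F k G lam u \<and>
     (\<forall>x. (u has_derivative (\<lambda>h. D x *v h)) (at x)) \<and> continuous_on UNIV D"

text \<open>The weight \<open>sgn\<close> yields the difference of the two half-space integrals,
  which is odd in \<open>\<phi>\<close>, as Borsuk-Ulam demands.\<close>

definition splits :: "(real ^ 'N \<Rightarrow> real ^ 'n) \<Rightarrow> (real ^ 'N) \<times> real \<Rightarrow> bool" where
  "splits u \<phi> \<longleftrightarrow> fst \<phi> \<noteq> 0 \<and>
     (\<forall>j\<in>{1..k}. (LINT x|lebesgue. sgn (aff \<phi> x) * integrand (G j) u x) = 0)"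

lemma C1_minimizerD:
  assumes "C1_minimizer u D"
  shows "minimizer X F k G lam u" "(u has_derivative (\<lambda>h. D x *v h)) (at x within S)"
    "continuous_on S D" "u \<in> X" "continuous_on S u"
proof -
  show "minimizer X F k G lam u" using assms by (simp add: C1_minimizer_def)
  then show "u \<in> X" by (simp add: minimizer_def admissible_def)
  show d: "(u has_derivative (\<lambda>h. D x *v h)) (at x within S)" for x S
    using assms by (auto simp: C1_minimizer_def intro: has_derivative_at_withinI)
  show "continuous_on S D"
    using assms by (auto simp: C1_minimizer_def intro: continuous_on_subset)
  show "continuous_on S u" by (rule has_derivative_continuous_on[OF d])
qed

lemma in_X:
  assumes "v \<in> X" shows "locally_integrable v" "has_weak_gradient v (weak_gradient v)"
proof -
  have "\<exists>D. has_weak_gradient v D" using assms X unfolding function_space_def by blast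
  then show "has_weak_gradient v (weak_gradient v)"
    unfolding weak_gradient_def by (rule someI_ex)
qed (use assms X in \<open>auto simp: function_space_def\<close>)

lemma minimizer_AE_cong:
  assumes u: "minimizer X F k G lam u" and w: "AE x in lebesgue. w x = u x"
  shows "minimizer X F k G lam w"
proof -
  have uX: "u \<in> X" using u by (simp add: minimizer_def admissible_def)
  then have wX: "w \<in> X" using X w by (auto simp: function_space_def)
  have "weak_gradient w = weak_gradient u"
    unfolding weak_gradient_def
    by (simp add: has_weak_gradient_AE_cong[OF in_X(1)[OF uX] in_X(1)[OF wX] w])
  then have "AE x in lebesgue. integrand H w x = integrand H u x" for H
    using w by (auto simp: integrand_def)
  then have eq: "functional H w = functional H u"
    if "integrable lebesgue (integrand H u)" "integrable lebesgue (integrand H w)" for H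
    unfolding functional_def using that by (intro integral_cong_AE) auto
  have "functional (G j) w = functional (G j) u" if "j \<in> {1..k}" for j
    using G_integrable uX wX that by (intro eq) auto
  moreover have "functional F w = functional F u"
    using F_integrable uX wX by (intro eq) auto
  ultimately show ?thesis
    using u wX by (auto simp: minimizer_def admissible_def)
qed

lemma C1_minimizer_representative:
  assumes "minimizer X F k G lam u"
  obtains w D where "C1_representative u w" "C1_minimizer w D"
proof -
  obtain w where w: "C1_representative u w" using ex_C1[OF assms] by blast
  then have "minimizer X F k G lam w"
    using minimizer_AE_cong[OF assms] by (simp add: C1_representative_def)
  then show thesis using that w by (auto simp: C1_representative_def C1_def C1_minimizer_def)
qed

lemma weak_gradient_C1_minimizer:
  assumes "C1_minimizer u D" shows "AE x in lebesgue. weak_gradient u x = D x"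
  using weak_gradient_eq_classical[OF in_X[OF C1_minimizerD(4)[OF assms]] open_UNIV
      C1_minimizerD(2)[OF assms] C1_minimizerD(3)[OF assms]] by simp

text \<open>The linear part of a reflection is self-adjoint, so composing with it reflects the rows
  of the Jacobian matrix; this form makes it visible that the norm does not change.\<close>

lemma has_derivative_compose_reflection:
  assumes u: "C1_minimizer u D"
  shows "((\<lambda>x. u (reflection a b x)) has_derivative
      (\<lambda>h. (\<chi> i. reflection a 0 (D (reflection a b x) $ i)) *v h)) (at x)"
proof -
  have "(\<chi> i. reflection a 0 (D (reflection a b x) $ i)) *v h = D (reflection a b x) *v reflection a 0 h" for h
    by (simp add: vec_eq_iff matrix_vector_mul_component reflection_0_self_adjoint)
  then show ?thesis
    using has_derivative_compose[OF has_derivative_reflection[of a b x UNIV] C1_minimizerD(2)[OF u, of "reflection a b x" UNIV]]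
    by simp
qed

lemma continuous_on_reflected_derivative:
  assumes u: "C1_minimizer u D"
  shows "continuous_on S (\<lambda>x. \<chi> i. reflection a 0 (D (reflection a b x) $ i))"
  by (intro continuous_intros continuous_on_compose2[OF continuous_on_reflection[of UNIV]]
      continuous_on_compose2[OF C1_minimizerD(3)[OF u]] continuous_on_reflection) auto

text \<open>Membership in \<open>X\<close> provides some weak gradient of the reflected function. It
  is identified with the classical derivative on each open half-space, and the hyperplane between
  them is null.\<close>

lemma integrand_reflect_pos:
  assumes u: "C1_minimizer u D" and a: "a \<noteq> 0"
  shows "AE x in lebesgue. integrand H (reflect_pos a b u) x = reflect_pos a b (integrand H u) x"
proof -
  interpret lborel_preserving "reflection a b" by (rule lborel_preserving_reflection)
  let ?v = "reflect_pos a b u"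
  have vX: "?v \<in> X" using C1_minimizerD(4)[OF u] a by (rule reflect_in_X)
  note Dv = weak_gradient_eq_classical[OF in_X[OF vX]]
  have "AE x in lebesgue. x \<in> {x. a \<bullet> x > b} \<longrightarrow> weak_gradient ?v x = D x"
    by (rule Dv[where w = u]) 
      (auto simp: reflect_pos_def open_halfspace_gt intro: C1_minimizerD[OF u])
  moreover have "AE x in lebesgue. x \<in> {x. a \<bullet> x < b} \<longrightarrow>
      weak_gradient ?v x = (\<chi> i. reflection a 0 (D (reflection a b x) $ i))"
    by (rule Dv[where w = "\<lambda>x. u (reflection a b x)"])
      (auto simp: reflect_pos_def open_halfspace_lt
        intro: has_derivative_compose_reflection[OF u] continuous_on_reflected_derivative[OF u])
  moreover note weak_gradient_C1_minimizer[OF u] AE_compose[OF weak_gradient_C1_minimizer[OF u]]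
    AE_hyperplane[OF a, of b]
  ultimately show ?thesis
  proof eventually_elim
    case (elim x)
    then show ?case
      by (cases "a \<bullet> x > b") (auto simp: integrand_def reflect_pos_def norm_map_rows norm_reflection_0)
  qed
qed

lemma integrand_reflection_invariant:
  assumes u: "C1_minimizer u D" and inv: "\<And>x. u (reflection a b x) = u x"
  shows "AE x in lebesgue. integrand H u (reflection a b x) = integrand H u x"
proof -
  interpret lborel_preserving "reflection a b" by (rule lborel_preserving_reflection)
  have D: "D x = (\<chi> i. reflection a 0 (D (reflection a b x) $ i))" for x
    using has_derivative_unique[OF has_derivative_compose_reflection[OF u, of a b x, unfolded inv]
      C1_minimizerD(2)[OF u, of x UNIV]]
    by (simp add: matrix_eq fun_eq_iff)
  have n: "norm (D (reflection a b x)) = norm (D x)" for x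
    by (subst (2) D) (simp add: norm_map_rows norm_reflection_0)
  show ?thesis
    using weak_gradient_C1_minimizer[OF u] AE_compose[OF weak_gradient_C1_minimizer[OF u]]
    by eventually_elim (simp add: integrand_def inv n)
qed

end

lemma tendsto_integral_sgn_affine:
  fixes a :: "nat \<Rightarrow> 'a::euclidean_space"
  assumes h: "integrable lebesgue h"
    and lim: "AE x in lebesgue. (\<lambda>n. sgn (a n \<bullet> x - b n)) \<longlonglongrightarrow> s x" and s: "s \<in> borel_measurable lebesgue"
  shows "(\<lambda>n. LINT x|lebesgue. sgn (a n \<bullet> x - b n) * h x) \<longlonglongrightarrow> (LINT x|lebesgue. s x * h x)"
proof (rule integral_dominated_convergence)
  show "(\<lambda>x. s x * h x) \<in> borel_measurable lebesgue"
    using s h by simp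
  show "integrable lebesgue (\<lambda>x. norm (h x))" using h by simp
  show "(\<lambda>x. sgn (a n \<bullet> x - b n) * h x) \<in> borel_measurable lebesgue" for n
    using integrable_sgn_mult[OF h] by simp
  show "AE x in lebesgue. (\<lambda>n. sgn (a n \<bullet> x - b n) * h x) \<longlonglongrightarrow> s x * h x"
    using lim by eventually_elim (rule tendsto_mult_right)
  show "AE x in lebesgue. norm (sgn (a n \<bullet> x - b n) * h x) \<le> norm (h x)" for n
    by (auto simp: abs_mult intro!: mult_left_le_one_le abs_sgn_le_1)
qed

text \<open>\<open>sgn\<close> jumps only at 0, and the zero set of a nonzero functional is null: a
  hyperplane or, for a constant, empty. Hence dominated convergence applies.\<close>

lemma continuous_on_integral_sgn_aff:
  fixes L :: "((real ^ 'N) \<times> real) set"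
  assumes h: "integrable lebesgue h" and L: "0 \<notin> L"
  shows "continuous_on L (\<lambda>\<phi>. LINT x|lebesgue. sgn (aff \<phi> x) * h x)"
proof (rule continuous_on_sequentiallyI)
  fix p :: "nat \<Rightarrow> (real ^ 'N) \<times> real" and \<phi>
  assume \<phi>: "\<phi> \<in> L" "p \<longlonglongrightarrow> \<phi>"
  have "AE x in lebesgue. aff \<phi> x \<noteq> 0"
  proof (cases "fst \<phi> = 0")
    case True
    then have "snd \<phi> \<noteq> 0" using L \<phi>(1) by (cases \<phi>) (auto simp: zero_prod_def)
    then show ?thesis using True by (simp add: aff_def)
  next
    case False
    from AE_hyperplane[OF this, of "snd \<phi>"] show ?thesis by (simp add: aff_def)
  qed
  then have "AE x in lebesgue. (\<lambda>n. sgn (fst (p n) \<bullet> x - snd (p n))) \<longlonglongrightarrow> sgn (fst \<phi> \<bullet> x - snd \<phi>)"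
    by eventually_elim (intro tendsto_intros \<phi>(2), simp add: aff_def)
  from tendsto_integral_sgn_affine[OF h this measurable_sgn_affine]
  show "(\<lambda>n. LINT x|lebesgue. sgn (aff (p n) x) * h x) \<longlonglongrightarrow> (LINT x|lebesgue. sgn (aff \<phi> x) * h x)"
    by (simp add: aff_def)
qed

lemma halfspace_limit:
  fixes f g :: "real ^ 'N \<Rightarrow> 'c::t2_space"
  assumes "continuous_on UNIV f" "continuous_on UNIV g" "a \<noteq> 0"
    and eq: "\<And>x. a \<bullet> x > b \<Longrightarrow> f x = g x" and x: "a \<bullet> x \<ge> b"
  shows "f x = g x"
proof (rule tendsto_unique[of "at_right (0::real)"])
  have path: "((\<lambda>t. x + t *\<^sub>R a) \<longlongrightarrow> x + 0 *\<^sub>R a) (at_right 0)" by (intro tendsto_intros)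
  show "((\<lambda>t. f (x + t *\<^sub>R a)) \<longlongrightarrow> f x) (at_right 0)"
    using continuous_on_tendsto_compose[OF assms(1) path] by simp
  have "((\<lambda>t. g (x + t *\<^sub>R a)) \<longlongrightarrow> g x) (at_right 0)"
    using continuous_on_tendsto_compose[OF assms(2) path] by simp
  moreover have "\<forall>\<^sub>F t in at_right 0. g (x + t *\<^sub>R a) = f (x + t *\<^sub>R a)"
    using eventually_at_right_less[of "0::real"]
  proof eventually_elim
    case (elim t)
    then have "t * (a \<bullet> a) > 0" using \<open>a \<noteq> 0\<close> by simp
    then have "a \<bullet> (x + t *\<^sub>R a) > b" using x by (simp add: inner_add_right)
    then show ?case using eq by simp
  qed
  ultimately show "((\<lambda>t. f (x + t *\<^sub>R a)) \<longlongrightarrow> g x) (at_right 0)"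
    by (rule Lim_transform_eventually)
qed auto

context minimization_problem
begin

lemma functional_C1_minimizer:
  assumes "C1_minimizer u D"
  shows "integrable lebesgue (integrand F u)" "j \<in> {1..k} \<Longrightarrow> integrable lebesgue (integrand (G j) u)"
    "j \<in> {1..k} \<Longrightarrow> (LINT x|lebesgue. integrand (G j) u x) = lam j"
  using C1_minimizerD[OF assms] F_integrable G_integrable
  by (auto simp: minimizer_def admissible_def functional_def)

text \<open>Negation exchanges the half-spaces: \<open>reflect_pos\<close> for
  \<open>- \<phi>\<close> copies the other side of the hyperplane.\<close>

lemma splits_uminus: "splits u \<phi> \<Longrightarrow> splits u (- \<phi>)"
proof -
  assume "splits u \<phi>"
  moreover have "sgn (aff (- \<phi>) x) = - sgn (aff \<phi> x)" for x
    by (simp add: aff_def sgn_minus[symmetric] del: sgn_minus)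
  ultimately show ?thesis by (simp add: splits_def)
qed

text \<open>
  The energies of the two reflected functions add up to twice the energy of \<open>u\<close>, and both
  functions satisfy the constraints.
\<close>

lemma reflect_pos_minimizer:
  assumes u: "C1_minimizer u D" and s: "splits u \<phi>"
  shows "minimizer X F k G lam (reflect_pos (fst \<phi>) (snd \<phi>) u)"
proof -
  note uX = C1_minimizerD(4)[OF u]
  \<comment> \<open>Stated for every splitting functional, as it serves both \<open>\<phi>\<close>
    and \<open>- \<phi>\<close>.\<close>
  have adm: "reflect_pos (fst \<psi>) (snd \<psi>) u \<in> admissible X k G lam" if s: "splits u \<psi>" for \<psi>
  proof -
    have a: "fst \<psi> \<noteq> 0" using s by (simp add: splits_def)
    note vX = reflect_in_X[OF uX a, of "snd \<psi>"]
    have "functional (G j) (reflect_pos (fst \<psi>) (snd \<psi>) u) = lam j" if j: "j \<in> {1..k}" for j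
      using integral_reflect_pos[OF functional_C1_minimizer(2)[OF u j] a G_integrable[OF vX j]
          integrand_reflect_pos[OF u a]] functional_C1_minimizer(3)[OF u j] s j
      by (simp add: functional_def splits_def aff_def)
    then show ?thesis using vX by (simp add: admissible_def)
  qed
  define e where "e = (LINT x|lebesgue. sgn (aff \<phi> x) * integrand F u x)"
  have en: "functional F (reflect_pos (fst \<psi>) (snd \<psi>) u)
      = functional F u + (LINT x|lebesgue. sgn (aff \<psi> x) * integrand F u x)" if s: "splits u \<psi>" for \<psi>
  proof -
    have a: "fst \<psi> \<noteq> 0" using s by (simp add: splits_def)
    show ?thesis
      using integral_reflect_pos[OF functional_C1_minimizer(1)[OF u] a
          F_integrable[OF reflect_in_X[OF uX a]] integrand_reflect_pos[OF u a]]
      by (simp add: functional_def aff_def)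
  qed
  have sgn_neg: "sgn (aff (- \<phi>) x) = - sgn (aff \<phi> x)" for x
    by (simp add: aff_def sgn_minus[symmetric] del: sgn_minus)
  have min: "functional F u \<le> functional F v" if "v \<in> admissible X k G lam" for v
    using C1_minimizerD(1)[OF u] that by (simp add: minimizer_def)
  have "e \<ge> 0" using min[OF adm[OF s]] en[OF s] by (simp add: e_def)
  moreover have "e \<le> 0"
    using min[OF adm[OF splits_uminus[OF s]]] en[OF splits_uminus[OF s]] by (simp add: e_def sgn_neg)
  ultimately have "functional F (reflect_pos (fst \<phi>) (snd \<phi>) u) = functional F u"
    using en[OF s] by (simp add: e_def)
  then show ?thesis using adm[OF s] min by (auto simp: minimizer_def)
qed

text \<open>The reflected function is continuous, so it equals its \<open>C1\<close> representative
  everywhere. Being even along the normal, it has zero normal derivative on the hyperplane; by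
  continuity its derivative agrees with that of \<open>u\<close> up to the hyperplane.\<close>

lemma reflect_pos_C1_minimizer:
  assumes u: "C1_minimizer u D" and s: "splits u \<phi>"
  obtains D' where "C1_minimizer (reflect_pos (fst \<phi>) (snd \<phi>) u) D'"
    "\<And>x. aff \<phi> x \<ge> 0 \<Longrightarrow> D' x = D x" "\<And>x. aff \<phi> x = 0 \<Longrightarrow> D x *v fst \<phi> = 0"
proof -
  define a b where "a = fst \<phi>" "b = snd \<phi>"
  have a: "a \<noteq> 0" using s by (simp add: splits_def a_b_def)
  let ?v = "reflect_pos a b u"
  have v: "minimizer X F k G lam ?v" using reflect_pos_minimizer[OF u s] by (simp add: a_b_def)
  obtain w D' where w: "C1_representative ?v w" "C1_minimizer w D'"
    by (rule C1_minimizer_representative[OF v])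
  have cont: "continuous_on UNIV ?v"
  proof -
    have "continuous_on ({x. a \<bullet> x \<ge> b} \<union> {x. a \<bullet> x \<le> b}) (\<lambda>x. if a \<bullet> x \<ge> b then u x else u (reflection a b x))"
      by (rule continuous_on_If)
        (auto simp: closed_halfspace_ge closed_halfspace_le reflection_fixes
          intro!: continuous_on_compose2[OF C1_minimizerD(5)[OF u, of UNIV]] continuous_on_reflection C1_minimizerD(5)[OF u])
    moreover have "{x. a \<bullet> x \<ge> b} \<union> {x. a \<bullet> x \<le> b} = UNIV" by auto
    ultimately show ?thesis by (simp add: reflect_pos_def[abs_def])
  qed
  have "w = ?v"
    using w(1) by (intro continuous_AE_eq[OF C1_minimizerD(5)[OF w(2)] cont]) (simp add: C1_representative_def)
  with w have D': "C1_minimizer ?v D'" by simp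
  have "D' x = D x" if "a \<bullet> x > b" for x
  proof -
    have "(?v has_derivative (\<lambda>h. D x *v h)) (at x)"
      by (rule has_derivative_transform_within_open[OF C1_minimizerD(2)[OF u] open_halfspace_gt[of b a]])
        (use that in \<open>auto simp: reflect_pos_def\<close>)
    from has_derivative_unique[OF this C1_minimizerD(2)[OF D', of x UNIV]]
    show ?thesis by (simp add: matrix_eq fun_eq_iff)
  qed
  then have DD: "D' x = D x" if "a \<bullet> x \<ge> b" for x
    using halfspace_limit[OF C1_minimizerD(3)[OF D'] C1_minimizerD(3)[OF u] a, of b x] that by blast
  have "D x *v a = 0" if x: "a \<bullet> x = b" for x
  proof -
    have "a \<bullet> (x + t *\<^sub>R a) - b = t * (a \<bullet> a)" for t using x by (simp add: inner_add_right)
    then have "reflection a b (x + t *\<^sub>R a) = x + t *\<^sub>R a - (2 * t) *\<^sub>R a" for t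
      using a by (simp add: reflection_def)
    moreover have "(2 * t) *\<^sub>R a = t *\<^sub>R a + t *\<^sub>R a" for t
      by (metis mult_2 scaleR_add_left)
    ultimately have "reflection a b (x + t *\<^sub>R a) = x - t *\<^sub>R a" for t
      by simp
    then have refl: "reflection a b (x + t *\<^sub>R a) = x + (- t) *\<^sub>R a" for t by simp
    have "a \<bullet> a > 0" using a by simp
    then have side: "a \<bullet> (x + t *\<^sub>R a) \<ge> b \<longleftrightarrow> t \<ge> 0" for t
      using x by (simp add: inner_add_right zero_le_mult_iff del: inner_gt_zero_iff)
    have even: "?v (x + t *\<^sub>R a) = ?v (x + (- t) *\<^sub>R a)" for t
      unfolding reflect_pos_def side refl by (cases t "0 :: real" rule: linorder_cases) simp_all
    have d1: "((\<lambda>t. ?v (x + t *\<^sub>R a)) has_derivative (\<lambda>h. D' (x + 0 *\<^sub>R a) *v (h *\<^sub>R a))) (at 0)"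
      by (rule has_derivative_compose[OF _ C1_minimizerD(2)[OF D']]) (auto intro!: derivative_eq_intros)
    have "((\<lambda>t. ?v (x + (- t) *\<^sub>R a)) has_derivative (\<lambda>h. D' (x + (- 0) *\<^sub>R a) *v ((- h) *\<^sub>R a))) (at 0)"
      by (rule has_derivative_compose[OF _ C1_minimizerD(2)[OF D']]) (auto intro!: derivative_eq_intros)
    then have d2: "((\<lambda>t. ?v (x + t *\<^sub>R a)) has_derivative (\<lambda>h. D' (x + (- 0) *\<^sub>R a) *v ((- h) *\<^sub>R a))) (at 0)"
      by (simp only: even[symmetric])
    have "D' x *v a = - (D' x *v a)"
      using fun_cong[OF has_derivative_unique[OF d1 d2], of 1]
      by (simp add: matrix_vector_mult_scaleR linear_neg[OF matrix_vector_mul_linear])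
    then have "(D' x *v a) $ i = - (D' x *v a) $ i" for i
      by (metis vector_uminus_component)
    then have "D' x *v a = 0" by (simp add: vec_eq_iff)
    then show ?thesis using DD[of x] x by simp
  qed
  then show thesis
    using that[of D'] D' DD by (simp add: a_b_def aff_def)
qed

lemma splits_normal_derivative:
  assumes "C1_minimizer u D" "splits u \<phi>" "aff \<phi> x = 0"
  shows "D x *v fst \<phi> = 0"
  using reflect_pos_C1_minimizer[OF assms(1,2)] assms(3) by metis

lemma exists_splitting:
  assumes u: "C1_minimizer u D" and L: "subspace L" "k < dim L"
  obtains \<phi> where "\<phi> \<in> L" "splits u \<phi>"
proof -
  \<comment> \<open>\<open>G\<close> is indexed from 1, the functions in \<open>Borsuk_Ulam\<close>
    from 0.\<close>
  define h where "h j \<phi> = (LINT x|lebesgue. sgn (aff \<phi> x) * integrand (G (Suc j)) u x)" for j \<phi>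
  obtain \<phi> where \<phi>: "\<phi> \<in> L" "norm \<phi> = 1" "\<And>j. j < k \<Longrightarrow> h j \<phi> = 0"
  proof (rule Borsuk_Ulam[OF L, of h])
    show "continuous_on (sphere 0 1 \<inter> L) (h j)" if "j < k" for j
      unfolding h_def using that
      by (intro continuous_on_integral_sgn_aff functional_C1_minimizer(2)[OF u]) auto
    have "sgn (aff (- \<phi>) x) = - sgn (aff \<phi> x)" for \<phi> and x :: "real ^ 'N"
      by (simp add: aff_def sgn_minus[symmetric] del: sgn_minus)
    then show "h j (- \<phi>) = - h j \<phi>" for j \<phi> by (simp add: h_def)
  qed blast
  have 0: "(LINT x|lebesgue. sgn (aff \<phi> x) * integrand (G j) u x) = 0" if "j \<in> {1..k}" for j
    using \<phi>(3)[of "j - 1"] that by (auto simp: h_def)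
  \<comment> \<open>A nonzero constant has the whole space on one side, so its integrals would be
    the numbers \<open>lam j\<close> up to sign, and these are not all 0.\<close>
  have "fst \<phi> \<noteq> 0"
  proof
    assume f: "fst \<phi> = 0"
    then have "snd \<phi> \<noteq> 0" using \<phi>(2) by (cases \<phi>) auto
    obtain j where j: "j \<in> {1..k}" "lam j \<noteq> 0" using lam by blast
    have "sgn (- snd \<phi>) * lam j = 0"
      using 0[OF j(1)] functional_C1_minimizer(3)[OF u j(1)] f by (simp add: aff_def)
    with j(2) \<open>snd \<phi> \<noteq> 0\<close> show False by (simp add: sgn_if split: if_splits)
  qed
  with 0 \<phi>(1) that show thesis by (auto simp: splits_def)
qed

text \<open>If \<open>u\<close> were invariant along \<open>a\<close>, the difference
  \<open>M b\<close> of the shares on the two sides of \<open>a \<bullet> x = b\<close> would not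
  depend on \<open>b\<close>. But it tends to \<open>- lam j\<close> and to \<open>lam j\<close> as
  \<open>b\<close> tends to plus and minus infinity.\<close>

lemma not_translation_invariant:
  assumes u: "C1_minimizer u D" and a: "a \<noteq> 0" and 0: "\<And>x. D x *v a = 0"
  shows False
proof -
  obtain j where j: "j \<in> {1..k}" "lam j \<noteq> 0" using lam by blast
  define h where "h = integrand (G j) u"
  have h: "integrable lebesgue h" "(LINT x|lebesgue. h x) = lam j"
    using functional_C1_minimizer[OF u] j(1) by (auto simp: h_def)
  have u_shift: "u (x + c *\<^sub>R a) = u x" for x c
  proof -
    have "((\<lambda>t. u (x + t *\<^sub>R a)) has_derivative (\<lambda>t. 0)) (at t)" for t
    proof -
      have "((\<lambda>t. u (x + t *\<^sub>R a)) has_derivative (\<lambda>h. D (x + t *\<^sub>R a) *v (h *\<^sub>R a))) (at t)"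
        by (rule has_derivative_compose[OF _ C1_minimizerD(2)[OF u]]) (auto intro!: derivative_eq_intros)
      then show ?thesis by (simp add: matrix_vector_mult_scaleR 0)
    qed
    then have "\<exists>d. \<forall>t\<in>UNIV. u (x + t *\<^sub>R a) = d"
      by (intro has_derivative_zero_constant) auto
    then have "u (x + c *\<^sub>R a) = u (x + 0 *\<^sub>R a)" by (metis UNIV_I)
    then show ?thesis by simp
  qed
  have u_shift': "u (c *\<^sub>R a + x) = u x" for x c
    using u_shift[of x c] by (simp add: add.commute)
  have D_shift: "D (c *\<^sub>R a + x) = D x" for x c
  proof -
    have "((\<lambda>x. u (x + c *\<^sub>R a)) has_derivative (\<lambda>h. D (x + c *\<^sub>R a) *v h)) (at x)"
      by (rule has_derivative_compose[OF _ C1_minimizerD(2)[OF u]]) (auto intro!: derivative_eq_intros)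
    then have "(u has_derivative (\<lambda>h. D (x + c *\<^sub>R a) *v h)) (at x)" by (simp add: u_shift)
    from has_derivative_unique[OF this C1_minimizerD(2)[OF u, of x UNIV]]
    show ?thesis by (simp add: matrix_eq fun_eq_iff add.commute)
  qed
  define M where "M b = (LINT x|lebesgue. sgn (a \<bullet> x - b) * h x)" for b
  have M_shift: "M b = M (b - c * (a \<bullet> a))" for b c
  proof -
    interpret lborel_preserving "\<lambda>x. c *\<^sub>R a + x"
      by (rule lborel_preserving_isometry[of "\<lambda>x. x"]) (auto simp: linear_ident)
    have ae: "AE x in lebesgue. h (c *\<^sub>R a + x) = h x"
      using weak_gradient_C1_minimizer[OF u] AE_compose[OF weak_gradient_C1_minimizer[OF u]]
      by eventually_elim (simp add: h_def integrand_def D_shift u_shift')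
    note hb = integrable_sgn_mult[OF h(1), of a]
    have "M b = (LINT x|lebesgue. sgn (a \<bullet> (c *\<^sub>R a + x) - b) * h (c *\<^sub>R a + x))"
      unfolding M_def by (rule integral_compose(2)[OF hb, symmetric])
    also have "\<dots> = M (b - c * (a \<bullet> a))"
      unfolding M_def
    proof (rule integral_cong_AE)
      show "(\<lambda>x. sgn (a \<bullet> (c *\<^sub>R a + x) - b) * h (c *\<^sub>R a + x)) \<in> borel_measurable lebesgue"
        using integral_compose(1)[OF hb] by simp
      show "AE x in lebesgue. sgn (a \<bullet> (c *\<^sub>R a + x) - b) * h (c *\<^sub>R a + x) = sgn (a \<bullet> x - (b - c * (a \<bullet> a))) * h x"
        using ae by eventually_elim (simp add: inner_add_right algebra_simps)
    qed (use hb in simp)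
    finally show ?thesis .
  qed
  have M_const: "M b = M b'" for b b'
    using M_shift[of b "(b - b') / (a \<bullet> a)"] a by simp
  have ev: "\<forall>\<^sub>F n in sequentially. r < real n" for r
    using filterlim_real_sequentially by (simp add: filterlim_at_top_dense)
  have "(\<lambda>n. M (real n)) \<longlonglongrightarrow> (LINT x|lebesgue. - 1 * h x)"
    unfolding M_def
  proof (rule tendsto_integral_sgn_affine[OF h(1)])
    show "AE x in lebesgue. (\<lambda>n. sgn (a \<bullet> x - real n)) \<longlonglongrightarrow> - 1"
    proof (intro AE_I2 tendsto_eventually)
      show "\<forall>\<^sub>F n in sequentially. sgn (a \<bullet> x - real n) = - 1" for x
        using ev[of "a \<bullet> x"] by eventually_elim (simp add: sgn_if)
    qed
  qed simp
  moreover have "(\<lambda>n. M (- real n)) \<longlonglongrightarrow> (LINT x|lebesgue. 1 * h x)"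
    unfolding M_def
  proof (rule tendsto_integral_sgn_affine[OF h(1)])
    show "AE x in lebesgue. (\<lambda>n. sgn (a \<bullet> x - - real n)) \<longlonglongrightarrow> 1"
    proof (intro AE_I2 tendsto_eventually)
      show "\<forall>\<^sub>F n in sequentially. sgn (a \<bullet> x - - real n) = 1" for x
        using ev[of "- (a \<bullet> x)"] by eventually_elim (simp add: sgn_if)
    qed
  qed simp
  ultimately have "(\<lambda>n::nat. M 0) \<longlonglongrightarrow> - lam j" "(\<lambda>n::nat. M 0) \<longlonglongrightarrow> lam j"
    using h by (simp_all add: M_const[of "real n" 0 for n] M_const[of "- real n" 0 for n])
  then have "lam j = - lam j" by (rule LIMSEQ_unique[rotated])
  with j(2) show False by simp
qed

text \<open>The composite of the two reflections preserves the measure and, almost everywhere, the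
  integrands, while it changes the sign of the weight; hence each integral equals its own
  negative.\<close>

lemma splits_if_reversed:
  assumes u: "C1_minimizer u D" and inv1: "\<And>x. u (reflection a1 b1 x) = u x"
    and inv2: "\<And>x. u (reflection a2 b2 x) = u x" and \<phi>: "fst \<phi> \<noteq> 0"
    and rev: "\<And>x. aff \<phi> (reflection a1 b1 (reflection a2 b2 x)) = - aff \<phi> x"
  shows "splits u \<phi>"
proof -
  have "(LINT x|lebesgue. sgn (aff \<phi> x) * integrand (G j) u x) = 0" if j: "j \<in> {1..k}" for j
  proof -
    define h where "h = integrand (G j) u"
    have h: "integrable lebesgue h"
      using functional_C1_minimizer[OF u] j by (auto simp: h_def)
    have step: "integrable lebesgue (\<lambda>x. \<sigma> (reflection a b x) * h x)
        \<and> (LINT x|lebesgue. \<sigma> (reflection a b x) * h x) = (LINT x|lebesgue. \<sigma> x * h x)"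
      if \<sigma>: "integrable lebesgue (\<lambda>x. \<sigma> x * h x)" "\<sigma> \<in> borel_measurable lebesgue"
        and inv: "\<And>x. u (reflection a b x) = u x"
      for \<sigma> a b
    proof -
      interpret lborel_preserving "reflection a b" by (rule lborel_preserving_reflection)
      have ae: "AE x in lebesgue. \<sigma> (reflection a b x) * h (reflection a b x) = \<sigma> (reflection a b x) * h x"
        using integrand_reflection_invariant[OF u inv, of "G j"] by eventually_elim (simp add: h_def)
      note c = integral_compose[OF \<sigma>(1)]
      have m: "(\<lambda>x. \<sigma> (reflection a b x) * h x) \<in> borel_measurable lebesgue"
        using measurable_compose_R[OF \<sigma>(2)] h by simp
      show ?thesis
        using integrable_cong_AE[OF _ m ae] integral_cong_AE[OF _ m ae] c by auto
    qed
    let ?s = "\<lambda>x. sgn (aff \<phi> x)"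
    have s: "integrable lebesgue (\<lambda>x. ?s x * h x)" "?s \<in> borel_measurable lebesgue"
      using integrable_sgn_mult[OF h] measurable_sgn_affine by (auto simp: aff_def)
    note s1 = step[OF s inv1]
    have "(\<lambda>x. ?s (reflection a1 b1 x)) \<in> borel_measurable lebesgue"
      by (rule lborel_preserving.measurable_compose_R[OF lborel_preserving_reflection s(2)])
    note s2 = step[OF conjunct1[OF s1] this inv2]
    have "(LINT x|lebesgue. ?s x * h x) = (LINT x|lebesgue. ?s (reflection a1 b1 (reflection a2 b2 x)) * h x)"
      using s1 s2 by simp
    also have "\<dots> = - (LINT x|lebesgue. ?s x * h x)"
      by (simp add: rev sgn_minus)
    finally show ?thesis by (simp add: h_def)
  qed
  then show ?thesis using \<phi> by (simp add: splits_def)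
qed

end

section \<open>Killing fields that annihilate a function\<close>

text \<open>For orthonormal gradients this is the velocity field of the rotations about the common
  zero set; for a constant \<open>\<psi>\<close> it is a multiple of the translation field
  \<open>fst \<phi>\<close>.\<close>

definition kfield :: "(real ^ 'N) \<times> real \<Rightarrow> (real ^ 'N) \<times> real \<Rightarrow> real ^ 'N \<Rightarrow> real ^ 'N" where
  "kfield \<phi> \<psi> x = aff \<phi> x *\<^sub>R fst \<psi> - aff \<psi> x *\<^sub>R fst \<phi>"

lemma aff_add [simp]: "aff (\<phi> + \<psi>) x = aff \<phi> x + aff \<psi> x"
  and aff_diff [simp]: "aff (\<phi> - \<psi>) x = aff \<phi> x - aff \<psi> x"
  and aff_scaleR [simp]: "aff (c *\<^sub>R \<phi>) x = c * aff \<phi> x"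
  and aff_0 [simp]: "aff 0 x = 0"
  by (simp_all add: aff_def inner_add_left inner_diff_left algebra_simps)

lemma aff_shift: "aff \<phi> (x + y) = aff \<phi> x + fst \<phi> \<bullet> y"
  by (simp add: aff_def inner_add_right)

lemma aff_eq_0_imp: "aff \<phi> x = 0 \<Longrightarrow> \<phi> \<noteq> 0 \<Longrightarrow> fst \<phi> \<noteq> 0"
  by (cases \<phi>) (auto simp: aff_def zero_prod_def)

lemma continuous_on_aff [continuous_intros]: "continuous_on S (aff \<phi>)"
  unfolding aff_def by (intro continuous_intros)

lemma continuous_on_kfield [continuous_intros]: "continuous_on S (kfield \<phi> \<psi>)"
  unfolding kfield_def by (intro continuous_intros)

lemma aff_nonzero_dense:
  fixes f :: "real ^ 'N \<Rightarrow> 'c::t2_space"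
  assumes "\<phi> \<noteq> 0" "open U" "continuous_on U f" "x \<in> U"
    and f: "\<And>x. x \<in> U \<Longrightarrow> aff \<phi> x \<noteq> 0 \<Longrightarrow> f x = c"
  shows "f x = c"
proof (cases "aff \<phi> x = 0")
  case True
  then have a: "fst \<phi> \<noteq> 0" using aff_eq_0_imp assms(1) by blast
  have path: "((\<lambda>t. x + t *\<^sub>R fst \<phi>) \<longlongrightarrow> x) (at_right (0::real))"
    by (auto intro!: tendsto_eq_intros)
  have in_U: "\<forall>\<^sub>F t in at_right 0. x + t *\<^sub>R fst \<phi> \<in> U"
    using topological_tendstoD[OF path assms(2,4)] .
  have "((\<lambda>t. f (x + t *\<^sub>R fst \<phi>)) \<longlongrightarrow> f x) (at_right 0)"
    by (rule continuous_on_tendsto_compose[OF assms(3) path assms(4) in_U])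
  moreover have "\<forall>\<^sub>F t in at_right (0::real). f (x + t *\<^sub>R fst \<phi>) = c"
    using in_U eventually_at_right_less[of "0::real"]
    by eventually_elim (use f True a in \<open>auto simp: aff_shift\<close>)
  ultimately have "((\<lambda>t::real. c) \<longlongrightarrow> f x) (at_right 0)"
    by (rule Lim_transform_eventually)
  then show ?thesis by (intro tendsto_unique[of "at_right (0::real)" "\<lambda>t. c" "f x" c]) auto
qed (use assms in auto)

lemma aff_vanishing_imp_multiple:
  assumes a: "fst \<phi> \<noteq> 0" and v: "\<And>x. aff \<phi> x = 0 \<Longrightarrow> aff \<xi> x = 0"
  obtains c where "\<xi> = c *\<^sub>R \<phi>"
proof -
  define x0 where "x0 = (snd \<phi> / (fst \<phi> \<bullet> fst \<phi>)) *\<^sub>R fst \<phi>"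
  define c where "c = (fst \<xi> \<bullet> fst \<phi>) / (fst \<phi> \<bullet> fst \<phi>)"
  \<comment> \<open>The part of the gradient of \<open>\<xi>\<close> orthogonal to that of
    \<open>\<phi>\<close>; a step along it from \<open>x0\<close> stays in the zero set of
    \<open>\<phi>\<close>.\<close>
  define y where "y = fst \<xi> - c *\<^sub>R fst \<phi>"
  have x0: "aff \<phi> x0 = 0" using a by (simp add: aff_def x0_def)
  have y: "fst \<phi> \<bullet> y = 0" using a by (simp add: y_def c_def inner_diff_right inner_commute)
  have "aff \<xi> (x0 + y) = 0" using v[of "x0 + y"] x0 y by (simp add: aff_shift)
  then have "fst \<xi> \<bullet> y = 0" using v[OF x0] by (simp add: aff_shift)
  then have "y \<bullet> y = 0" using y by (simp add: y_def inner_diff_left)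
  then have f: "fst \<xi> = c *\<^sub>R fst \<phi>" by (simp add: y_def)
  moreover have "snd \<xi> = c * snd \<phi>"
    using v[OF x0] x0 f by (simp add: aff_def)
  ultimately show thesis using that[of c] by (simp add: prod_eq_iff)
qed

text \<open>
  The displacement is chosen so that the pair of values of \<open>\<phi>\<close> and \<open>\<psi>\<close> is turned by the angle \<open>t\<close>.
\<close>

definition rotation :: "(real ^ 'N) \<times> real \<Rightarrow> (real ^ 'N) \<times> real \<Rightarrow> real \<Rightarrow> real ^ 'N \<Rightarrow> real ^ 'N" where
  "rotation \<phi> \<psi> t x = x + (cos t * aff \<phi> x - sin t * aff \<psi> x - aff \<phi> x) *\<^sub>R fst \<phi>
      + (sin t * aff \<phi> x + cos t * aff \<psi> x - aff \<psi> x) *\<^sub>R fst \<psi>"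

definition orthonormal_pair :: "(real ^ 'N) \<times> real \<Rightarrow> (real ^ 'N) \<times> real \<Rightarrow> bool" where
  "orthonormal_pair \<phi> \<psi> \<longleftrightarrow> fst \<phi> \<bullet> fst \<phi> = 1 \<and> fst \<psi> \<bullet> fst \<psi> = 1 \<and> fst \<phi> \<bullet> fst \<psi> = 0"

lemma rotation_0 [simp]: "rotation \<phi> \<psi> 0 x = x"
  by (simp add: rotation_def)

lemma aff_rotation:
  assumes "orthonormal_pair \<phi> \<psi>"
  shows "aff \<phi> (rotation \<phi> \<psi> t x) = cos t * aff \<phi> x - sin t * aff \<psi> x"
    "aff \<psi> (rotation \<phi> \<psi> t x) = sin t * aff \<phi> x + cos t * aff \<psi> x"
  using assms by (simp_all add: rotation_def orthonormal_pair_def aff_shift inner_add_right inner_commute add.assoc)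

lemma has_derivative_rotation:
  assumes "orthonormal_pair \<phi> \<psi>"
  shows "((\<lambda>t. rotation \<phi> \<psi> t x) has_derivative (\<lambda>h. h *\<^sub>R kfield \<phi> \<psi> (rotation \<phi> \<psi> t x))) (at t within S)"
proof -
  have k: "kfield \<phi> \<psi> (rotation \<phi> \<psi> t x)
      = (cos t * aff \<phi> x - sin t * aff \<psi> x) *\<^sub>R fst \<psi> - (sin t * aff \<phi> x + cos t * aff \<psi> x) *\<^sub>R fst \<phi>"
    by (simp add: kfield_def aff_rotation[OF assms])
  show ?thesis
    unfolding k unfolding rotation_def by (auto intro!: derivative_eq_intros simp: algebra_simps)
qed

lemma continuous_on_rotation:
  "continuous_on UNIV (\<lambda>z. rotation \<phi> \<psi> (fst z) (snd z))"
  unfolding rotation_def aff_def by (intro continuous_intros)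

locale C1_function =
  fixes u :: "real ^ 'N \<Rightarrow> real ^ 'n" and D :: "real ^ 'N \<Rightarrow> real ^ 'N ^ 'n"
  assumes deriv: "(u has_derivative (\<lambda>h. D x *v h)) (at x)"
    and cont: "continuous_on UNIV D"
begin

definition related :: "(real ^ 'N) set \<Rightarrow> (real ^ 'N) \<times> real \<Rightarrow> (real ^ 'N) \<times> real \<Rightarrow> bool" where
  "related U \<phi> \<psi> \<longleftrightarrow> (\<forall>x\<in>U. D x *v kfield \<phi> \<psi> x = 0)"

lemma D_scaleR: "D x *v (c *\<^sub>R v) = c *\<^sub>R (D x *v v)"
  and D_add: "D x *v (v + w) = D x *v v + D x *v w"
  and D_diff: "D x *v (v - w) = D x *v v - D x *v w"
  by (simp_all add: matrix_vector_mult_scaleR matrix_vector_right_distrib matrix_vector_mult_diff_distrib)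

lemma D_kfield: "D x *v kfield \<phi> \<psi> x = aff \<phi> x *\<^sub>R (D x *v fst \<psi>) - aff \<psi> x *\<^sub>R (D x *v fst \<phi>)"
  by (simp add: kfield_def D_diff D_scaleR)

lemma continuous_on_D_kfield: "continuous_on S (\<lambda>x. D x *v kfield \<phi> \<psi> x)"
  unfolding matrix_vector_mult_def
  by (intro continuous_intros continuous_on_subset[OF cont]) auto

lemma related_refl: "related U \<phi> \<phi>"
  by (simp add: related_def kfield_def)

lemma related_sym: "related U \<phi> \<psi> \<Longrightarrow> related U \<psi> \<phi>"
  by (simp add: related_def D_kfield)

lemma related_mono: "related U \<phi> \<psi> \<Longrightarrow> U' \<subseteq> U \<Longrightarrow> related U' \<phi> \<psi>"
  by (auto simp: related_def)

lemma subspace_related: "subspace {\<psi>. related U \<phi> \<psi>}"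
  by (auto simp: subspace_def related_def D_kfield scaleR_add_left D_add scaleR_add_right algebra_simps D_scaleR)
    (metis (no_types, lifting) diff_self mult.commute scaleR_left_commute scaleR_right_diff_distrib scaleR_scaleR right_minus_eq)+

text \<open>Where \<open>\<psi>\<close> does not vanish, both relations give the derivative along a
  gradient as a multiple of that along \<open>fst \<psi>\<close>, with quotients of functionals as
  factors. The zero set of \<open>\<psi>\<close> has a dense complement in the open set, and
  continuity does the rest.\<close>

lemma related_trans:
  assumes "open U" "\<psi> \<noteq> 0" "related U \<phi> \<psi>" "related U \<psi> \<xi>"
  shows "related U \<phi> \<xi>"
  unfolding related_def
proof
  fix x assume "x \<in> U"
  show "D x *v kfield \<phi> \<xi> x = 0"
  proof (rule aff_nonzero_dense[OF assms(2,1) continuous_on_D_kfield \<open>x \<in> U\<close>])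
    fix x assume x: "x \<in> U" "aff \<psi> x \<noteq> 0"
    have 1: "aff \<phi> x *\<^sub>R (D x *v fst \<psi>) = aff \<psi> x *\<^sub>R (D x *v fst \<phi>)"
      "aff \<psi> x *\<^sub>R (D x *v fst \<xi>) = aff \<xi> x *\<^sub>R (D x *v fst \<psi>)"
      using assms(3,4) x(1) by (auto simp: related_def D_kfield)
    have "aff \<psi> x *\<^sub>R (D x *v kfield \<phi> \<xi> x)
        = aff \<phi> x *\<^sub>R (aff \<psi> x *\<^sub>R (D x *v fst \<xi>)) - aff \<xi> x *\<^sub>R (aff \<psi> x *\<^sub>R (D x *v fst \<phi>))"
      by (simp add: D_kfield algebra_simps)
    also have "\<dots> = aff \<phi> x *\<^sub>R (aff \<xi> x *\<^sub>R (D x *v fst \<psi>)) - aff \<xi> x *\<^sub>R (aff \<phi> x *\<^sub>R (D x *v fst \<psi>))"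
      by (simp only: 1)
    also have "\<dots> = 0" by (simp add: mult.commute)
    finally show "D x *v kfield \<phi> \<xi> x = 0" using x(2) by simp
  qed
qed

lemma constant_along_rotation:
  assumes o: "orthonormal_pair \<phi> \<psi>" and r: "related U \<phi> \<psi>"
    and S: "convex S" "s \<in> S" "t \<in> S" "\<And>\<tau>. \<tau> \<in> S \<Longrightarrow> rotation \<phi> \<psi> \<tau> x \<in> U"
  shows "u (rotation \<phi> \<psi> s x) = u (rotation \<phi> \<psi> t x)"
proof -
  have "((\<lambda>\<tau>. u (rotation \<phi> \<psi> \<tau> x)) has_derivative (\<lambda>h. 0)) (at \<tau> within S)" if "\<tau> \<in> S" for \<tau>
  proof -
    have "D (rotation \<phi> \<psi> \<tau> x) *v kfield \<phi> \<psi> (rotation \<phi> \<psi> \<tau> x) = 0"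
      using r S(4)[OF that] by (simp add: related_def)
    then show ?thesis
      using has_derivative_compose[OF has_derivative_rotation[OF o, where x = x and t = \<tau> and S = S] deriv] by (simp add: D_scaleR)
  qed
  then have "\<exists>c. \<forall>\<tau>\<in>S. u (rotation \<phi> \<psi> \<tau> x) = c"
    by (rule has_derivative_zero_constant[OF S(1)])
  then show ?thesis using S by metis
qed

text \<open>The mirror image of \<open>x\<close> lies on the orbit of \<open>x\<close> under the
  rotations, and \<open>u\<close> is constant on this orbit.\<close>

lemma reflection_invariant_orthonormal:
  assumes o: "orthonormal_pair \<phi> \<psi>" and r: "related UNIV \<phi> \<psi>"
  shows "u (reflection (fst \<phi>) (snd \<phi>) x) = u x"
proof -
  have refl: "reflection (fst \<phi>) (snd \<phi>) x = x - (2 * aff \<phi> x) *\<^sub>R fst \<phi>"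
    using o by (simp add: orthonormal_pair_def reflection_def aff_def)
  define p q where "p = aff \<phi> x" "q = aff \<psi> x"
  show ?thesis
  proof (cases "p = 0")
    case False
    \<comment> \<open>In complex terms the angle solves (p + i q) exp (i t) = - p + i q, so exp (i
      t) = (q^2 - p^2 + 2 i p q) / r.\<close>
    define r where "r = p\<^sup>2 + q\<^sup>2"
    have "r > 0" using False by (simp add: r_def sum_power2_gt_zero_iff)
    have "((q\<^sup>2 - p\<^sup>2) / r)\<^sup>2 + (2 * p * q / r)\<^sup>2 = ((q\<^sup>2 - p\<^sup>2)\<^sup>2 + (2 * p * q)\<^sup>2) / r\<^sup>2"
      by (simp add: power_divide add_divide_distrib)
    also have "(q\<^sup>2 - p\<^sup>2)\<^sup>2 + (2 * p * q)\<^sup>2 = r\<^sup>2"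
      by (simp add: r_def power2_eq_square algebra_simps)
    finally have "((q\<^sup>2 - p\<^sup>2) / r)\<^sup>2 + (2 * p * q / r)\<^sup>2 = 1"
      using \<open>r > 0\<close> by simp
    then obtain t where t: "(q\<^sup>2 - p\<^sup>2) / r = cos t" "2 * p * q / r = sin t"
      using sincos_total_2pi by blast
    have "r * (cos t * p - sin t * q) = (q\<^sup>2 - p\<^sup>2) * p - 2 * p * q * q"
      using \<open>r > 0\<close> by (simp add: t[symmetric] right_diff_distrib)
    also have "\<dots> = r * (- p)" by (simp add: r_def power2_eq_square algebra_simps)
    finally have 1: "cos t * p - sin t * q = - p" using \<open>r > 0\<close> by (metis less_irrefl mult_cancel_left)
    have "r * (sin t * p + cos t * q) = 2 * p * q * p + (q\<^sup>2 - p\<^sup>2) * q"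
      using \<open>r > 0\<close> by (simp add: t[symmetric] distrib_left)
    also have "\<dots> = r * q" by (simp add: r_def power2_eq_square algebra_simps)
    finally have 2: "sin t * p + cos t * q = q" using \<open>r > 0\<close> by (metis less_irrefl mult_cancel_left)
    have "rotation \<phi> \<psi> t x = reflection (fst \<phi>) (snd \<phi>) x"
      unfolding rotation_def refl p_q_def[symmetric] 1 2 mult_2 by (simp add: algebra_simps)
    then show ?thesis
      using constant_along_rotation[OF o \<open>related UNIV \<phi> \<psi>\<close> convex_UNIV, of t 0 x] by simp
  qed (simp add: refl p_q_def)
qed

lemma related_scaleR: "related U \<phi> \<psi> \<Longrightarrow> related U (c *\<^sub>R \<phi>) (d *\<^sub>R \<psi>)"
proof -
  assume "related U \<phi> \<psi>"
  then have "related U \<phi> (d *\<^sub>R \<psi>)"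
    using subspace_scale[OF subspace_related] by blast
  from related_sym[OF this] have "related U (d *\<^sub>R \<psi>) (c *\<^sub>R \<phi>)"
    using subspace_scale[OF subspace_related] by blast
  then show ?thesis by (rule related_sym)
qed

lemma orthonormal_pair_scaled:
  assumes "fst \<phi> \<noteq> 0" "fst \<psi> \<noteq> 0" "fst \<phi> \<bullet> fst \<psi> = 0"
  shows "orthonormal_pair (\<phi> /\<^sub>R norm (fst \<phi>)) (\<psi> /\<^sub>R norm (fst \<psi>))"
  using assms by (simp add: orthonormal_pair_def dot_square_norm power2_eq_square)

lemma reflection_scaled: "c \<noteq> 0 \<Longrightarrow> reflection (c *\<^sub>R a) (c * b) x = reflection a b x"
proof -
  assume "c \<noteq> 0"
  then have "2 * ((c *\<^sub>R a) \<bullet> x - c * b) / ((c *\<^sub>R a) \<bullet> (c *\<^sub>R a)) * c = 2 * (a \<bullet> x - b) / (a \<bullet> a)"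
    by (cases "a = 0") (simp_all add: divide_simps, simp add: algebra_simps)
  then show ?thesis unfolding reflection_def scaleR_scaleR by (rule arg_cong)
qed

lemma reflection_invariant:
  assumes "fst \<phi> \<noteq> 0" "fst \<psi> \<noteq> 0" "fst \<phi> \<bullet> fst \<psi> = 0" "related UNIV \<phi> \<psi>"
  shows "u (reflection (fst \<phi>) (snd \<phi>) x) = u x"
  using reflection_invariant_orthonormal[OF orthonormal_pair_scaled[OF assms(1-3)] related_scaleR[OF assms(4)], of x]
    assms(1) by (simp add: reflection_scaled)

text \<open>
  The argument of \<open>D x\<close> is the bracket of the two fields.  As \<open>u\<close> is only \<open>C\<^sup>1\<close>, it is obtained
  by differentiating the pull-back of the second field along the flow of the first one.
\<close>

lemma bracket_annihilates:
  assumes o: "orthonormal_pair \<phi> \<psi>" and U: "open U" and x: "x \<in> U"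
    and r: "related U \<phi> \<psi>" "related U \<phi>' \<psi>'"
  shows "D x *v ((fst \<phi>' \<bullet> kfield \<phi> \<psi> x) *\<^sub>R fst \<psi>' - (fst \<psi>' \<bullet> kfield \<phi> \<psi> x) *\<^sub>R fst \<phi>'
      + (fst \<psi> \<bullet> kfield \<phi>' \<psi>' x) *\<^sub>R fst \<phi> - (fst \<phi> \<bullet> kfield \<phi>' \<psi>' x) *\<^sub>R fst \<psi>) = 0"
proof -
  define a b where "a = fst \<phi>" "b = fst \<psi>"
  have ab: "a \<bullet> a = 1" "b \<bullet> b = 1" "a \<bullet> b = 0" "b \<bullet> a = 0"
    using o by (auto simp: a_b_def orthonormal_pair_def inner_commute)
  \<comment> \<open>\<open>L t\<close> is the linear part of
    \<open>rotation \<phi> \<psi> t\<close>, with inverse \<open>L (- t)\<close>.\<close>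
  define L where "L t h = h + (cos t * (a \<bullet> h) - sin t * (b \<bullet> h) - a \<bullet> h) *\<^sub>R a
      + (sin t * (a \<bullet> h) + cos t * (b \<bullet> h) - b \<bullet> h) *\<^sub>R b" for t h
  have L_inv: "L t (L (- t) h) = h" for t h
  proof -
    have a': "a \<bullet> L (- t) h = cos t * (a \<bullet> h) + sin t * (b \<bullet> h)"
      and b': "b \<bullet> L (- t) h = - sin t * (a \<bullet> h) + cos t * (b \<bullet> h)"
      by (simp_all add: L_def inner_add_right ab)
    have s: "cos t * (cos t * v) + sin t * (sin t * v) = v" for v
      using sin_cos_squared_add[of t] by (metis add.commute distrib_right mult.assoc mult_1 power2_eq_square)
    have "cos t * (a \<bullet> L (- t) h) - sin t * (b \<bullet> L (- t) h) = a \<bullet> h"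
      "sin t * (a \<bullet> L (- t) h) + cos t * (b \<bullet> L (- t) h) = b \<bullet> h"
      unfolding a' b' using s[of "a \<bullet> h"] s[of "b \<bullet> h"] by (simp_all add: algebra_simps)
    then have "L t (L (- t) h) = L (- t) h + (a \<bullet> h - a \<bullet> L (- t) h) *\<^sub>R a + (b \<bullet> h - b \<bullet> L (- t) h) *\<^sub>R b"
      by (simp add: L_def[of t])
    also have "\<dots> = h" unfolding a' b' by (simp add: L_def algebra_simps)
    finally show ?thesis .
  qed
  have dR: "(rotation \<phi> \<psi> t has_derivative L t) (at y)" for t y
    unfolding rotation_def[abs_def] aff_def L_def[abs_def] a_b_def
    by (auto intro!: derivative_eq_intros)
  let ?R = "\<lambda>z. rotation \<phi> \<psi> (fst z) (snd z)"
  have "open (?R -` U)"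
    by (rule open_vimage[OF U continuous_on_rotation])
  moreover have "(0, x) \<in> ?R -` U" using x by simp
  ultimately obtain A B where AB: "open A" "open B" "0 \<in> A" "x \<in> B" "A \<times> B \<subseteq> ?R -` U"
    by (rule open_prod_elim) (use that in \<open>simp only: mem_Sigma_iff\<close>)
  obtain \<delta> where \<delta>: "\<delta> > 0" "ball 0 \<delta> \<subseteq> A" using AB(1,3) open_contains_ball by blast
  \<comment> \<open>Near \<open>x\<close> the function is invariant under small rotations, so
    \<open>D x\<close> is the derivative at the rotated point composed with \<open>L t\<close>. The
    second field is annihilated there, hence its pull-back is annihilated at
    \<open>x\<close>.\<close>
  have zero: "D x *v L (- t) (kfield \<phi>' \<psi>' (rotation \<phi> \<psi> t x)) = 0" if t: "t \<in> ball 0 \<delta>" for t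
  proof -
    have in_U: "rotation \<phi> \<psi> s y \<in> U" if "s \<in> ball 0 \<delta>" "y \<in> B" for s y
    proof -
      have "s \<in> A" using that(1) \<delta>(2) by blast
      then have "(s, y) \<in> ?R -` U" using that(2) AB(5) by blast
      then show ?thesis by simp
    qed
    have "u y = u (rotation \<phi> \<psi> t y)" if "y \<in> B" for y
      using constant_along_rotation[OF o r(1) convex_ball, of 0 0 \<delta> t y] in_U that t \<delta>(1) by simp
    moreover have "((\<lambda>y. u (rotation \<phi> \<psi> t y)) has_derivative (\<lambda>h. D (rotation \<phi> \<psi> t x) *v L t h)) (at x)"
      by (rule has_derivative_compose[OF dR deriv])
    ultimately have "(u has_derivative (\<lambda>h. D (rotation \<phi> \<psi> t x) *v L t h)) (at x)"
      using has_derivative_transform_within_open[OF _ AB(2,4)] by metis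
    then have "D x *v h = D (rotation \<phi> \<psi> t x) *v L t h" for h
      using has_derivative_unique[OF deriv] by metis
    then have "D x *v L (- t) (kfield \<phi>' \<psi>' (rotation \<phi> \<psi> t x))
        = D (rotation \<phi> \<psi> t x) *v kfield \<phi>' \<psi>' (rotation \<phi> \<psi> t x)"
      by (simp add: L_inv)
    also have "\<dots> = 0"
      using r(2) in_U[OF t AB(4)] by (simp add: related_def)
    finally show ?thesis .
  qed
  define K where "K t = kfield \<phi>' \<psi>' (rotation \<phi> \<psi> t x)" for t
  define K' where "K' = (fst \<phi>' \<bullet> kfield \<phi> \<psi> x) *\<^sub>R fst \<psi>' - (fst \<psi>' \<bullet> kfield \<phi> \<psi> x) *\<^sub>R fst \<phi>'"
  have dK: "(K has_derivative (\<lambda>h. h *\<^sub>R K')) (at 0)"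
    unfolding K_def kfield_def[of \<phi>' \<psi>'] aff_def
    by (auto intro!: derivative_eq_intros has_derivative_rotation[OF o] simp: K'_def algebra_simps)
  have "((\<lambda>t. L (- t) (K t)) has_derivative
      (\<lambda>h. h *\<^sub>R (K' + (b \<bullet> K 0) *\<^sub>R a - (a \<bullet> K 0) *\<^sub>R b))) (at 0)"
    unfolding L_def by (auto intro!: derivative_eq_intros dK simp: algebra_simps)
  then have "((\<lambda>t. D x *v L (- t) (K t)) has_derivative
      (\<lambda>h. D x *v (h *\<^sub>R (K' + (b \<bullet> K 0) *\<^sub>R a - (a \<bullet> K 0) *\<^sub>R b)))) (at 0)"
    by (rule bounded_linear.has_derivative[OF matrix_vector_mul_bounded_linear])
  moreover have "((\<lambda>t. D x *v L (- t) (K t)) has_derivative (\<lambda>h. 0)) (at 0)"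
    by (rule has_derivative_transform_within_open[of "\<lambda>t. 0" _ _ UNIV "ball 0 \<delta>"])
      (use zero \<delta>(1) in \<open>auto simp: K_def\<close>)
  ultimately have "(\<lambda>h. D x *v (h *\<^sub>R (K' + (b \<bullet> K 0) *\<^sub>R a - (a \<bullet> K 0) *\<^sub>R b))) = (\<lambda>h. 0)"
    by (rule has_derivative_unique)
  from fun_cong[OF this, of 1] have "D x *v (1 *\<^sub>R (K' + (b \<bullet> K 0) *\<^sub>R a - (a \<bullet> K 0) *\<^sub>R b)) = 0" .
  then show ?thesis by (simp add: K'_def K_def a_b_def)
qed

text \<open>After multiplication of the bracket identity by
  \<open>aff \<phi> x * aff \<phi>' x\<close>, the two relations eliminate the derivatives along
  \<open>fst \<psi>\<close> and \<open>fst \<psi>'\<close>. The rest factors into the inner product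
  of the fields and \<open>D x *v kfield \<phi> \<phi>' x\<close>.\<close>

lemma inner_kfields_annihilate:
  assumes "orthonormal_pair \<phi> \<psi>" "open U" "x \<in> U" "related U \<phi> \<psi>" "related U \<phi>' \<psi>'"
  shows "kfield \<phi> \<psi> x \<bullet> kfield \<phi>' \<psi>' x = 0 \<or> D x *v kfield \<phi> \<phi>' x = 0"
proof -
  let ?K = "kfield \<phi> \<psi> x" and ?K' = "kfield \<phi>' \<psi>' x"
  define p q p' q' where "p = aff \<phi> x" "q = aff \<psi> x" "p' = aff \<phi>' x" "q' = aff \<psi>' x"
  define d e d' e' where "d = D x *v fst \<phi>" "e = D x *v fst \<psi>" "d' = D x *v fst \<phi>'" "e' = D x *v fst \<psi>'"
  note defs = p_q_p'_q'_def d_e_d'_e'_def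
  have r: "p *\<^sub>R e = q *\<^sub>R d" "p' *\<^sub>R e' = q' *\<^sub>R d'"
    using assms(3-5) by (auto simp: related_def D_kfield defs)
  have b: "(fst \<phi>' \<bullet> ?K) *\<^sub>R e' - (fst \<psi>' \<bullet> ?K) *\<^sub>R d' + (fst \<psi> \<bullet> ?K') *\<^sub>R d - (fst \<phi> \<bullet> ?K') *\<^sub>R e = 0"
    using bracket_annihilates[OF assms] by (simp only: D_add D_diff D_scaleR defs)
  have "0 = (p * p') *\<^sub>R ((fst \<phi>' \<bullet> ?K) *\<^sub>R e' - (fst \<psi>' \<bullet> ?K) *\<^sub>R d' + (fst \<psi> \<bullet> ?K') *\<^sub>R d - (fst \<phi> \<bullet> ?K') *\<^sub>R e)"
    by (simp add: b)
  also have "\<dots> = (p * (fst \<phi>' \<bullet> ?K)) *\<^sub>R (p' *\<^sub>R e') - (p * p' * (fst \<psi>' \<bullet> ?K)) *\<^sub>R d'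
      + (p * p' * (fst \<psi> \<bullet> ?K')) *\<^sub>R d - (p' * (fst \<phi> \<bullet> ?K')) *\<^sub>R (p *\<^sub>R e)"
    by (simp add: algebra_simps)
  also have "\<dots> = (p * (q' * (fst \<phi>' \<bullet> ?K) - p' * (fst \<psi>' \<bullet> ?K))) *\<^sub>R d'
      + (p' * (p * (fst \<psi> \<bullet> ?K') - q * (fst \<phi> \<bullet> ?K'))) *\<^sub>R d"
    unfolding r by (simp add: algebra_simps)
  also have "q' * (fst \<phi>' \<bullet> ?K) - p' * (fst \<psi>' \<bullet> ?K) = - (?K \<bullet> ?K')"
    by (simp add: kfield_def[of \<phi>'] defs inner_diff_right inner_commute)
  also have "p * (fst \<psi> \<bullet> ?K') - q * (fst \<phi> \<bullet> ?K') = ?K \<bullet> ?K'"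
    by (simp add: kfield_def[of \<phi> \<psi>] defs inner_diff_left)
  finally have "(?K \<bullet> ?K') *\<^sub>R (p *\<^sub>R d' - p' *\<^sub>R d) = 0"
    by (simp add: algebra_simps)
  then show ?thesis by (auto simp: D_kfield defs)
qed

end

section \<open>Orthogonality of unrelated functionals\<close>

lemma kfield_line:
  "kfield \<phi> \<psi> (x + t *\<^sub>R y) = kfield \<phi> \<psi> x + t *\<^sub>R ((fst \<phi> \<bullet> y) *\<^sub>R fst \<psi> - (fst \<psi> \<bullet> y) *\<^sub>R fst \<phi>)"
  by (simp add: kfield_def aff_shift algebra_simps)

text \<open>On the line from \<open>x\<close> to \<open>z\<close> the inner product is a polynomial
  of degree at most 2; its zeros at 0, \<open>s\<close> and \<open>- s\<close> make it the zero
  polynomial.\<close>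

lemma inner_kfields_eq_0:
  assumes V: "open V" "x \<in> V" "\<And>x. x \<in> V \<Longrightarrow> kfield \<phi> \<psi> x \<bullet> kfield \<phi>' \<psi>' x = 0"
  shows "kfield \<phi> \<psi> z \<bullet> kfield \<phi>' \<psi>' z = 0"
proof -
  define y where "y = z - x"
  define p p' where "p = (fst \<phi> \<bullet> y) *\<^sub>R fst \<psi> - (fst \<psi> \<bullet> y) *\<^sub>R fst \<phi>"
    and "p' = (fst \<phi>' \<bullet> y) *\<^sub>R fst \<psi>' - (fst \<psi>' \<bullet> y) *\<^sub>R fst \<phi>'"
  define A B C where "A = kfield \<phi> \<psi> x \<bullet> kfield \<phi>' \<psi>' x"
    and "B = kfield \<phi> \<psi> x \<bullet> p' + p \<bullet> kfield \<phi>' \<psi>' x" and "C = p \<bullet> p'"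
  have q: "kfield \<phi> \<psi> (x + t *\<^sub>R y) \<bullet> kfield \<phi>' \<psi>' (x + t *\<^sub>R y) = A + t * B + t * t * C" for t
    unfolding kfield_line p_def[symmetric] p'_def[symmetric]
    by (simp add: A_def B_def C_def inner_add_left inner_add_right algebra_simps)
  obtain \<epsilon> where \<epsilon>: "\<epsilon> > 0" "ball x \<epsilon> \<subseteq> V" using V(1,2) open_contains_ball by blast
  define s where "s = \<epsilon> / (norm y + 1)"
  have "norm y + 1 > 0" using norm_ge_zero by (rule add_nonneg_pos) simp
  then have s: "s > 0" using \<epsilon> by (simp add: s_def)
  have "s * (norm y + 1) = \<epsilon>" using \<open>norm y + 1 > 0\<close> by (simp add: s_def)
  then have "s * norm y < \<epsilon>" using s by (simp add: distrib_left)
  then have "x + s *\<^sub>R y \<in> V" "x + (- s) *\<^sub>R y \<in> V"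
    using \<epsilon>(2) s by (auto simp: subset_iff dist_norm)
  then have "A = 0" "A + s * B + s * s * C = 0" "A + (- s) * B + (- s) * (- s) * C = 0"
    using V(3) V(2) q A_def by metis+
  then have "s * B + s * s * C = 0" "- (s * B) + s * s * C = 0" by simp_all
  then have "s * s * C = 0" "s * B = 0" by linarith+
  then have "B = 0" "C = 0" using s by simp_all
  then show ?thesis using q[of 1] \<open>A = 0\<close> by (simp add: y_def)
qed

context C1_function
begin

text \<open>Where the field of \<open>\<phi>\<close> and \<open>\<phi>'\<close> does not annihilate
  \<open>u\<close>, the two given fields are orthogonal, and then they are so everywhere. On the
  hyperplane \<open>\<phi>' = 0\<close> the second field is parallel to \<open>fst \<phi>'\<close>,
  which forces the first one to be tangent to this hyperplane.\<close>

lemma unrelated_orthogonal: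
  assumes o: "orthonormal_pair \<phi> \<psi>" and U: "open U"
    and r: "related U \<phi> \<psi>" "related U \<phi>' \<psi>'"
    and \<phi>': "fst \<phi>' \<noteq> 0" "fst \<psi>' \<noteq> 0" "fst \<phi>' \<bullet> fst \<psi>' = 0"
    and not: "\<not> related U \<phi> \<phi>'"
  shows "fst \<phi>' \<bullet> fst \<phi> = 0 \<and> fst \<phi>' \<bullet> fst \<psi> = 0"
proof -
  define V where "V = U \<inter> {x. D x *v kfield \<phi> \<phi>' x \<noteq> 0}"
  have "open V"
    unfolding V_def by (intro open_Int U open_Collect_neq continuous_on_D_kfield continuous_on_const)
  obtain x where "x \<in> V" using not by (auto simp: V_def related_def)
  have q: "kfield \<phi> \<psi> z \<bullet> kfield \<phi>' \<psi>' z = 0" for z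
    by (rule inner_kfields_eq_0[OF \<open>open V\<close> \<open>x \<in> V\<close>])
      (use inner_kfields_annihilate[OF o U _ r] in \<open>auto simp: V_def\<close>)
  \<comment> \<open>\<open>aff \<xi>\<close> is the inner product of \<open>fst \<phi>'\<close> with
    \<open>kfield \<phi> \<psi>\<close>. As \<open>\<xi>\<close> belongs to the class of
    \<open>\<phi>\<close>, it cannot be a nonzero multiple of \<open>\<phi>'\<close>.\<close>
  define \<xi> where "\<xi> = (fst \<phi>' \<bullet> fst \<psi>) *\<^sub>R \<phi> - (fst \<phi>' \<bullet> fst \<phi>) *\<^sub>R \<psi>"
  have prod: "aff \<psi>' z * aff \<xi> z = 0" if "aff \<phi>' z = 0" for z
    using q[of z] that
    by (auto simp: kfield_def \<xi>_def inner_diff_left inner_diff_right inner_commute algebra_simps)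
  have "aff \<xi> z = 0" if z: "aff \<phi>' z = 0" for z
  proof (cases "aff \<psi>' z = 0")
    case True
    \<comment> \<open>Moving along \<open>fst \<psi>'\<close> stays in the hyperplane but leaves the
      zero set of \<open>\<psi>'\<close>; an affine function with two zeros on a line vanishes on
      it.\<close>
    have "aff \<xi> (z + t *\<^sub>R fst \<psi>') = 0" if "t \<noteq> 0" for t
      using prod[of "z + t *\<^sub>R fst \<psi>'"] z True \<phi>' that by (simp add: aff_shift)
    from this[of 1] this[of 2] show ?thesis by (simp add: aff_shift)
  qed (use prod[OF z] in auto)
  then obtain c where c: "\<xi> = c *\<^sub>R \<phi>'"
    using aff_vanishing_imp_multiple[OF \<phi>'(1)] by blast
  have "c = 0"
  proof (rule ccontr)
    assume "c \<noteq> 0"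
    have "\<xi> \<in> {\<chi>'. related U \<phi> \<chi>'}"
      unfolding \<xi>_def using r(1) related_refl
      by (intro subspace_diff subspace_scale subspace_related) auto
    from subspace_scale[OF subspace_related this, of "1 / c"]
    have "related U \<phi> \<phi>'" using c \<open>c \<noteq> 0\<close> by simp
    with not show False by simp
  qed
  then have "(fst \<phi>' \<bullet> fst \<psi>) *\<^sub>R fst \<phi> = (fst \<phi>' \<bullet> fst \<phi>) *\<^sub>R fst \<psi>"
    using c by (simp add: \<xi>_def prod_eq_iff)
  then have "(fst \<phi>' \<bullet> fst \<psi>) *\<^sub>R fst \<phi> \<bullet> fst \<phi> = (fst \<phi>' \<bullet> fst \<phi>) *\<^sub>R fst \<psi> \<bullet> fst \<phi>"
    "(fst \<phi>' \<bullet> fst \<psi>) *\<^sub>R fst \<phi> \<bullet> fst \<psi> = (fst \<phi>' \<bullet> fst \<phi>) *\<^sub>R fst \<psi> \<bullet> fst \<psi>"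
    by simp_all
  then show ?thesis
    using o by (simp add: orthonormal_pair_def inner_commute)
qed

text \<open>A partner found on one side of a hyperplane that cuts a stable set is thereby a partner
  on the whole set.\<close>

definition stable :: "(real ^ 'N) set \<Rightarrow> bool" where
  "stable U \<longleftrightarrow> open U \<and> U \<noteq> {} \<and>
     (\<forall>V \<phi> \<psi>. open V \<longrightarrow> V \<noteq> {} \<longrightarrow> V \<subseteq> U \<longrightarrow> related V \<phi> \<psi> \<longrightarrow> related U \<phi> \<psi>)"

text \<open>
  All Killing fields are among the affine fields \<open>x \<mapsto> A x + v\<close>, which form a finite-dimensional space;
  hence an open set with annihilators of maximal dimension is stable.
\<close>

definition annihilators :: "(real ^ 'N) set \<Rightarrow> ((real ^ 'N ^ 'N) \<times> (real ^ 'N)) set" where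
  "annihilators U = {(A, v). \<forall>x\<in>U. D x *v (A *v x + v) = 0}"

lemma subspace_annihilators: "subspace (annihilators U)"
  unfolding subspace_def
proof (intro conjI ballI allI)
  show "0 \<in> annihilators U" by (simp add: annihilators_def zero_prod_def)
  fix p assume "p \<in> annihilators U"
  then obtain A v where p: "p = (A, v)" "\<And>x. x \<in> U \<Longrightarrow> D x *v (A *v x + v) = 0"
    by (auto simp: annihilators_def)
  show "c *\<^sub>R p \<in> annihilators U" for c
  proof -
    have "(c *\<^sub>R A) *v x + c *\<^sub>R v = c *\<^sub>R (A *v x + v)" for x
      by (simp add: scaleR_matrix_vector_assoc scaleR_add_right)
    then have "D x *v ((c *\<^sub>R A) *v x + c *\<^sub>R v) = c *\<^sub>R (D x *v (A *v x + v))" for x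
      by (simp only: D_scaleR)
    then show ?thesis using p by (simp add: annihilators_def)
  qed
  fix q assume "q \<in> annihilators U"
  then obtain B w where q: "q = (B, w)" "\<And>x. x \<in> U \<Longrightarrow> D x *v (B *v x + w) = 0"
    by (auto simp: annihilators_def)
  have "(A + B) *v x + (v + w) = (A *v x + v) + (B *v x + w)" for x
    by (simp add: matrix_vector_mult_add_rdistrib)
  then have "D x *v ((A + B) *v x + (v + w)) = D x *v (A *v x + v) + D x *v (B *v x + w)" for x
    by (simp only: D_add)
  then show "p + q \<in> annihilators U" using p q by (simp add: annihilators_def)
qed

text \<open>The witness \<open>p\<close> does not depend on the open set, so open sets with equal
  annihilator spaces have the same relations.\<close>

lemma related_iff_annihilators:
  obtains p where "\<And>U. related U \<phi> \<psi> \<longleftrightarrow> p \<in> annihilators U"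
proof -
  define A :: "real ^ 'N ^ 'N" where "A = (\<chi> i. fst \<psi> $ i *\<^sub>R fst \<phi> - fst \<phi> $ i *\<^sub>R fst \<psi>)"
  define v where "v = snd \<psi> *\<^sub>R fst \<phi> - snd \<phi> *\<^sub>R fst \<psi>"
  have "kfield \<phi> \<psi> x = A *v x + v" for x
    by (simp add: vec_eq_iff A_def v_def kfield_def aff_def matrix_vector_mul_component
        inner_diff_left algebra_simps)
  then show thesis using that[of "(A, v)"] by (simp add: related_def annihilators_def)
qed

lemma exists_stable:
  assumes "open W" "W \<noteq> {}"
  obtains U where "U \<subseteq> W" "stable U"
proof -
  have "\<exists>U. (open U \<and> U \<noteq> {} \<and> U \<subseteq> W) \<and> (\<forall>V. open V \<and> V \<noteq> {} \<and> V \<subseteq> W \<longrightarrow> dim (annihilators V) \<le> dim (annihilators U))"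
    by (rule ex_has_greatest_nat[of _ W _ "Suc (DIM((real ^ 'N ^ 'N) \<times> (real ^ 'N)))"])
      (use assms dim_subset_UNIV[where 'a = "(real ^ 'N ^ 'N) \<times> (real ^ 'N)"] in \<open>auto simp: less_Suc_eq_le\<close>)
  then obtain U where U: "open U" "U \<noteq> {}" "U \<subseteq> W"
    "\<And>V. open V \<Longrightarrow> V \<noteq> {} \<Longrightarrow> V \<subseteq> W \<Longrightarrow> dim (annihilators V) \<le> dim (annihilators U)"
    by blast
  have "related U \<phi> \<psi>" if V: "open V" "V \<noteq> {}" "V \<subseteq> U" "related V \<phi> \<psi>" for V \<phi> \<psi>
  proof -
    obtain p where p: "\<And>U. related U \<phi> \<psi> \<longleftrightarrow> p \<in> annihilators U"
      using related_iff_annihilators[of \<phi> \<psi>] by metis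
    have "annihilators U \<subseteq> annihilators V" using V(3) by (auto simp: annihilators_def)
    moreover have "dim (annihilators V) \<le> dim (annihilators U)" using U(4)[OF V(1,2)] V(3) U(3) by blast
    ultimately have "annihilators U = annihilators V"
      using subspace_dim_equal[OF subspace_annihilators subspace_annihilators] by blast
    then show ?thesis using V(4) p by simp
  qed
  then have "stable U" using U by (auto simp: stable_def)
  with U(3) that show thesis by blast
qed

text \<open>The points where the field fails to annihilate \<open>u\<close> form an open set; if
  nonempty, it would contain a stable set.\<close>

lemma related_UNIV_if_stable:
  assumes "\<And>U. stable U \<Longrightarrow> related U \<phi> \<psi>"
  shows "related UNIV \<phi> \<psi>"
proof (rule ccontr)
  define W where "W = {x. D x *v kfield \<phi> \<psi> x \<noteq> 0}"
  assume "\<not> related UNIV \<phi> \<psi>"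
  then have "W \<noteq> {}" by (auto simp: related_def W_def)
  moreover have "open W"
    unfolding W_def by (intro open_Collect_neq continuous_on_D_kfield continuous_on_const)
  ultimately obtain U where U: "U \<subseteq> W" "stable U" by (metis exists_stable)
  obtain x where "x \<in> U" using U(2) by (auto simp: stable_def)
  then show False using assms[OF U(2)] U(1) by (auto simp: related_def W_def)
qed

lemma related_constant:
  assumes "related U \<phi> \<psi>" "fst \<psi> = 0" "\<psi> \<noteq> 0" "x \<in> U"
  shows "D x *v fst \<phi> = 0"
proof -
  have "snd \<psi> \<noteq> 0" using assms(2,3) by (cases \<psi>) (auto simp: zero_prod_def)
  moreover have "snd \<psi> *\<^sub>R (D x *v fst \<phi>) = 0"
    using assms(1,2,4) by (auto simp: related_def D_kfield aff_def)
  ultimately show ?thesis by simp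
qed

lemma related_orthogonal_part:
  assumes "related U \<phi> \<psi>" "fst \<phi> \<noteq> 0"
  obtains c where "related U \<phi> (\<psi> - c *\<^sub>R \<phi>)" "fst \<phi> \<bullet> fst (\<psi> - c *\<^sub>R \<phi>) = 0"
proof (rule that)
  define c where "c = (fst \<phi> \<bullet> fst \<psi>) / (fst \<phi> \<bullet> fst \<phi>)"
  have "\<psi> \<in> {\<psi>. related U \<phi> \<psi>}" "c *\<^sub>R \<phi> \<in> {\<psi>. related U \<phi> \<psi>}"
    using assms(1) subspace_scale[OF subspace_related, of \<phi> U \<phi> c] related_refl by auto
  then show "related U \<phi> (\<psi> - c *\<^sub>R \<phi>)"
    using subspace_diff[OF subspace_related] by blast
  show "fst \<phi> \<bullet> fst (\<psi> - c *\<^sub>R \<phi>) = 0"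
    using assms(2) by (simp add: c_def inner_diff_right)
qed

end

text \<open>As the subspaces meet only in 0, their orthogonal complements together span the whole
  space, so \<open>b - a\<close> splits into one correction for each. This merges a hyperplane
  chosen for \<open>A\<close> with one chosen for \<open>B\<close>.\<close>

lemma exists_common_functional:
  fixes A B :: "'a::euclidean_space set"
  assumes AB: "subspace A" "subspace B" "A \<inter> B = {0}"
  obtains w where "\<And>x. x \<in> A \<Longrightarrow> x \<bullet> w = x \<bullet> a" "\<And>x. x \<in> B \<Longrightarrow> x \<bullet> w = x \<bullet> b"
proof -
  let ?A = "{y. \<forall>x\<in>A. x \<bullet> y = 0}" and ?B = "{y. \<forall>x\<in>B. x \<bullet> y = 0}"
  have sub: "subspace ?A" "subspace ?B"
    by (auto simp: subspace_def inner_add_right)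
  have dim_perp: "dim {y. \<forall>x\<in>S. x \<bullet> y = 0} = DIM('a) - dim S" if "subspace S" for S :: "'a set"
    using dim_subspace_orthogonal_to_vectors[OF that subspace_UNIV] by (simp add: orthogonal_def)
  have AB': "?A \<inter> ?B = {y. \<forall>x\<in>{x + y |x y. x \<in> A \<and> y \<in> B}. x \<bullet> y = 0}"
  proof -
    have A_sub: "A \<subseteq> {x + y |x y. x \<in> A \<and> y \<in> B}"
      using subspace_0[OF AB(2)] by (metis (mono_tags, lifting) add.right_neutral mem_Collect_eq subsetI)
    have B_sub: "B \<subseteq> {x + y |x y. x \<in> A \<and> y \<in> B}"
      using subspace_0[OF AB(1)] by (metis (mono_tags, lifting) add.left_neutral mem_Collect_eq subsetI)
    show ?thesis
    proof (rule subset_antisym)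
      show "?A \<inter> ?B \<subseteq> {y. \<forall>x\<in>{x + y |x y. x \<in> A \<and> y \<in> B}. x \<bullet> y = 0}"
        by (auto simp: inner_add_left)
    qed (use A_sub B_sub in blast)
  qed
  have le: "dim A \<le> DIM('a)" "dim B \<le> DIM('a)" by (simp_all add: dim_subset_UNIV)
  have sum: "dim {x + y |x y. x \<in> A \<and> y \<in> B} = dim A + dim B"
    using dim_sums_Int[OF AB(1,2)] AB(3) by simp
  moreover have "dim {x + y |x y. x \<in> A \<and> y \<in> B} \<le> DIM('a)" by (simp add: dim_subset_UNIV)
  moreover have "dim (?A \<inter> ?B) = DIM('a) - (dim A + dim B)"
    unfolding AB' using dim_perp[OF subspace_sums[OF AB(1,2)]] sum by simp
  moreover have "dim {x + y |x y. x \<in> ?A \<and> y \<in> ?B} + dim (?A \<inter> ?B) = dim ?A + dim ?B"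
    by (rule dim_sums_Int[OF sub])
  ultimately have "dim {x + y |x y. x \<in> ?A \<and> y \<in> ?B} = DIM('a)"
    using dim_perp[OF AB(1)] dim_perp[OF AB(2)] le by linarith
  then have "{x + y |x y. x \<in> ?A \<and> y \<in> ?B} = UNIV"
    using dim_eq_full[of "{x + y |x y. x \<in> ?A \<and> y \<in> ?B}"] span_eq_iff[THEN iffD2, OF subspace_sums[OF sub]] by simp
  then obtain x y where xy: "x \<in> ?A" "y \<in> ?B" "b - a = x + y" by blast
  then have w: "a + x = b - y" by (simp add: algebra_simps)
  show thesis
  proof (rule that[of "a + x"])
    show "z \<bullet> (a + x) = z \<bullet> a" if "z \<in> A" for z using xy(1) that by (simp add: inner_add_right)
    show "z \<bullet> (a + x) = z \<bullet> b" if "z \<in> B" for z using xy(2) that by (simp add: w inner_diff_right)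
  qed
qed

section \<open>Symmetry of minimizers\<close>

lemma reflect_pos_reflection:
  assumes "a \<noteq> 0" shows "reflect_pos a b f (reflection a b x) = reflect_pos a b f x"
proof -
  have "a \<bullet> reflection a b x - b = - (a \<bullet> x - b)" by (rule inner_reflection[OF assms])
  then have "a \<bullet> reflection a b x \<ge> b \<longleftrightarrow> a \<bullet> x \<le> b" by linarith
  then show ?thesis
    using reflection_reflection[OF assms, of b x]
    by (cases "a \<bullet> x" b rule: linorder_cases) (auto simp: reflect_pos_def reflection_fixes)
qed

lemma inner_reflection_orthogonal: "a' \<bullet> a = 0 \<Longrightarrow> a' \<bullet> reflection a b x = a' \<bullet> x"
  by (simp add: reflection_def inner_diff_right)

lemma reflection_commute:
  assumes "a' \<bullet> a = 0"
  shows "reflection a' b' (reflection a b x) = reflection a b (reflection a' b' x)"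
proof -
  have "a \<bullet> a' = 0" using assms by (simp add: inner_commute)
  then show ?thesis
    unfolding reflection_def[of a' b' "reflection a b x"] reflection_def[of a b "reflection a' b' x"]
      inner_reflection_orthogonal[OF assms] inner_reflection_orthogonal[OF \<open>a \<bullet> a' = 0\<close>]
    by (simp add: reflection_def)
qed

lemma reflect_pos_reflection_orthogonal:
  assumes "a' \<bullet> a = 0" "\<And>x. f (reflection a b x) = f x"
  shows "reflect_pos a' b' f (reflection a b x) = reflect_pos a' b' f x"
  using assms by (simp add: reflect_pos_def inner_reflection_orthogonal reflection_commute)

lemma aff_reflection: "fst \<phi> \<noteq> 0 \<Longrightarrow> aff \<phi> (reflection (fst \<phi>) (snd \<phi>) x) = - aff \<phi> x"
  unfolding aff_def by (rule inner_reflection)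

lemma aff_reflection_orthogonal:
  "fst \<phi> \<bullet> fst \<psi> = 0 \<Longrightarrow> aff \<phi> (reflection (fst \<psi>) (snd \<psi>) x) = aff \<phi> x"
  by (simp add: aff_def inner_reflection_orthogonal)

lemma (in C1_function) stable_related:
  "stable U \<Longrightarrow> open V \<Longrightarrow> V \<noteq> {} \<Longrightarrow> V \<subseteq> U \<Longrightarrow> related V \<phi> \<psi> \<Longrightarrow> related U \<phi> \<psi>"
  unfolding stable_def by blast

text \<open>The constants belong to this space, hence the dimension N and not N - 1; this leaves
  room for k = N - 1 constraints.\<close>

lemma dim_fst_orthogonal:
  fixes a :: "real ^ 'N"
  assumes "a \<noteq> 0"
  shows "subspace {\<psi> :: (real ^ 'N) \<times> real. a \<bullet> fst \<psi> = 0}" "dim {\<psi> :: (real ^ 'N) \<times> real. a \<bullet> fst \<psi> = 0} = CARD('N)"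
proof -
  show "subspace {\<psi> :: (real ^ 'N) \<times> real. a \<bullet> fst \<psi> = 0}"
    by (auto simp: subspace_def inner_add_right)
  have "{\<psi> :: (real ^ 'N) \<times> real. a \<bullet> fst \<psi> = 0} = {\<psi>. (a, 0) \<bullet> \<psi> = 0}"
    by (auto simp: inner_prod_def)
  moreover have "(a, 0 :: real) \<noteq> 0" using assms by (simp add: zero_prod_def)
  ultimately show "dim {\<psi> :: (real ^ 'N) \<times> real. a \<bullet> fst \<psi> = 0} = CARD('N)"
    using dim_hyperplane[of "(a, 0 :: real)"] by simp
qed

context minimization_problem
begin

lemma C1_function: "C1_minimizer u D \<Longrightarrow> C1_function u D"
  by unfold_locales (auto simp: C1_minimizer_def)

text \<open>The field of \<open>\<phi>\<close> and a nonzero constant is a translation field, which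
  \<open>not_translation_invariant\<close> rules out.\<close>

lemma C1_minimizer_nonconstant_related:
  assumes u: "C1_minimizer u D" and \<phi>: "fst \<phi> \<noteq> 0" "C1_function.related D UNIV \<phi> \<psi>" and \<psi>: "fst \<psi> = 0"
  shows "\<psi> = 0"
  using C1_function.related_constant[OF C1_function[OF u] \<phi>(2) \<psi>] not_translation_invariant[OF u \<phi>(1)] by blast

text \<open>
  The half-turn about the intersection of the two mirrors exchanges the sides of every hyperplane
  through this intersection, so all these hyperplanes split \<open>u\<close>.
\<close>

lemma related_if_two_reflections:
  assumes u: "C1_minimizer u D" and \<phi>: "fst \<phi> \<noteq> 0" and \<psi>: "fst \<psi> \<noteq> 0" and o: "fst \<phi> \<bullet> fst \<psi> = 0"
    and inv: "\<And>x. u (reflection (fst \<phi>) (snd \<phi>) x) = u x" "\<And>x. u (reflection (fst \<psi>) (snd \<psi>) x) = u x"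
  shows "D x *v kfield \<phi> \<psi> x = 0"
proof (cases "kfield \<phi> \<psi> x = 0")
  case False
  \<comment> \<open>The member of the pencil of \<open>\<phi>\<close> and \<open>\<psi>\<close> that
    vanishes at \<open>x\<close>; its gradient is the Killing field at \<open>x\<close>.\<close>
  define \<xi> where "\<xi> = aff \<phi> x *\<^sub>R \<psi> - aff \<psi> x *\<^sub>R \<phi>"
  have \<xi>: "fst \<xi> = kfield \<phi> \<psi> x" "aff \<xi> x = 0"
    by (simp_all add: \<xi>_def kfield_def)
  have o': "fst \<psi> \<bullet> fst \<phi> = 0" using o by (simp add: inner_commute)
  have "splits u \<xi>"
  proof (rule splits_if_reversed[OF u inv])
    show "fst \<xi> \<noteq> 0" using False \<xi> by simp
    show "aff \<xi> (reflection (fst \<phi>) (snd \<phi>) (reflection (fst \<psi>) (snd \<psi>) y)) = - aff \<xi> y" for y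
      by (simp add: \<xi>_def aff_reflection \<phi> \<psi> aff_reflection_orthogonal o o' algebra_simps)
  qed
  from splits_normal_derivative[OF u this \<xi>(2)] show ?thesis by (simp add: \<xi>(1))
qed simp

lemma splits_related_if_reflection:
  assumes u: "C1_minimizer u D" and \<phi>: "fst \<phi> \<noteq> 0"
    and inv: "\<And>x. u (reflection (fst \<phi>) (snd \<phi>) x) = u x"
    and \<psi>: "splits u \<psi>" "fst \<phi> \<bullet> fst \<psi> = 0"
  shows "C1_function.related D UNIV \<phi> \<psi>"
proof -
  have half: "D x *v kfield \<phi> \<psi> x = 0" if \<psi>: "splits u \<psi>" "fst \<phi> \<bullet> fst \<psi> = 0" and x: "aff \<psi> x \<ge> 0" for \<psi> x
  proof -
    let ?v = "reflect_pos (fst \<psi>) (snd \<psi>) u"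
    obtain D' where D': "C1_minimizer ?v D'" "\<And>x. aff \<psi> x \<ge> 0 \<Longrightarrow> D' x = D x"
      by (rule reflect_pos_C1_minimizer[OF u \<psi>(1)]) blast
    have \<psi>0: "fst \<psi> \<noteq> 0" using \<psi>(1) by (simp add: splits_def)
    have "D' x *v kfield \<phi> \<psi> x = 0"
    proof (rule related_if_two_reflections[OF D'(1) \<phi> \<psi>0 \<psi>(2)])
      \<comment> \<open>Orthogonal mirrors commute, so reflecting across \<open>\<psi> = 0\<close>
        preserves the symmetry in \<open>\<phi> = 0\<close>.\<close>
      show "?v (reflection (fst \<phi>) (snd \<phi>) x) = ?v x" for x
        using \<psi>(2) inv by (intro reflect_pos_reflection_orthogonal) (simp_all add: inner_commute)
      show "?v (reflection (fst \<psi>) (snd \<psi>) x) = ?v x" for x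
        by (rule reflect_pos_reflection[OF \<psi>0])
    qed
    then show ?thesis using D'(2)[OF x] by simp
  qed
  interpret C1_function u D by (rule C1_function[OF u])
  have "D x *v kfield \<phi> \<psi> x = 0" for x
  proof (cases "aff \<psi> x \<ge> 0")
    case True
    then show ?thesis using half \<psi> by blast
  next
    case False
    have m: "aff (- \<psi>) y = - aff \<psi> y" for y using aff_scaleR[of "- 1" \<psi> y] by simp
    have "D x *v kfield \<phi> (- \<psi>) x = 0"
      using half[OF splits_uminus[OF \<psi>(1)], of x] \<psi>(2) False m by simp
    moreover have "kfield \<phi> (- \<psi>) x = (- 1) *\<^sub>R kfield \<phi> \<psi> x"
      by (simp add: kfield_def m)
    ultimately have "(- 1) *\<^sub>R (D x *v kfield \<phi> \<psi> x) = 0" by (simp only: D_scaleR)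
    then show ?thesis by simp
  qed
  then show ?thesis by (simp add: related_def)
qed

section \<open>Partners of splitting functionals and their classes\<close>

lemma k_less_card: "k < CARD('N)"
  using k by simp

text \<open>The function reflected across \<open>\<phi> = 0\<close> is a minimizer with a mirror, so
  any functional that splits it and has gradient orthogonal to \<open>fst \<phi>\<close> is related
  to \<open>\<phi>\<close>. On the positive side its derivative is that of \<open>u\<close>.\<close>

lemma exists_mate:
  assumes u: "C1_minimizer u D" and \<phi>: "splits u \<phi>"
  obtains \<psi> where "fst \<psi> \<noteq> 0" "fst \<phi> \<bullet> fst \<psi> = 0" "C1_function.related D {x. aff \<phi> x > 0} \<phi> \<psi>"
proof -
  interpret C1_function u D by (rule C1_function[OF u])
  let ?v = "reflect_pos (fst \<phi>) (snd \<phi>) u"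
  have \<phi>0: "fst \<phi> \<noteq> 0" using \<phi> by (simp add: splits_def)
  obtain D' where D': "C1_minimizer ?v D'" "\<And>x. aff \<phi> x \<ge> 0 \<Longrightarrow> D' x = D x"
    by (rule reflect_pos_C1_minimizer[OF u \<phi>]) blast
  obtain \<psi> where \<psi>: "fst \<phi> \<bullet> fst \<psi> = 0" "splits ?v \<psi>"
    using exists_splitting[OF D'(1) dim_fst_orthogonal(1)[OF \<phi>0]] k_less_card dim_fst_orthogonal(2)[OF \<phi>0]
    by (metis mem_Collect_eq)
  have "C1_function.related D' UNIV \<phi> \<psi>"
    by (rule splits_related_if_reflection[OF D'(1) \<phi>0 reflect_pos_reflection[OF \<phi>0] \<psi>(2,1)])
  then have "D' x *v kfield \<phi> \<psi> x = 0" for x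
    by (simp add: C1_function.related_def[OF C1_function[OF D'(1)]])
  then have "D x *v kfield \<phi> \<psi> x = 0" if "aff \<phi> x > 0" for x
    using D'(2)[of x] that by (metis less_imp_le)
  then have "related {x. aff \<phi> x > 0} \<phi> \<psi>" by (simp add: related_def)
  moreover have "fst \<psi> \<noteq> 0" using \<psi>(2) by (simp add: splits_def)
  ultimately show thesis using that \<psi>(1) by blast
qed

text \<open>The zero set of \<open>\<phi>\<close> has empty interior, so the stable set meets one of
  the open sides, and the partner on that side serves the whole set.\<close>

lemma exists_mate_stable:
  assumes u: "C1_minimizer u D" and \<phi>: "splits u \<phi>" and U: "C1_function.stable D U"
  obtains \<psi> where "fst \<psi> \<noteq> 0" "fst \<phi> \<bullet> fst \<psi> = 0" "C1_function.related D U \<phi> \<psi>"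
proof -
  interpret C1_function u D by (rule C1_function[OF u])
  have \<phi>0: "fst \<phi> \<noteq> 0" using \<phi> by (simp add: splits_def)
  have U': "open U" "U \<noteq> {}" using U by (auto simp: stable_def)
  have m: "aff (- \<phi>) y = - aff \<phi> y" for y using aff_scaleR[of "- 1" \<phi> y] by simp
  have "\<exists>x\<in>U. aff \<phi> x \<noteq> 0"
  proof (rule ccontr)
    assume z: "\<not> ?thesis"
    obtain x where "x \<in> U" using U' by blast
    moreover have "\<phi> \<noteq> 0" using \<phi>0 by auto
    ultimately show False
      using aff_nonzero_dense[OF _ U'(1) continuous_on_const[of U "1::real"], of \<phi> x 0] z by simp
  qed
  then obtain x where "x \<in> U" "aff \<phi> x \<noteq> 0" by blast
  then consider "aff \<phi> x > 0" | "aff (- \<phi>) x > 0" using m[of x] by linarith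
  then show thesis
  proof cases
    case 1
    obtain \<psi> where \<psi>: "fst \<psi> \<noteq> 0" "fst \<phi> \<bullet> fst \<psi> = 0" "related {x. aff \<phi> x > 0} \<phi> \<psi>"
      using exists_mate[OF u \<phi>] by metis
    have "open (U \<inter> {x. aff \<phi> x > 0})"
      by (intro open_Int U' open_Collect_less continuous_intros)
    moreover have "x \<in> U \<inter> {x. aff \<phi> x > 0}" using 1 \<open>x \<in> U\<close> by simp
    moreover have "related (U \<inter> {x. aff \<phi> x > 0}) \<phi> \<psi>"
      by (rule related_mono[OF \<psi>(3)]) simp
    ultimately have "related U \<phi> \<psi>"
      using stable_related[OF U] by blast
    then show thesis using that \<psi> by blast
  next
    case 2
    obtain \<psi> where \<psi>: "fst \<psi> \<noteq> 0" "fst (- \<phi>) \<bullet> fst \<psi> = 0" "related {x. aff (- \<phi>) x > 0} (- \<phi>) \<psi>"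
      using exists_mate[OF u splits_uminus[OF \<phi>]] by metis
    have "open (U \<inter> {x. aff (- \<phi>) x > 0})"
      by (intro open_Int U' open_Collect_less continuous_intros)
    moreover have "x \<in> U \<inter> {x. aff (- \<phi>) x > 0}" using 2 \<open>x \<in> U\<close> by simp
    moreover have "related (U \<inter> {x. aff (- \<phi>) x > 0}) (- \<phi>) \<psi>"
      by (rule related_mono[OF \<psi>(3)]) simp
    ultimately have "related U (- \<phi>) \<psi>"
      using stable_related[OF U] by blast
    then have "related U \<phi> \<psi>"
      using related_scaleR[of U "- \<phi>" \<psi> "- 1" 1] by simp
    then show thesis using that \<psi> by simp
  qed
qed

text \<open>\<open>unrelated_orthogonal\<close> compares two related pairs with orthogonal
  gradients. Both splitting functionals have such partners on the stable set, and
  \<open>\<xi>\<close> is first freed of its component along \<open>\<phi>\<close> without leaving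
  the class.\<close>

lemma splits_orthogonal_stable:
  assumes u: "C1_minimizer u D" and \<phi>: "splits u \<phi>" and \<psi>: "splits u \<psi>" and U: "C1_function.stable D U"
    and not: "\<not> C1_function.related D U \<phi> \<psi>" and \<xi>: "C1_function.related D U \<phi> \<xi>"
    and const: "\<not> C1_function.related D U \<phi> (0, 1)"
  shows "fst \<psi> \<bullet> fst \<xi> = 0"
proof -
  interpret C1_function u D by (rule C1_function[OF u])
  have \<phi>0: "fst \<phi> \<noteq> 0" and \<psi>0: "fst \<psi> \<noteq> 0" using \<phi> \<psi> by (auto simp: splits_def)
  have openU: "open U" using U by (simp add: stable_def)
  obtain \<psi>' where \<psi>': "fst \<psi>' \<noteq> 0" "fst \<psi> \<bullet> fst \<psi>' = 0" "related U \<psi> \<psi>'"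
    by (rule exists_mate_stable[OF u \<psi> U])
  have orth: "fst \<psi> \<bullet> fst \<phi> = 0 \<and> fst \<psi> \<bullet> fst \<xi> = 0"
    if \<xi>: "related U \<phi> \<xi>" "fst \<xi> \<noteq> 0" "fst \<phi> \<bullet> fst \<xi> = 0" for \<xi>
  proof -
    have "\<not> related U (\<phi> /\<^sub>R norm (fst \<phi>)) \<psi>"
      using not related_scaleR[of U "\<phi> /\<^sub>R norm (fst \<phi>)" \<psi> "norm (fst \<phi>)" 1] \<phi>0 by auto
    from unrelated_orthogonal[OF orthonormal_pair_scaled[OF \<phi>0 \<xi>(2,3)] openU related_scaleR[OF \<xi>(1)]
        \<psi>'(3) \<psi>0 \<psi>'(1,2) this]
    show ?thesis using \<phi>0 \<xi>(2) by simp
  qed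
  obtain \<phi>' where \<phi>': "fst \<phi>' \<noteq> 0" "fst \<phi> \<bullet> fst \<phi>' = 0" "related U \<phi> \<phi>'"
    by (rule exists_mate_stable[OF u \<phi> U])
  have \<phi>\<psi>: "fst \<psi> \<bullet> fst \<phi> = 0" using orth[OF \<phi>'(3,1,2)] by simp
  obtain c where c: "related U \<phi> (\<xi> - c *\<^sub>R \<phi>)" "fst \<phi> \<bullet> fst (\<xi> - c *\<^sub>R \<phi>) = 0"
    by (rule related_orthogonal_part[OF \<xi> \<phi>0])
  have "fst \<psi> \<bullet> fst (\<xi> - c *\<^sub>R \<phi>) = 0"
  proof (cases "fst (\<xi> - c *\<^sub>R \<phi>) = 0")
    case False
    then show ?thesis using orth[OF c(1) False c(2)] by simp
  qed simp
  then show ?thesis using \<phi>\<psi> by (simp add: inner_diff_right)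
qed

lemma exists_splitting_orthogonal:
  assumes u: "C1_minimizer u D"
  obtains \<phi> where "splits u \<phi>" "\<phi> \<bullet> w = 0"
proof -
  have "subspace {\<phi> :: (real ^ 'N) \<times> real. \<phi> \<bullet> w = 0}"
    by (auto simp: subspace_def inner_add_left)
  moreover have "k < dim {\<phi> :: (real ^ 'N) \<times> real. \<phi> \<bullet> w = 0}"
  proof (cases "w = 0")
    case True
    then show ?thesis using k_less_card by simp
  next
    case False
    then show ?thesis using dim_hyperplane[OF False] k_less_card by (simp add: inner_commute)
  qed
  ultimately show thesis using exists_splitting[OF u] that by (metis (mono_tags, lifting) mem_Collect_eq)
qed

text \<open>
  A subspace of least dimension among those in which the splitting functionals meet every hyperplane.
  On a stable set the splitting functionals fall into mutually orthogonal classes; if the subspace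
  were not contained in a single class, hyperplanes avoiding the splitting functionals of two
  complementary smaller subspaces could be combined.
\<close>

lemma exists_reflection_invariance:
  assumes u: "C1_minimizer u D"
  obtains \<phi> where "fst \<phi> \<noteq> 0" "\<And>x. u (reflection (fst \<phi>) (snd \<phi>) x) = u x"
proof -
  interpret C1_function u D by (rule C1_function[OF u])
  define P where "P B \<longleftrightarrow> subspace B \<and> (\<forall>w. \<exists>\<phi>\<in>B. splits u \<phi> \<and> \<phi> \<bullet> w = 0)" for B :: "((real ^ 'N) \<times> real) set"
  have "P UNIV" unfolding P_def using exists_splitting_orthogonal[OF u] by (metis UNIV_I subspace_UNIV)
  then obtain B where B: "P B" "\<And>B'. P B' \<Longrightarrow> dim B \<le> dim B'"
    using ex_has_least_nat[of P UNIV dim] by blast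
  have subB: "subspace B" and meet: "\<And>w. \<exists>\<phi>\<in>B. splits u \<phi> \<and> \<phi> \<bullet> w = 0"
    using B(1) by (auto simp: P_def)
  have notP: "\<exists>w. \<forall>\<phi>\<in>B'. splits u \<phi> \<longrightarrow> \<phi> \<bullet> w \<noteq> 0" if "subspace B'" "B' \<subseteq> B" "B' \<noteq> B" for B'
  proof -
    have "dim B' < dim B"
      using that subB dim_psubset[of B' B] by (metis psubsetI span_eq_iff)
    then have "\<not> P B'" using B(2)[of B'] by auto
    then show ?thesis using that(1) by (auto simp: P_def)
  qed
  have splits0: "fst \<phi> \<noteq> 0" if "splits u \<phi>" for \<phi> using that by (simp add: splits_def)
  have class_stable: "related U \<phi> \<psi>" if U: "stable U" and \<phi>: "\<phi> \<in> B" and \<psi>: "\<psi> \<in> B" for U \<phi> \<psi>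
  proof -
    have openU: "open U" using U by (simp add: stable_def)
    have sub_class: "subspace ({\<psi>. related U \<phi> \<psi>} \<inter> B)" for \<phi>
      by (intro subspace_inter subspace_related subB)
    have "\<exists>\<phi>\<in>B. splits u \<phi> \<and> B \<subseteq> {\<psi>. related U \<phi> \<psi>}"
    proof (rule ccontr)
      assume "\<not> ?thesis"
      then have contra: "\<And>\<phi>. \<phi> \<in> B \<Longrightarrow> splits u \<phi> \<Longrightarrow> {\<psi>. related U \<phi> \<psi>} \<inter> B \<noteq> B" by blast
      show False
      proof (cases "\<forall>\<phi>\<in>B. splits u \<phi> \<longrightarrow> related U \<phi> (0, 1)")
        case True
        obtain \<phi> where \<phi>: "\<phi> \<in> B" "splits u \<phi>" using meet by blast
        \<comment> \<open>All splitting functionals in \<open>B\<close> are related to the constant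
          \<open>(0, 1)\<close> and, through it, to each other.\<close>
        have "related U \<phi> \<psi>" if "\<psi> \<in> B" "splits u \<psi>" for \<psi>
          using related_trans[OF openU, of "(0, 1)" \<phi> \<psi>] True \<phi> that related_sym by (auto simp: zero_prod_def)
        moreover obtain w where "\<forall>\<psi>\<in>{\<psi>. related U \<phi> \<psi>} \<inter> B. splits u \<psi> \<longrightarrow> \<psi> \<bullet> w \<noteq> 0"
          using notP[OF sub_class _ contra[OF \<phi>]] by blast
        ultimately show False using meet[of w] by blast
      next
        case False
        then obtain \<phi> where \<phi>: "\<phi> \<in> B" "splits u \<phi>" "\<not> related U \<phi> (0, 1)" by blast
        define B1 where "B1 = {\<psi>. related U \<phi> \<psi>} \<inter> B"
        define B2 where "B2 = {\<psi>\<in>B. \<forall>\<xi>\<in>{\<xi>. related U \<phi> \<xi>}. fst \<psi> \<bullet> fst \<xi> = 0}"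
        have sub1: "subspace B1" unfolding B1_def by (rule sub_class)
        have sub2: "subspace B2"
          unfolding B2_def using subB by (auto simp: subspace_def inner_add_left)
        have "\<phi> \<notin> B2"
        proof
          assume "\<phi> \<in> B2"
          then have "fst \<phi> \<bullet> fst \<phi> = 0" using related_refl[of U \<phi>] unfolding B2_def by blast
          then show False using splits0[OF \<phi>(2)] by simp
        qed
        then have "B2 \<noteq> B" "B2 \<subseteq> B" using \<phi>(1) by (auto simp: B2_def)
        then obtain w2 where w2: "\<And>\<psi>. \<psi> \<in> B2 \<Longrightarrow> splits u \<psi> \<Longrightarrow> \<psi> \<bullet> w2 \<noteq> 0" using notP[OF sub2] by blast
        obtain w1 where w1: "\<And>\<psi>. \<psi> \<in> B1 \<Longrightarrow> splits u \<psi> \<Longrightarrow> \<psi> \<bullet> w1 \<noteq> 0"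
          using notP[OF sub1] contra[OF \<phi>(1,2)] by (auto simp: B1_def)
        \<comment> \<open>A nonzero common element would have gradient 0 and so be a constant in the
          class of \<open>\<phi>\<close>, against the choice of \<open>\<phi>\<close>.\<close>
        have "\<psi> = 0" if "\<psi> \<in> B1" "\<psi> \<in> B2" for \<psi>
        proof (rule ccontr)
          assume "\<psi> \<noteq> 0"
          have "fst \<psi> \<bullet> fst \<psi> = 0" using that unfolding B1_def B2_def by blast
          then have "fst \<psi> = 0" by simp
          then have "snd \<psi> \<noteq> 0" using \<open>\<psi> \<noteq> 0\<close> by (simp add: prod_eq_iff)
          have "(1 / snd \<psi>) *\<^sub>R \<psi> \<in> {\<psi>. related U \<phi> \<psi>}"
            using that(1) by (intro subspace_scale subspace_related) (simp add: B1_def)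
          moreover have "(1 / snd \<psi>) *\<^sub>R \<psi> = (0, 1)"
            using \<open>fst \<psi> = 0\<close> \<open>snd \<psi> \<noteq> 0\<close> by (simp add: prod_eq_iff)
          ultimately show False using \<phi>(3) by simp
        qed
        then have "B1 \<inter> B2 = {0}" using subspace_0[OF sub1] subspace_0[OF sub2] by blast
        from exists_common_functional[OF sub1 sub2 this] obtain w
          where w: "\<And>\<psi>. \<psi> \<in> B1 \<Longrightarrow> \<psi> \<bullet> w = \<psi> \<bullet> w1" "\<And>\<psi>. \<psi> \<in> B2 \<Longrightarrow> \<psi> \<bullet> w = \<psi> \<bullet> w2" by metis
        have "\<psi> \<in> B1 \<union> B2" if "\<psi> \<in> B" "splits u \<psi>" for \<psi>
          using splits_orthogonal_stable[OF u \<phi>(2) that(2) U _ _ \<phi>(3)] that(1) by (auto simp: B1_def B2_def)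
        then show False using meet[of w] w w1 w2 by (metis Un_iff)
      qed
    qed
    then obtain \<xi> where \<xi>: "splits u \<xi>" "B \<subseteq> {\<psi>. related U \<xi> \<psi>}" by blast
    then have "related U \<xi> \<phi>" "related U \<xi> \<psi>" using \<phi> \<psi> by blast+
    moreover have "\<xi> \<noteq> 0" using splits0[OF \<xi>(1)] by auto
    ultimately show ?thesis using related_trans[OF openU] related_sym by blast
  qed
  obtain \<phi> where \<phi>: "\<phi> \<in> B" "splits u \<phi>" using meet by blast
  \<comment> \<open>The hyperplane orthogonal to \<open>\<phi>\<close> itself yields a splitting
    functional not proportional to \<open>\<phi>\<close>.\<close>
  obtain \<psi> where \<psi>: "\<psi> \<in> B" "splits u \<psi>" "\<psi> \<bullet> \<phi> = 0" using meet by blast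
  have \<phi>0: "fst \<phi> \<noteq> 0" using splits0 \<phi> by blast
  \<comment> \<open>\<open>B\<close> was chosen independently of the stable set, so the same two
    functionals are related on every stable set.\<close>
  have "related UNIV \<phi> \<psi>" using class_stable \<phi> \<psi> by (intro related_UNIV_if_stable) blast
  then obtain c where c: "related UNIV \<phi> (\<psi> - c *\<^sub>R \<phi>)" "fst \<phi> \<bullet> fst (\<psi> - c *\<^sub>R \<phi>) = 0"
    using related_orthogonal_part[OF _ \<phi>0] by blast
  have "\<psi> - c *\<^sub>R \<phi> \<noteq> 0"
  proof
    assume "\<psi> - c *\<^sub>R \<phi> = 0"
    then have "\<psi> \<bullet> \<psi> = c * (\<psi> \<bullet> \<phi>)" by (metis eq_iff_diff_eq_0 inner_scaleR_right)
    then have "\<psi> = 0" using \<psi>(3) by simp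
    then show False using splits0[OF \<psi>(2)] by simp
  qed
  then have "fst (\<psi> - c *\<^sub>R \<phi>) \<noteq> 0"
    using C1_minimizer_nonconstant_related[OF u \<phi>0 c(1)] by blast
  from reflection_invariant[OF \<phi>0 this c(2,1)] show thesis using that[OF \<phi>0] by blast
qed

text \<open>A splitting functional in \<open>L\<close> is related to \<open>\<phi>\<close>, so the
  orthogonal complement of \<open>A \<inter> L\<close> in \<open>L\<close> contains none and has
  dimension at most k. This leaves at least N - k dimensions for \<open>A \<inter> L\<close>, and
  \<open>\<phi>\<close> adds one more.\<close>

lemma exists_large_class:
  assumes u: "C1_minimizer u D"
  obtains B where "subspace B" "dim B = CARD('N) + 1 - k"
    "\<And>\<phi> \<psi>. \<phi> \<in> B \<Longrightarrow> \<psi> \<in> B \<Longrightarrow> C1_function.related D UNIV \<phi> \<psi>"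
    "\<And>\<phi>. \<phi> \<in> B \<Longrightarrow> fst \<phi> = 0 \<Longrightarrow> \<phi> = 0"
proof -
  interpret C1_function u D by (rule C1_function[OF u])
  obtain \<phi> where \<phi>: "fst \<phi> \<noteq> 0" "\<And>x. u (reflection (fst \<phi>) (snd \<phi>) x) = u x"
    using exists_reflection_invariance[OF u] by blast
  define A where "A = {\<psi>. related UNIV \<phi> \<psi>}"
  define L where "L = {\<psi> :: (real ^ 'N) \<times> real. fst \<phi> \<bullet> fst \<psi> = 0}"
  have subA: "subspace A" unfolding A_def by (rule subspace_related)
  note L = dim_fst_orthogonal[OF \<phi>(1), folded L_def]
  have subAL: "subspace (A \<inter> L)" by (intro subspace_inter subA L)
  have "CARD('N) - k \<le> dim (A \<inter> L)"
  proof (rule ccontr)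
    assume "\<not> ?thesis"
    let ?M = "{y \<in> L. \<forall>x\<in>A \<inter> L. orthogonal x y}"
    have "dim ?M + dim (A \<inter> L) = CARD('N)"
      using dim_subspace_orthogonal_to_vectors[OF subAL L(1)] L(2) by simp
    with \<open>\<not> ?thesis\<close> have "k < dim ?M" by linarith
    moreover have "subspace ?M"
      using L(1) by (auto simp: subspace_def orthogonal_def inner_add_right)
    ultimately obtain \<psi> where \<psi>: "\<psi> \<in> ?M" "splits u \<psi>" using exists_splitting[OF u, of ?M] by blast
    then have "related UNIV \<phi> \<psi>"
      by (intro splits_related_if_reflection[OF u \<phi>]) (auto simp: L_def)
    then have "orthogonal \<psi> \<psi>" using \<psi>(1) by (auto simp: A_def)
    then show False using \<psi>(2) by (simp add: orthogonal_def splits_def)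
  qed
  moreover have "dim (A \<inter> L) < dim A"
  proof (rule dim_psubset)
    have "\<phi> \<in> A" "\<phi> \<notin> L" using \<phi>(1) related_refl by (auto simp: A_def L_def)
    moreover have "span A = A" "span (A \<inter> L) = A \<inter> L"
      using subA subAL by (simp_all only: span_eq_iff)
    ultimately show "span (A \<inter> L) \<subset> span A" by blast
  qed
  ultimately have "CARD('N) + 1 - k \<le> dim A" using k_less_card by linarith
  then obtain B where B: "subspace B" "B \<subseteq> span A" "dim B = CARD('N) + 1 - k"
    by (rule choose_subspace_of_subspace)
  have BA: "B \<subseteq> A" using B(2) span_eq_iff[THEN iffD2, OF subA] by simp
  have \<phi>0: "\<phi> \<noteq> 0" using \<phi>(1) by auto
  show thesis
  proof (rule that[OF B(1,3)])
    show "related UNIV \<psi> \<xi>" if "\<psi> \<in> B" "\<xi> \<in> B" for \<psi> \<xi>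
    proof -
      have "related UNIV \<phi> \<psi>" "related UNIV \<phi> \<xi>" using that BA by (auto simp: A_def)
      then show ?thesis using related_trans[OF open_UNIV \<phi>0] related_sym by blast
    qed
    show "\<psi> = 0" if "\<psi> \<in> B" "fst \<psi> = 0" for \<psi>
      using C1_minimizer_nonconstant_related[OF u \<phi>(1) _ that(2)] that(1) BA by (auto simp: A_def)
  qed
qed

text \<open>Dimension 2 provides a functional not proportional to \<open>\<phi>\<close>; its part
  with orthogonal gradient is not constant, so it spans with \<open>\<phi>\<close> a genuine family
  of rotations.\<close>

lemma class_reflection_invariant:
  assumes u: "C1_minimizer u D" and B: "subspace B" "dim B \<ge> 2"
    and r: "\<And>\<phi> \<psi>. \<phi> \<in> B \<Longrightarrow> \<psi> \<in> B \<Longrightarrow> C1_function.related D UNIV \<phi> \<psi>"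
    and \<phi>: "\<phi> \<in> B" "fst \<phi> \<noteq> 0"
  shows "u (reflection (fst \<phi>) (snd \<phi>) x) = u x"
proof -
  interpret C1_function u D by (rule C1_function[OF u])
  have "\<not> B \<subseteq> span {\<phi>}"
  proof
    assume "B \<subseteq> span {\<phi>}"
    then have "dim B \<le> card {\<phi>}" by (intro dim_le_card) auto
    then show False using B(2) by simp
  qed
  then obtain \<psi> where \<psi>: "\<psi> \<in> B" "\<psi> \<notin> span {\<phi>}" by blast
  obtain c where c: "related UNIV \<phi> (\<psi> - c *\<^sub>R \<phi>)" "fst \<phi> \<bullet> fst (\<psi> - c *\<^sub>R \<phi>) = 0"
    by (rule related_orthogonal_part[OF r[OF \<phi>(1) \<psi>(1)] \<phi>(2)])
  have "\<psi> - c *\<^sub>R \<phi> \<noteq> 0" using \<psi>(2) by (auto simp: span_singleton)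
  then have "fst (\<psi> - c *\<^sub>R \<phi>) \<noteq> 0"
    using C1_minimizer_nonconstant_related[OF u \<phi>(2) c(1)] by blast
  from reflection_invariant[OF \<phi>(2) this c(2,1)] show ?thesis .
qed

text \<open>\<open>V\<close> is the common zero set of \<open>B\<close>: a point plus the orthogonal
  complement of the gradients, of dimension k - 1. Distinct points with the same projection and
  distance are mirror images in a hyperplane from \<open>B\<close>.\<close>

lemma radially_symmetric_C1_minimizer:
  assumes u: "C1_minimizer u D"
  obtains V where "affine V" "aff_dim V = int k - 1" "radially_symmetric u V"
proof -
  obtain B where B: "subspace B" "dim B = CARD('N) + 1 - k"
    "\<And>\<phi> \<psi>. \<phi> \<in> B \<Longrightarrow> \<psi> \<in> B \<Longrightarrow> C1_function.related D UNIV \<phi> \<psi>"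
    "\<And>\<phi>. \<phi> \<in> B \<Longrightarrow> fst \<phi> = 0 \<Longrightarrow> \<phi> = 0"
    using exists_large_class[OF u] by metis
  have inv: "u (reflection (fst \<phi>) (snd \<phi>) x) = u x" if "\<phi> \<in> B" "fst \<phi> \<noteq> 0" for \<phi> x
    using class_reflection_invariant[OF u B(1) _ B(3) that] B(2) k_less_card by simp
  \<comment> \<open>The part \<open>q\<close> of the constant \<open>(0, 1)\<close> orthogonal to
    \<open>B\<close> is nonzero since \<open>B\<close> contains no nonzero constant. Its second
    component equals \<open>q \<bullet> q\<close>, and dividing by it turns orthogonality to
    \<open>B\<close> into a common zero \<open>x0\<close>.\<close>
  obtain p q where pq: "p \<in> span B" "\<And>w. w \<in> span B \<Longrightarrow> orthogonal q w" "(0, 1) = p + q"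
    using orthogonal_subspace_decomp_exists[of B "(0, 1) :: (real ^ 'N) \<times> real"] by metis
  have spanB: "span B = B" using B(1) by (simp add: span_eq_iff)
  have "q \<noteq> 0"
  proof
    assume "q = 0"
    then have "(0, 1) \<in> B" using pq spanB by simp
    then show False using B(4)[of "(0, 1)"] by (simp add: zero_prod_def)
  qed
  have "q \<bullet> (0, 1) = q \<bullet> q"
    using pq(2)[OF pq(1)] by (simp add: pq(3) inner_add_right orthogonal_def)
  then have "snd q \<noteq> 0" using \<open>q \<noteq> 0\<close> by (cases q) (auto simp: inner_prod_def zero_prod_def)
  define x0 where "x0 = (- 1 / snd q) *\<^sub>R fst q"
  have x0: "aff \<phi> x0 = 0" if "\<phi> \<in> B" for \<phi>
  proof -
    have "q \<bullet> \<phi> = 0" using pq(2)[of \<phi>] that spanB by (simp add: orthogonal_def)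
    then have "fst \<phi> \<bullet> fst q = - (snd q * snd \<phi>)"
      by (simp add: inner_prod_def inner_commute add_eq_0_iff)
    then show ?thesis using \<open>snd q \<noteq> 0\<close> by (simp add: aff_def x0_def)
  qed
  define W where "W = fst ` B"
  have subW: "subspace W" unfolding W_def by (intro linear_subspace_image linear_fst B(1))
  have dimW: "dim W = CARD('N) + 1 - k"
  proof -
    have "inj_on fst B"
    proof (rule inj_onI)
      fix x y assume "x \<in> B" "y \<in> B" "fst x = fst y"
      then have "x - y = 0" by (intro B(4) subspace_diff[OF B(1)]) auto
      then show "x = y" by simp
    qed
    then show ?thesis
      using dim_image_eq[of fst B] B(2) spanB by (simp add: W_def linear_fst)
  qed
  define W' where "W' = {y. \<forall>x\<in>W. orthogonal x y}"
  have subW': "subspace W'" by (auto simp: W'_def subspace_def orthogonal_def inner_add_right)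
  have dimW': "dim W' + 1 = k"
    using dim_subspace_orthogonal_to_vectors[OF subW subspace_UNIV] dimW k_less_card k(1)
    by (simp add: W'_def)
  define V where "V = (+) x0 ` W'"
  have "affine V" unfolding V_def using subW' by (simp add: affine_translation[symmetric] subspace_imp_affine)
  moreover have "aff_dim V = int k - 1"
    unfolding V_def using dimW' by (simp add: aff_dim_translation_eq aff_dim_subspace[OF subW'])
  moreover have proj: "x - orth_proj V x \<in> W \<and> orth_proj V x \<in> V" for x
  proof -
    obtain w z where wz: "w \<in> span W" "\<And>y. y \<in> span W \<Longrightarrow> orthogonal z y" "x - x0 = w + z"
      using orthogonal_subspace_decomp_exists[of W "x - x0"] by metis
    have spanW: "span W = W" using subW by (simp add: span_eq_iff)
    have z: "z \<in> W'" using wz(2) spanW by (auto simp: W'_def orthogonal_commute)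
    have x: "x - (x0 + z) = w" using wz(3) by (simp add: algebra_simps)
    have "orth_proj V x = x0 + z"
    proof (rule orth_proj_unique)
      show "x0 + z \<in> V" using z by (simp add: V_def)
      fix y assume "y \<in> V"
      then obtain z' where "z' \<in> W'" "y = x0 + z'" by (auto simp: V_def)
      then show "orthogonal (x - (x0 + z)) (y - (x0 + z))"
        using subspace_diff[OF subW' _ z, of z'] wz(1) spanW unfolding x by (auto simp: W'_def)
    qed
    then show ?thesis using z x wz(1) spanW by (simp add: V_def)
  qed
  moreover have "radially_symmetric u V"
  proof -
    have eq: "u x = u y"
      if same: "orth_proj V x = orth_proj V y" "norm (x - orth_proj V x) = norm (y - orth_proj V y)" for x y
    proof (cases "x = y")
      case False
      define p where "p = orth_proj V x"
      have W: "x - p \<in> W" "y - p \<in> W" using proj[of x] proj[of y] same(1) by (auto simp: p_def)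
      have "x - y \<in> W" using subspace_diff[OF subW W] by simp
      \<comment> \<open>The zero set of this functional is the perpendicular bisector of
        \<open>x\<close> and \<open>y\<close>: it has normal \<open>x - y\<close> and passes through
        \<open>p\<close>, which is equally far from both.\<close>
      then obtain \<phi> where \<phi>: "\<phi> \<in> B" "fst \<phi> = x - y" by (auto simp: W_def)
      obtain z where z: "z \<in> W'" "p = x0 + z" using proj[of x] by (auto simp: p_def V_def)
      have "(x - y) \<bullet> z = 0" using z(1) \<open>x - y \<in> W\<close> by (auto simp: W'_def orthogonal_def)
      then have "aff \<phi> p = 0" using x0[OF \<phi>(1)] \<phi>(2) z(2) by (simp add: aff_shift)
      then have sp: "snd \<phi> = (x - y) \<bullet> p" using \<phi>(2) by (simp add: aff_def)
      have "(x - p) \<bullet> (x - p) = (y - p) \<bullet> (y - p)"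
        using same by (simp add: p_def norm_eq)
      then have "2 * ((x - y) \<bullet> x - (x - y) \<bullet> p) = (x - y) \<bullet> (x - y)"
        by (simp add: inner_diff_left inner_diff_right inner_commute)
      then have "reflection (fst \<phi>) (snd \<phi>) x = x - ((x - y) \<bullet> (x - y) / ((x - y) \<bullet> (x - y))) *\<^sub>R (x - y)"
        unfolding reflection_def \<phi>(2) sp by (simp only:)
      also have "\<dots> = y" using False by simp
      finally show ?thesis using inv[OF \<phi>(1), of x] \<phi>(2) False by simp
    qed simp
    define g where "g p r = u (SOME x. orth_proj V x = p \<and> norm (x - orth_proj V x) = r)" for p r
    have "u x = g (orth_proj V x) (norm (x - orth_proj V x))" for x
    proof -
      let ?Q = "\<lambda>y. orth_proj V y = orth_proj V x \<and> norm (y - orth_proj V y) = norm (x - orth_proj V x)"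
      have Q: "?Q (SOME y. ?Q y)" by (rule someI[of ?Q x]) simp
      show ?thesis
        unfolding g_def by (rule eq[OF conjunct1[OF Q, symmetric] conjunct2[OF Q, symmetric]])
    qed
    then show ?thesis unfolding radially_symmetric_def by blast
  qed
  ultimately show thesis using that by blast
qed

end

theorem theorem2:
  fixes X :: "(real ^ 'N \<Rightarrow> real ^ 'n) set"
    and F :: "real ^ 'n \<Rightarrow> real \<Rightarrow> real"
    and G :: "nat \<Rightarrow> real ^ 'n \<Rightarrow> real \<Rightarrow> real"
    and k :: nat
    and lam :: "nat \<Rightarrow> real"
    and u :: "real ^ 'N \<Rightarrow> real ^ 'n"
  assumes X: "function_space X"
    and F_integrable: "\<And>v. v \<in> X \<Longrightarrow> integrable lebesgue (integrand F v)"
    and G_integrable: "\<And>v j. v \<in> X \<Longrightarrow> j \<in> {1..k} \<Longrightarrow> integrable lebesgue (integrand (G j) v)"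
    and k: "1 \<le> k" "k \<le> CARD('N) - 1"
    and A1': "\<And>v a b. v \<in> X \<Longrightarrow> a \<noteq> 0 \<Longrightarrow> reflect_pos a b v \<in> X \<and> reflect_neg a b v \<in> X"
    and A2: "\<exists>v. minimizer X F k G lam v"
      "\<And>v. minimizer X F k G lam v \<Longrightarrow> \<exists>w. C1_representative v w"
    and lam: "\<exists>j\<in>{1..k}. lam j \<noteq> 0"
    and u: "minimizer X F k G lam u"
  shows "\<exists>w V. C1_representative u w \<and> affine V \<and> aff_dim V = int k - 1 \<and> radially_symmetric w V"
proof -
  interpret minimization_problem X F G k lam
    using X F_integrable G_integrable k A1' A2(2) lam by unfold_locales blast+
  obtain w D where w: "C1_representative u w" "C1_minimizer w D"
    by (rule C1_minimizer_representative[OF u])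
  obtain V where "affine V" "aff_dim V = int k - 1" "radially_symmetric w V"
    by (rule radially_symmetric_C1_minimizer[OF w(2)])
  with w(1) show ?thesis by blast
qed

end
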